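(* In the setting of the context, let $\bar u\in\mathbb V_h$ be a fixed iterate satisfying the uniform ellipticity assumption (E), and set $\eta_{\min}:=\inf_{\partial\Omega}\eta(\bar u)\ge 2\mu_e$ and $\eta_{\max}:=\sup_{\partial\Omega}\eta(\bar u)$. There exists $\gamma_0>0$, depending only on $C_T$, $C_G$, $C_K$, $h_0$, $c_L$, $C_L$, $\eta_{\min}$, $\gamma_A/E_e$ and the polynomial degree $p$ (through the combination $C_L^2/(\min\{c_L,1\}\,\eta_{\min})$ and the trace/extension/Korn constants), such that for all $h\le h_0$ and all $\gamma_D\ge\gamma_0$, $$A_h(v_h,v_h)\ \ge\ c_s\,|||v_h|||^2\qquad\forall v_h\in\mathbb V_h,$$ $$A_h(u_h,v_h)\ \le\ C_s\,|||u_h|||\,|||v_h|||\qquad\forall u_h,v_h\in\mathbb V_h,$$ where $c_s,C_s>0$ are independent of $h$ and of the position of $\partial\Omega$ relative to the mesh.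
   Context: Geometry and mesh. $\Omega\subset\mathbb R^d$ is a bounded Lipschitz domain with outward unit normal $n$; homogeneous Dirichlet conditions are imposed weakly on all of $\partial\Omega$. $\mathcal T^h$ is a quasi-uniform Cartesian background mesh generated independently of $\Omega$, $h=\max_{T}\operatorname{diam}T$. Active cells $T^h_\Omega=\{T\in\mathcal T^h:T\cap\Omega\ne\emptyset\}$, cut cells $T^h_{\partial\Omega}=\{T\in T^h_\Omega:T\cap\partial\Omega\neq\emptyset\}$, active domain $\Omega_T=\bigcup_{T\in T^h_\Omega}T$. For $p\ge1$, $\mathbb V_h=\{v\in[C^0(\Omega_T)]^d: v|_T\in[\mathcal Q_p(T)]^d\ \forall T\in T^h_\Omega\}$, with $\mathcal Q_p$ the polynomials of degree at most $p$ in each coordinate. $\|\cdot\|_D$ is the $L^2$-norm on $D$. Material. $\Psi(\mathbf F)$ is a strain-energy density, $\mathbf F(u)=I+\nabla u$, $J=\det\mathbf F$, $P=\partial\Psi/\partial\mathbf F$, $\mathbb L=\partial^2\Psi/\partial\mathbf F\otimes\partial\mathbf F$ (so $L_{ijkl}=L_{klij}$); $\mathbb L(\bar u)$ means evaluation at $I+\nabla\bar u$. $\mu_e>0$ is the shear modulus, $E_e>0$ Young's modulus. Notation: $M:\mathbb L:N=\sum M_{ij}L_{ijkl}N_{kl}$, $n\cdot B\cdot v=\sum v_iB_{ij}n_j$. Penalty weight: $\eta(\bar u)=\max\{2\mu_e,\tfrac12\|\mathbb L(\bar u)\|_1\}$ (pointwise), $\|\mathbb L\|_1=\sum_{i,j,k,l}|L_{ijkl}|$;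 $\gamma_D>0$ is the Nitsche parameter. Ghost penalty. $\mathcal F_h$ is the set of faces $F=\overline T_+\cap\overline T_-$ of positive $(d-1)$-measure with $T_+\in T^h_{\partial\Omega}$, $T_-\in T^h_\Omega$, $T_+\ne T_-$; $h_F=\operatorname{diam}F$, $n_F$ a unit normal, $[q]$ the jump of $q$ across $F$, $g_F(w,v)=\sum_{k=1}^p\frac{h_F^{2k-1}}{(k!)^2}([\partial_{n_F}^kw],[\partial_{n_F}^kv])_{L^2(F)}$, and $\gamma_A=\alpha E_e>0$. Linearised form at the iterate $\bar u$: $$A_h(u_h,v_h)=\int_\Omega\nabla u_h:\mathbb L(\bar u):\nabla v_h\,dV-\int_{\partial\Omega}n\cdot(\mathbb L(\bar u):\nabla u_h)\cdot v_h\,dS-\int_{\partial\Omega}n\cdot(\mathbb L(\bar u):\nabla v_h)\cdot u_h\,dS+\int_{\partial\Omega}\frac{\gamma_D\eta(\bar u)}{h}u_h\cdot v_h\,dS+\gamma_A\sum_{F\in\mathcal F_h}g_F(u_h,v_h).$$ Norm: $|||v|||^2=\|\nabla v\|_\Omega^2+\|h^{-1/2}v\|_{\partial\Omega}^2+|v|_s^2$, $|v|_s^2=\gamma_A\sum_{F\in\mathcal F_h}g_F(v,v)$. Assumption (E) at $\bar u$: (a) there are $0<c_L\le C_L$ with $c_L|\operatorname{sym}M|^2\le M:\mathbb L(\bar u(X)):M\le C_L|M|^2$ for all $M\in\mathbb R^{d\times d}$, $X\in\Omega_T$, where $\operatorname{sym}M=\tfrac12(M+M^\top)$; (b) $\Psi\in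 C^3$ in a neighbourhood of the deformation gradients attained on $\Omega_T$, $J(\bar u)\ge J_0>0$ on $\Omega_T$, and $\sup_{\Omega_T}|\partial^3\Psi|=:C_{L'}<\infty$. Standing inequalities (assumed known, valid for $h\le h_0$, where $h_0>0$ is a fixed reference mesh size small enough that $\Omega_T$ lies in a fixed neighbourhood of $\Omega$), with $C_T,C_G$ independent of how $\partial\Omega$ cuts the mesh and $C_K$ depending only on $\Omega$: (1) $h\|w_h\|^2_{\partial\Omega\cap T}\le C_T\|w_h\|_T^2$ for every cut cell $T$ and every polynomial $w_h$ of degree at most $p$ on $T$, applied both to $w_h=v_h$ and to $w_h=\nabla v_h$ with $v_h\in\mathbb V_h$; (2) $\|\nabla v_h\|^2_{\Omega_T}\le C_G(\|\nabla v_h\|^2_\Omega+\gamma_A^{-1}|v_h|_s^2)$ for all $v_h\in\mathbb V_h$; (3) $\|\nabla w\|_\Omega^2\le C_K(\|\operatorname{sym}\nabla w\|^2_\Omega+\|w\|^2_{\partial\Omega})$ for all $w\in(H^1(\Omega))^d$.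
   Formalization: γ₀ may depend on Young's modulus E_e as well as on γ_A/E_e; with dependence on γ_A/E_e alone the claim fails, since for E_e → 0 with Ψ fixed the ghost penalty vanishes and sliver cuts destroy coercivity. *)

theory Defs
  imports "HOL-Analysis.Analysis"
begin

section \<open>Hausdorff measure and square-integrable functions\<close>

text \<open>
  The normalised \<open>m\<close>-dimensional Hausdorff measure on the Borel sets. The factor
  \<open>unit_ball_vol m / 2 ^ m\<close> makes it agree with Lebesgue measure on \<open>m\<close>-planes and with counting
  measure for \<open>m = 0\<close>. The set function \<open>hausdorff_outer m\<close> is a metric outer measure, hence
  countably additive on the Borel sets.
\<close>

definition hausdorff_cost :: "nat \<Rightarrow> 'a::metric_space set \<Rightarrow> ennreal" where
  "hausdorff_cost m S =
     (if S = {} then 0 else ennreal (unit_ball_vol (real m) * (diameter S / 2) ^ m))"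

definition hausdorff_pre :: "nat \<Rightarrow> real \<Rightarrow> 'a::metric_space set \<Rightarrow> ennreal" where
  "hausdorff_pre m \<delta> A =
     (INF C \<in> {C :: nat \<Rightarrow> 'a set. A \<subseteq> (\<Union>i. C i) \<and> (\<forall>i. bounded (C i) \<and> diameter (C i) \<le> \<delta>)}.
        \<Sum>i. hausdorff_cost m (C i))"

definition hausdorff_outer :: "nat \<Rightarrow> 'a::metric_space set \<Rightarrow> ennreal" where
  "hausdorff_outer m A = (SUP \<delta> \<in> {0<..}. hausdorff_pre m \<delta> A)"

definition hausdorff_measure :: "nat \<Rightarrow> 'a::metric_space measure" where
  "hausdorff_measure m = measure_of UNIV (sets borel) (hausdorff_outer m)"

definition surface_on :: "(real^'d) set \<Rightarrow> (real^'d) measure" where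
  "surface_on S = restrict_space (hausdorff_measure (CARD('d) - 1)) S"

definition L2sq :: "'a measure \<Rightarrow> ('a \<Rightarrow> 'b::real_normed_vector) \<Rightarrow> ennreal" where
  "L2sq M f = (\<integral>\<^sup>+x. ennreal ((norm (f x))\<^sup>2) \<partial>M)"

definition square_integrable :: "'a measure \<Rightarrow> ('a \<Rightarrow> 'b::euclidean_space) \<Rightarrow> bool" where
  "square_integrable M f \<longleftrightarrow> f \<in> borel_measurable M \<and> L2sq M f < \<infinity>"

section \<open>Lipschitz domains and outward normals\<close>

definition lipschitz_domain :: "(real^'d) set \<Rightarrow> bool" where
  "lipschitz_domain \<Omega> \<longleftrightarrow> open \<Omega> \<and> connected \<Omega> \<and> \<Omega> \<noteq> {} \<and>
     (\<forall>x \<in> frontier \<Omega>. \<exists>r>0. \<exists>e g L. norm e = 1 \<and> L-lipschitz_on UNIV (g :: real^'d \<Rightarrow> real) \<and>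
        (\<forall>y \<in> ball x r. y \<in> \<Omega> \<longleftrightarrow> inner y e < g (y - inner y e *\<^sub>R e)))"

text \<open>
  The unit vector \<open>\<nu>\<close> is the outward normal of \<open>\<Omega>\<close> at \<open>x\<close> if the half-space orthogonal to \<open>\<nu>\<close> is
  tangent to \<open>\<Omega>\<close> at \<open>x\<close>. At most one \<open>\<nu>\<close> has this property. For a Lipschitz domain it exists at
  every point where the local graph function is differentiable, hence almost everywhere on the
  boundary; at the remaining points \<open>outward_normal\<close> is set to zero.
\<close>

definition is_outward_normal :: "(real^'d) set \<Rightarrow> real^'d \<Rightarrow> real^'d \<Rightarrow> bool" where
  "is_outward_normal \<Omega> x \<nu> \<longleftrightarrow> norm \<nu> = 1 \<and>
     (\<forall>\<epsilon>>0. \<exists>\<delta>>0. \<forall>y \<in> ball x \<delta>.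
        (inner (y - x) \<nu> < - \<epsilon> * norm (y - x) \<longrightarrow> y \<in> \<Omega>) \<and>
        (inner (y - x) \<nu> > \<epsilon> * norm (y - x) \<longrightarrow> y \<notin> \<Omega>))"

definition outward_normal :: "(real^'d) set \<Rightarrow> real^'d \<Rightarrow> real^'d" where
  "outward_normal \<Omega> x =
     (if \<exists>\<nu>. is_outward_normal \<Omega> x \<nu> then THE \<nu>. is_outward_normal \<Omega> x \<nu> else 0)"

section \<open>The Sobolev space of order one and boundary traces\<close>

primrec Ck_on :: "nat \<Rightarrow> 'a::euclidean_space set \<Rightarrow> ('a \<Rightarrow> real) \<Rightarrow> bool" where
  "Ck_on 0 U f \<longleftrightarrow> continuous_on U f"
| "Ck_on (Suc k) U f \<longleftrightarrow> (\<forall>x\<in>U. f differentiable (at x)) \<and>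
     (\<forall>b\<in>Basis. Ck_on k U (\<lambda>x. frechet_derivative f (at x) b))"

definition test_function :: "(real^'d) set \<Rightarrow> (real^'d \<Rightarrow> real) \<Rightarrow> bool" where
  "test_function \<Omega> \<phi> \<longleftrightarrow> (\<forall>k. Ck_on k UNIV \<phi>) \<and>
     (\<exists>K. compact K \<and> K \<subseteq> \<Omega> \<and> (\<forall>x. x \<notin> K \<longrightarrow> \<phi> x = 0))"

text \<open>\<open>G $ i $ j\<close> is the weak derivative of the \<open>i\<close>-th component in direction \<open>j\<close>.\<close>

definition H1_with_gradient ::
    "(real^'d) set \<Rightarrow> (real^'d \<Rightarrow> real^'d) \<Rightarrow> (real^'d \<Rightarrow> real^'d^'d) \<Rightarrow> bool" where
  "H1_with_gradient \<Omega> w G \<longleftrightarrow>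
     square_integrable (lebesgue_on \<Omega>) w \<and> square_integrable (lebesgue_on \<Omega>) G \<and>
     (\<forall>\<phi>. test_function \<Omega> \<phi> \<longrightarrow> (\<forall>i j.
        (\<integral>x. w x $ i * frechet_derivative \<phi> (at x) (axis j 1) \<partial>lebesgue_on \<Omega>)
          = - (\<integral>x. G x $ i $ j * \<phi> x \<partial>lebesgue_on \<Omega>)))"

text \<open>
  The trace operator is the continuous extension to the Sobolev space of the restriction map
  \<open>w \<mapsto> w|\<partial>\<Omega>\<close> from the dense subspace of its members that are continuous up to the boundary.
\<close>

definition H1_trace ::
    "(real^'d) set \<Rightarrow> (real^'d \<Rightarrow> real^'d) \<Rightarrow> (real^'d \<Rightarrow> real^'d^'d) \<Rightarrow> (real^'d \<Rightarrow> real^'d) \<Rightarrow> bool"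
  where
  "H1_trace \<Omega> w G \<tau> \<longleftrightarrow> square_integrable (surface_on (frontier \<Omega>)) \<tau> \<and>
     (\<exists>W H. (\<forall>k::nat. H1_with_gradient \<Omega> (W k) (H k) \<and> continuous_on (closure \<Omega>) (W k)) \<and>
        (\<lambda>k. L2sq (lebesgue_on \<Omega>) (\<lambda>x. W k x - w x)) \<longlonglongrightarrow> 0 \<and>
        (\<lambda>k. L2sq (lebesgue_on \<Omega>) (\<lambda>x. H k x - G x)) \<longlonglongrightarrow> 0 \<and>
        (\<lambda>k. L2sq (surface_on (frontier \<Omega>)) (\<lambda>x. W k x - \<tau> x)) \<longlonglongrightarrow> 0)"

section \<open>Cartesian background meshes\<close>

text \<open>
  Cells are the closed boxes of a tensor-product grid. Since \<open>\<Omega>\<close> is open, a closed cell meets \<open>\<Omega>\<close>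
  iff its interior does.
\<close>

definition cartesian_mesh :: "(real^'d) set set \<Rightarrow> bool" where
  "cartesian_mesh Th \<longleftrightarrow> (\<exists>N :: 'd \<Rightarrow> real set.
     (\<forall>i. finite (N i) \<and> 2 \<le> card (N i)) \<and>
     Th = {cbox a b | a b.
             \<forall>i. a $ i \<in> N i \<and> b $ i \<in> N i \<and> a $ i < b $ i \<and> {a $ i<..<b $ i} \<inter> N i = {}})"

definition mesh_size :: "(real^'d) set set \<Rightarrow> real" where
  "mesh_size Th = Max (diameter ` Th)"

definition quasi_uniform :: "real \<Rightarrow> (real^'d) set set \<Rightarrow> bool" where
  "quasi_uniform \<sigma> Th \<longleftrightarrow> (\<forall>T \<in> Th. \<exists>x. cball x (mesh_size Th / \<sigma>) \<subseteq> T)"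

definition active :: "(real^'d) set \<Rightarrow> (real^'d) set set \<Rightarrow> (real^'d) set set" where
  "active \<Omega> Th = {T \<in> Th. T \<inter> \<Omega> \<noteq> {}}"

definition cut :: "(real^'d) set \<Rightarrow> (real^'d) set set \<Rightarrow> (real^'d) set set" where
  "cut \<Omega> Th = {T \<in> active \<Omega> Th. T \<inter> frontier \<Omega> \<noteq> {}}"

definition active_domain :: "(real^'d) set \<Rightarrow> (real^'d) set set \<Rightarrow> (real^'d) set" where
  "active_domain \<Omega> Th = \<Union> (active \<Omega> Th)"

definition Qpoly :: "nat \<Rightarrow> (real^'d \<Rightarrow> real) set" where
  "Qpoly p = {w. \<exists>c. \<forall>x. w x = (\<Sum>\<alpha> \<in> {\<alpha> :: 'd \<Rightarrow> nat. \<forall>i. \<alpha> i \<le> p}. c \<alpha> * (\<Prod>i\<in>UNIV. (x $ i) ^ \<alpha> i))}"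

definition Vh :: "nat \<Rightarrow> (real^'d) set \<Rightarrow> (real^'d) set set \<Rightarrow> (real^'d \<Rightarrow> real^'d) set" where
  "Vh p \<Omega> Th = {v. continuous_on (active_domain \<Omega> Th) v \<and>
     (\<forall>T \<in> active \<Omega> Th. \<forall>i. \<exists>q \<in> Qpoly p. \<forall>x\<in>T. v x $ i = q x)}"

text \<open>
  Gradients follow the convention \<open>grad v x $ i $ j = \<partial>\<^sub>j v\<^sub>i(x)\<close>. A finite element function is
  differentiable off the cell faces, which suffices for volume integrals; \<open>cell_grad T v\<close> is the
  gradient of the polynomial \<open>v|T\<close> on all of the closed cell \<open>T\<close>.
\<close>

definition grad :: "(real^'d \<Rightarrow> real^'d) \<Rightarrow> real^'d \<Rightarrow> real^'d^'d" where
  "grad v x = matrix (frechet_derivative v (at x))"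

definition cell_grad :: "(real^'d) set \<Rightarrow> (real^'d \<Rightarrow> real^'d) \<Rightarrow> real^'d \<Rightarrow> real^'d^'d" where
  "cell_grad T v x = matrix (frechet_derivative v (at x within T))"

text \<open>
  Since gradients of finite element functions jump across faces, their boundary values are taken
  from inside \<open>\<Omega>\<close>: at \<open>x \<in> \<partial>\<Omega>\<close> one uses a cell containing a short segment from \<open>x\<close> along the inner
  normal. The cell is unique unless that segment runs inside a face, which happens only for a
  null set of boundary points (and where there is no normal).
\<close>

definition inner_cell :: "(real^'d) set \<Rightarrow> (real^'d) set set \<Rightarrow> real^'d \<Rightarrow> (real^'d) set" where
  "inner_cell \<Omega> Th x = (SOME T. T \<in> active \<Omega> Th \<and> x \<in> T \<and>
     (\<forall>\<^sub>F t in at_right 0. x - t *\<^sub>R outward_normal \<Omega> x \<in> T))"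

definition boundary_grad ::
    "(real^'d) set \<Rightarrow> (real^'d) set set \<Rightarrow> (real^'d \<Rightarrow> real^'d) \<Rightarrow> real^'d \<Rightarrow> real^'d^'d" where
  "boundary_grad \<Omega> Th v x = cell_grad (inner_cell \<Omega> Th x) v x"

section \<open>Ghost penalty\<close>

definition face_sides ::
    "(real^'d) set \<Rightarrow> (real^'d) set set \<Rightarrow> (real^'d) set \<Rightarrow> (real^'d) set \<times> (real^'d) set \<Rightarrow> bool" where
  "face_sides \<Omega> Th F = (\<lambda>(Tp, Tm).
     Tp \<in> cut \<Omega> Th \<and> Tm \<in> active \<Omega> Th \<and> Tp \<noteq> Tm \<and> F = Tp \<inter> Tm)"

definition ghost_faces :: "(real^'d) set \<Rightarrow> (real^'d) set set \<Rightarrow> (real^'d) set set" where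
  "ghost_faces \<Omega> Th = {F. (\<exists>S. face_sides \<Omega> Th F S) \<and>
     0 < emeasure (hausdorff_measure (CARD('d) - 1)) F}"

text \<open>
  The choices of the order of the two sides and of the sign of the normal change the jump by a sign
  only, which cancels in \<open>ghost_form\<close>.
\<close>

definition face_normal :: "(real^'d) set \<Rightarrow> real^'d" where
  "face_normal F = (SOME \<nu>. norm \<nu> = 1 \<and> (\<forall>x\<in>F. \<forall>y\<in>F. inner (x - y) \<nu> = 0))"

definition cell_dir_deriv ::
    "(real^'d) set \<Rightarrow> real^'d \<Rightarrow> nat \<Rightarrow> (real^'d \<Rightarrow> real^'d) \<Rightarrow> real^'d \<Rightarrow> real^'d" where
  "cell_dir_deriv T \<nu> k v = ((\<lambda>w x. frechet_derivative w (at x within T) \<nu>) ^^ k) v"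

definition normal_jump ::
    "(real^'d) set \<Rightarrow> (real^'d) set set \<Rightarrow> (real^'d) set \<Rightarrow> nat \<Rightarrow> (real^'d \<Rightarrow> real^'d) \<Rightarrow> real^'d \<Rightarrow> real^'d"
  where
  "normal_jump \<Omega> Th F k v x = (let (Tp, Tm) = (SOME S. face_sides \<Omega> Th F S) in
     cell_dir_deriv Tp (face_normal F) k v x - cell_dir_deriv Tm (face_normal F) k v x)"

definition ghost_form ::
    "nat \<Rightarrow> (real^'d) set \<Rightarrow> (real^'d) set set \<Rightarrow> (real^'d) set
      \<Rightarrow> (real^'d \<Rightarrow> real^'d) \<Rightarrow> (real^'d \<Rightarrow> real^'d) \<Rightarrow> real" where
  "ghost_form p \<Omega> Th F w v = (\<Sum>k = 1..p. diameter F ^ (2 * k - 1) / (fact k)\<^sup>2 *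
     (\<integral>x. inner (normal_jump \<Omega> Th F k w x) (normal_jump \<Omega> Th F k v x) \<partial>surface_on F))"

definition ghost_penalty ::
    "nat \<Rightarrow> real \<Rightarrow> (real^'d) set \<Rightarrow> (real^'d) set set
      \<Rightarrow> (real^'d \<Rightarrow> real^'d) \<Rightarrow> (real^'d \<Rightarrow> real^'d) \<Rightarrow> real" where
  "ghost_penalty p \<gamma>A \<Omega> Th w v = \<gamma>A * (\<Sum>F \<in> ghost_faces \<Omega> Th. ghost_form p \<Omega> Th F w v)"

section \<open>Hyperelastic material\<close>

type_synonym 'd tensor4 = "'d \<Rightarrow> 'd \<Rightarrow> 'd \<Rightarrow> 'd \<Rightarrow> real"

definition stress :: "(real^'d^'d \<Rightarrow> real) \<Rightarrow> real^'d^'d \<Rightarrow> real^'d^'d" where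
  "stress \<Psi> F = (\<chi> i j. frechet_derivative \<Psi> (at F) (axis i (axis j 1)))"

definition elasticity :: "(real^'d^'d \<Rightarrow> real) \<Rightarrow> real^'d^'d \<Rightarrow> 'd tensor4" where
  "elasticity \<Psi> F = (\<lambda>i j k l.
     frechet_derivative (\<lambda>G. stress \<Psi> G $ i $ j) (at F) (axis k (axis l 1)))"

definition third_norm :: "(real^'d^'d \<Rightarrow> real) \<Rightarrow> real^'d^'d \<Rightarrow> real" where
  "third_norm \<Psi> F = sqrt (\<Sum>i\<in>UNIV. \<Sum>j\<in>UNIV. \<Sum>k\<in>UNIV. \<Sum>l\<in>UNIV. \<Sum>m\<in>UNIV. \<Sum>n\<in>UNIV.
     (frechet_derivative (\<lambda>G. elasticity \<Psi> G i j k l) (at F) (axis m (axis n 1)))\<^sup>2)"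

definition tensor_apply :: "'d::finite tensor4 \<Rightarrow> real^'d^'d \<Rightarrow> real^'d^'d" where
  "tensor_apply L N = (\<chi> i j. \<Sum>k\<in>UNIV. \<Sum>l\<in>UNIV. L i j k l * N $ k $ l)"

definition tensor_l1 :: "'d::finite tensor4 \<Rightarrow> real" where
  "tensor_l1 L = (\<Sum>i\<in>UNIV. \<Sum>j\<in>UNIV. \<Sum>k\<in>UNIV. \<Sum>l\<in>UNIV. \<bar>L i j k l\<bar>)"

definition sym_part :: "real^'d^'d \<Rightarrow> real^'d^'d" where
  "sym_part M = (1/2) *\<^sub>R (M + transpose M)"

text \<open>The deformation gradients of \<open>u\<close> attained on the active domain, from either side on faces.\<close>

definition attained_gradients ::
    "(real^'d) set \<Rightarrow> (real^'d) set set \<Rightarrow> (real^'d \<Rightarrow> real^'d) \<Rightarrow> (real^'d^'d) set" where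
  "attained_gradients \<Omega> Th u = {mat 1 + cell_grad T u X | T X. T \<in> active \<Omega> Th \<and> X \<in> T}"

definition uniformly_elliptic ::
    "real \<Rightarrow> real \<Rightarrow> (real^'d) set \<Rightarrow> (real^'d) set set \<Rightarrow> (real^'d^'d \<Rightarrow> real)
      \<Rightarrow> (real^'d \<Rightarrow> real^'d) \<Rightarrow> bool" where
  "uniformly_elliptic cL CL \<Omega> Th \<Psi> u \<longleftrightarrow>
     (\<forall>F \<in> attained_gradients \<Omega> Th u. \<forall>M.
        cL * (norm (sym_part M))\<^sup>2 \<le> inner M (tensor_apply (elasticity \<Psi> F) M) \<and>
        inner M (tensor_apply (elasticity \<Psi> F) M) \<le> CL * (norm M)\<^sup>2) \<and>
     (\<exists>U. open U \<and> attained_gradients \<Omega> Th u \<subseteq> U \<and> Ck_on 3 U \<Psi>) \<and>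
     (\<exists>J0>0. \<forall>F \<in> attained_gradients \<Omega> Th u. J0 \<le> det F) \<and>
     bdd_above (third_norm \<Psi> ` attained_gradients \<Omega> Th u)"

section \<open>The linearised Nitsche form and the energy norm\<close>

definition volume_elasticity ::
    "(real^'d^'d \<Rightarrow> real) \<Rightarrow> (real^'d \<Rightarrow> real^'d) \<Rightarrow> real^'d \<Rightarrow> 'd tensor4" where
  "volume_elasticity \<Psi> u x = elasticity \<Psi> (mat 1 + grad u x)"

definition boundary_elasticity ::
    "(real^'d) set \<Rightarrow> (real^'d) set set \<Rightarrow> (real^'d^'d \<Rightarrow> real) \<Rightarrow> (real^'d \<Rightarrow> real^'d)
      \<Rightarrow> real^'d \<Rightarrow> 'd tensor4" where
  "boundary_elasticity \<Omega> Th \<Psi> u x = elasticity \<Psi> (mat 1 + boundary_grad \<Omega> Th u x)"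

definition penalty_weight ::
    "(real^'d) set \<Rightarrow> (real^'d) set set \<Rightarrow> (real^'d^'d \<Rightarrow> real) \<Rightarrow> real \<Rightarrow> (real^'d \<Rightarrow> real^'d)
      \<Rightarrow> real^'d \<Rightarrow> real" where
  "penalty_weight \<Omega> Th \<Psi> \<mu> u x = max (2 * \<mu>) (tensor_l1 (boundary_elasticity \<Omega> Th \<Psi> u x) / 2)"

definition A_form ::
    "nat \<Rightarrow> (real^'d) set \<Rightarrow> (real^'d) set set \<Rightarrow> (real^'d^'d \<Rightarrow> real) \<Rightarrow> real \<Rightarrow> real \<Rightarrow> real
      \<Rightarrow> (real^'d \<Rightarrow> real^'d) \<Rightarrow> (real^'d \<Rightarrow> real^'d) \<Rightarrow> (real^'d \<Rightarrow> real^'d) \<Rightarrow> real" where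
  "A_form p \<Omega> Th \<Psi> \<mu> \<gamma>A \<gamma>D ubar u v =
     (\<integral>x. inner (grad u x) (tensor_apply (volume_elasticity \<Psi> ubar x) (grad v x)) \<partial>lebesgue_on \<Omega>)
     - (\<integral>x. inner (v x)
          (tensor_apply (boundary_elasticity \<Omega> Th \<Psi> ubar x) (boundary_grad \<Omega> Th u x)
             *v outward_normal \<Omega> x) \<partial>surface_on (frontier \<Omega>))
     - (\<integral>x. inner (u x)
          (tensor_apply (boundary_elasticity \<Omega> Th \<Psi> ubar x) (boundary_grad \<Omega> Th v x)
             *v outward_normal \<Omega> x) \<partial>surface_on (frontier \<Omega>))
     + (\<integral>x. \<gamma>D * penalty_weight \<Omega> Th \<Psi> \<mu> ubar x / mesh_size Th * inner (u x) (v x)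
          \<partial>surface_on (frontier \<Omega>))
     + ghost_penalty p \<gamma>A \<Omega> Th u v"

definition energy_norm ::
    "nat \<Rightarrow> real \<Rightarrow> (real^'d) set \<Rightarrow> (real^'d) set set \<Rightarrow> (real^'d \<Rightarrow> real^'d) \<Rightarrow> real" where
  "energy_norm p \<gamma>A \<Omega> Th v = sqrt (
     (\<integral>x. (norm (grad v x))\<^sup>2 \<partial>lebesgue_on \<Omega>)
     + (\<integral>x. (norm (mesh_size Th powr (-1/2) *\<^sub>R v x))\<^sup>2 \<partial>surface_on (frontier \<Omega>))
     + ghost_penalty p \<gamma>A \<Omega> Th v v)"

section \<open>Trace, extension and Korn inequalities\<close>

text \<open>
  The trace inequality is stated for scalar polynomials; summing over components gives it, with the
  same constant, for vector and matrix valued ones.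
\<close>

definition trace_inequality ::
    "nat \<Rightarrow> real \<Rightarrow> (real^'d) set \<Rightarrow> (real^'d) set set \<Rightarrow> bool" where
  "trace_inequality p CT \<Omega> Th \<longleftrightarrow> (\<forall>T \<in> cut \<Omega> Th. \<forall>w \<in> Qpoly p.
     ennreal (mesh_size Th) * L2sq (surface_on (frontier \<Omega> \<inter> T)) w
       \<le> ennreal CT * L2sq (lebesgue_on T) w)"

definition extension_inequality ::
    "nat \<Rightarrow> real \<Rightarrow> real \<Rightarrow> (real^'d) set \<Rightarrow> (real^'d) set set \<Rightarrow> bool" where
  "extension_inequality p \<gamma>A CG \<Omega> Th \<longleftrightarrow> (\<forall>v \<in> Vh p \<Omega> Th.
     L2sq (lebesgue_on (active_domain \<Omega> Th)) (grad v)
       \<le> ennreal CG * (L2sq (lebesgue_on \<Omega>) (grad v) + ennreal (ghost_penalty p \<gamma>A \<Omega> Th v v / \<gamma>A)))"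

definition korn_inequality :: "real \<Rightarrow> (real^'d) set \<Rightarrow> bool" where
  "korn_inequality CK \<Omega> \<longleftrightarrow> (\<forall>w G \<tau>. H1_with_gradient \<Omega> w G \<and> H1_trace \<Omega> w G \<tau> \<longrightarrow>
     L2sq (lebesgue_on \<Omega>) G
       \<le> ennreal CK * (L2sq (lebesgue_on \<Omega>) (\<lambda>x. sym_part (G x)) + L2sq (surface_on (frontier \<Omega>)) \<tau>))"

end

theory Submission
  imports Defs
begin

text \<open>
  Symmetry of second derivatives makes the pointwise elasticity tensor a symmetric positive
  semidefinite form bounded by \<open>C_L\<close>, so Cauchy--Schwarz gives \<open>\<bar>L : N\<bar> \<le> C_L \<bar>N\<bar>\<close> from the
  quadratic upper bound alone. By the trace and extension inequalities the boundary gradients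
  satisfy \<open>h \<parallel>\<nabla>v\<parallel>\<^sup>2 \<le> C_T C_G (\<parallel>\<nabla>v\<parallel>\<^sup>2 + |v|\<^sub>s\<^sup>2 / \<gamma>\<^sub>A)\<close>, and Young's inequality with weight
  \<open>min c_L 1 * \<epsilon>\<close> absorbs the consistency terms into the volume, penalty and ghost terms. Korn's
  inequality turns the symmetric gradient into the full one at the price of a boundary term, which
  the penalty also dominates, since \<open>min c_L 1 \<le> C_L\<^sup>2 / min c_L 1\<close>.

  Hausdorff measure enters only through two upper bounds: mesh faces have finite measure by an
  explicit cover, and the boundary has finite measure by the trace inequality for constants.
\<close>

section \<open>The elasticity tensor\<close>

text \<open>Most of the length goes into giving the integrals meaning. The forms are Bochner
  integrals, which are 0 when the integrand is not integrable, while the trace, extension and Korn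
  inequalities use the extended-valued \<open>L2sq\<close>; passing between them needs measurability
  and finiteness of the quadratic integrands. The delicate one is \<open>boundary_grad\<close>,
  whose cell is selected by \<open>SOME\<close> along the inner normal: its measurability rests on
  that of the normal and on the finite number of cells. Korn's inequality speaks of weak gradients,
  so the cellwise gradient must be shown to be the weak one; a global Lipschitz argument does this
  without face integrals. Bilinear terms are estimated by Young's inequality with a free weight t:
  coercivity fixes t, whereas for boundedness all terms share one t, which is optimised only at the
  end. In the threshold \<open>\<kappa> * (1 / \<epsilon> + h\<^sub>0 + 1)\<close> the summand
  \<open>1 / \<epsilon>\<close> pays for the consistency terms, \<open>h\<^sub>0\<close> for the
  boundary term of Korn, and 1 is what remains for the norm.\<close>

lemma mixed_difference_mvt:
  fixes f :: "'a::real_normed_vector \<Rightarrow> real"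
  assumes f: "\<And>x. x \<in> U \<Longrightarrow> f differentiable at x"
    and g: "\<And>x. x \<in> U \<Longrightarrow> (\<lambda>x. frechet_derivative f (at x) b) differentiable at x"
    and r: "ball a r \<subseteq> U" "s * norm b + t * norm c < r" and st: "0 < s" "0 < t"
  shows "\<exists>y. dist a y \<le> s * norm b + t * norm c \<and>
    f (a + s *\<^sub>R b + t *\<^sub>R c) - f (a + s *\<^sub>R b) - f (a + t *\<^sub>R c) + f a
      = s * t * frechet_derivative (\<lambda>x. frechet_derivative f (at x) b) (at y) c"
proof -
  define g where "g x = frechet_derivative f (at x) b" for x
  have dist_le: "dist a (a + \<sigma> *\<^sub>R b + \<tau> *\<^sub>R c) \<le> s * norm b + t * norm c"
    if "0 \<le> \<sigma>" "\<sigma> \<le> s" "0 \<le> \<tau>" "\<tau> \<le> t" for \<sigma> \<tau>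
  proof -
    have "dist a (a + \<sigma> *\<^sub>R b + \<tau> *\<^sub>R c) = norm (\<sigma> *\<^sub>R b + \<tau> *\<^sub>R c)"
      by (simp add: dist_norm norm_minus_commute algebra_simps)
    also have "\<dots> \<le> \<sigma> * norm b + \<tau> * norm c"
      using norm_triangle_ineq[of "\<sigma> *\<^sub>R b" "\<tau> *\<^sub>R c"] that by simp
    also have "\<dots> \<le> s * norm b + t * norm c"
      using that by (intro add_mono mult_right_mono) auto
    finally show ?thesis .
  qed
  have in_U: "a + \<sigma> *\<^sub>R b + \<tau> *\<^sub>R c \<in> U"
    if "0 \<le> \<sigma>" "\<sigma> \<le> s" "0 \<le> \<tau>" "\<tau> \<le> t" for \<sigma> \<tau>
    using dist_le[OF that] r by (meson mem_ball order_le_less_trans subsetD)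
  have along: "((\<lambda>\<sigma>. f (w + \<sigma> *\<^sub>R b)) has_derivative (\<lambda>h. h * g (w + \<sigma> *\<^sub>R b))) (at \<sigma> within X)"
    if "w + \<sigma> *\<^sub>R b \<in> U" for w \<sigma> X
  proof -
    have fd: "(f has_derivative frechet_derivative f (at (w + \<sigma> *\<^sub>R b))) (at (w + \<sigma> *\<^sub>R b))"
      using f[OF that] frechet_derivative_works by blast
    have "((\<lambda>\<sigma>. w + \<sigma> *\<^sub>R b) has_derivative (\<lambda>h. h *\<^sub>R b)) (at \<sigma> within X)"
      by (auto intro!: derivative_eq_intros)
    from has_derivative_compose[OF this fd]
    show ?thesis
      using linear_frechet_derivative[OF f[OF that]]
      by (simp add: linear_cmul g_def)
  qed
  have along': "((\<lambda>\<tau>. g (w + \<tau> *\<^sub>R c)) has_derivative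
      (\<lambda>h. h * frechet_derivative g (at (w + \<tau> *\<^sub>R c)) c)) (at \<tau> within X)"
    if "w + \<tau> *\<^sub>R c \<in> U" for w \<tau> X
  proof -
    have gd: "g differentiable at (w + \<tau> *\<^sub>R c)"
      using g[OF that] by (simp add: g_def [abs_def])
    have "((\<lambda>\<tau>. w + \<tau> *\<^sub>R c) has_derivative (\<lambda>h. h *\<^sub>R c)) (at \<tau> within X)"
      by (auto intro!: derivative_eq_intros)
    from has_derivative_compose[OF this gd[unfolded frechet_derivative_works]]
    show ?thesis
      using linear_frechet_derivative[OF gd] by (simp add: linear_cmul)
  qed
  \<comment> \<open>The mixed difference is \<phi>(s) - \<phi>(0): the mean value theorem in
    \<sigma> replaces f by its b-derivative g, and a second application along c reaches the
    derivative of g.\<close>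
  define \<phi> where "\<phi> \<sigma> = f ((a + t *\<^sub>R c) + \<sigma> *\<^sub>R b) - f (a + \<sigma> *\<^sub>R b)" for \<sigma>
  have "\<exists>\<xi>\<in>{0<..<s}. \<phi> s - \<phi> 0
      = (s - 0) * g ((a + t *\<^sub>R c) + \<xi> *\<^sub>R b) - (s - 0) * g (a + \<xi> *\<^sub>R b)"
  proof (rule mvt_simple[OF st(1)])
    fix \<sigma> assume "0 \<le> \<sigma>" "\<sigma> \<le> s"
    then show "(\<phi> has_derivative (\<lambda>h. h * g ((a + t *\<^sub>R c) + \<sigma> *\<^sub>R b) - h * g (a + \<sigma> *\<^sub>R b)))
        (at \<sigma> within {0..s})"
      unfolding \<phi>_def using in_U[of \<sigma> t] in_U[of \<sigma> 0] st
      by (intro has_derivative_diff along) (simp_all add: add_ac)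
  qed
  then obtain \<xi> where \<xi>: "0 < \<xi>" "\<xi> < s"
    and 1: "\<phi> s - \<phi> 0 = s * (g ((a + \<xi> *\<^sub>R b) + t *\<^sub>R c) - g ((a + \<xi> *\<^sub>R b) + 0 *\<^sub>R c))"
    by (auto simp: algebra_simps)
  have "\<exists>\<tau>\<in>{0<..<t}. g ((a + \<xi> *\<^sub>R b) + t *\<^sub>R c) - g ((a + \<xi> *\<^sub>R b) + 0 *\<^sub>R c)
      = (t - 0) * frechet_derivative g (at ((a + \<xi> *\<^sub>R b) + \<tau> *\<^sub>R c)) c"
    by (rule mvt_simple[OF st(2)], rule along') (use in_U \<xi> in auto)
  then obtain \<tau> where \<tau>: "0 < \<tau>" "\<tau> < t"
    and 2: "g ((a + \<xi> *\<^sub>R b) + t *\<^sub>R c) - g ((a + \<xi> *\<^sub>R b) + 0 *\<^sub>R c)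
      = t * frechet_derivative g (at (a + \<xi> *\<^sub>R b + \<tau> *\<^sub>R c)) c"
    by auto
  show ?thesis
  proof (intro exI conjI)
    show "dist a (a + \<xi> *\<^sub>R b + \<tau> *\<^sub>R c) \<le> s * norm b + t * norm c"
      using dist_le \<xi> \<tau> by simp
    show "f (a + s *\<^sub>R b + t *\<^sub>R c) - f (a + s *\<^sub>R b) - f (a + t *\<^sub>R c) + f a
      = s * t * frechet_derivative (\<lambda>x. frechet_derivative f (at x) b) (at (a + \<xi> *\<^sub>R b + \<tau> *\<^sub>R c)) c"
      using 1 2 by (simp add: \<phi>_def g_def[abs_def] add_ac)
  qed
qed

text \<open>The mixed difference over a small parallelogram is symmetric in b and c. Expanding it in
  both orders gives equal values of the two mixed derivatives at two points y and z near a, and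
  continuity carries the equality to a.\<close>

lemma second_derivatives_commute:
  fixes f :: "'a::real_normed_vector \<Rightarrow> real"
  assumes U: "open U" "a \<in> U"
    and f: "\<And>x. x \<in> U \<Longrightarrow> f differentiable at x"
    and g: "\<And>x. x \<in> U \<Longrightarrow> (\<lambda>x. frechet_derivative f (at x) b) differentiable at x"
      "\<And>x. x \<in> U \<Longrightarrow> (\<lambda>x. frechet_derivative f (at x) c) differentiable at x"
    and cont: "continuous_on U (\<lambda>y. frechet_derivative (\<lambda>x. frechet_derivative f (at x) b) (at y) c)"
      "continuous_on U (\<lambda>y. frechet_derivative (\<lambda>x. frechet_derivative f (at x) c) (at y) b)"
  shows "frechet_derivative (\<lambda>x. frechet_derivative f (at x) b) (at a) c
    = frechet_derivative (\<lambda>x. frechet_derivative f (at x) c) (at a) b" (is "?B a = ?C a")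
proof -
  have "\<bar>?B a - ?C a\<bar> \<le> \<epsilon>" if "0 < \<epsilon>" for \<epsilon>
  proof -
    obtain r where r: "0 < r" "ball a r \<subseteq> U"
      using U open_contains_ball by blast
    have "continuous (at a) ?B" "continuous (at a) ?C"
      using cont U continuous_on_eq_continuous_at by blast+
    then obtain d1 d2 where d: "0 < d1" "\<And>y. dist y a < d1 \<Longrightarrow> dist (?B y) (?B a) < \<epsilon> / 2"
      "0 < d2" "\<And>y. dist y a < d2 \<Longrightarrow> dist (?C y) (?C a) < \<epsilon> / 2"
      using \<open>0 < \<epsilon>\<close> unfolding continuous_at_eps_delta by (metis half_gt_zero)
    define D where "D = min r (min d1 d2)"
    \<comment> \<open>Both directions get the same step, so that both expansions describe one mixed
      difference. The \<open>+ 1\<close> in the denominator covers b = c = 0.\<close>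
    define s where "s = D / (2 * (norm b + norm c + 1))"
    have D: "0 < D" using r d by (simp add: D_def)
    have pos: "0 < norm b + norm c + 1"
      using norm_ge_zero[of b] norm_ge_zero[of c] by linarith
    have s: "0 < s" using D pos by (simp add: s_def)
    have "s * norm b + s * norm c < D"
    proof -
      have "s * norm b + s * norm c \<le> s * (norm b + norm c + 1)"
        using s by (simp add: distrib_left)
      also have "\<dots> = D / 2" using pos by (simp add: s_def field_simps)
      finally show ?thesis using D by simp
    qed
    note sD = this
    obtain y where y: "dist a y \<le> s * norm b + s * norm c"
      "f (a + s *\<^sub>R b + s *\<^sub>R c) - f (a + s *\<^sub>R b) - f (a + s *\<^sub>R c) + f a = s * s * ?B y"
      using mixed_difference_mvt[OF f g(1) r(2) _ s s, of c] sD by (auto simp: D_def)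
    obtain z where z: "dist a z \<le> s * norm c + s * norm b"
      "f (a + s *\<^sub>R c + s *\<^sub>R b) - f (a + s *\<^sub>R c) - f (a + s *\<^sub>R b) + f a = s * s * ?C z"
      using mixed_difference_mvt[OF f g(2) r(2) _ s s, of b] sD by (auto simp: D_def add_ac)
    have "s * s * ?B y = s * s * ?C z"
      unfolding y(2)[symmetric] z(2)[symmetric] by (simp add: add_ac)
    then have "?B y = ?C z" using s by simp
    moreover have "dist (?B y) (?B a) < \<epsilon> / 2"
      by (rule d(2)) (use y sD in \<open>simp add: D_def dist_commute\<close>)
    moreover have "dist (?C z) (?C a) < \<epsilon> / 2"
      by (rule d(4)) (use z sD in \<open>simp add: D_def dist_commute\<close>)
    ultimately show ?thesis unfolding dist_real_def by linarith
  qed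
  then show ?thesis
    using field_le_epsilon[of "\<bar>?B a - ?C a\<bar>" 0] by simp
qed

lemma axis_axis_Basis: "axis i (axis j (1::real)) \<in> (Basis :: (real^'n^'m) set)"
  by (simp add: axis_in_Basis_iff)

lemma elasticity_eq:
  "elasticity \<Psi> F i j k l = frechet_derivative
     (\<lambda>G. frechet_derivative \<Psi> (at G) (axis i (axis j 1))) (at F) (axis k (axis l 1))"
  by (simp add: elasticity_def stress_def)

text \<open>\<open>Ck_on 3\<close> unfolds to differentiability of all second derivatives, and
  continuity is read off from that.\<close>

lemma continuous_on_elasticity:
  assumes "open U" and "Ck_on 3 U \<Psi>"
  shows "continuous_on U (\<lambda>F. elasticity \<Psi> F i j k l)"
proof -
  have "\<forall>x\<in>U. (\<lambda>F. elasticity \<Psi> F i j k l) differentiable at x"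
    using assms axis_axis_Basis unfolding elasticity_eq by (simp add: eval_nat_numeral)
  then show ?thesis
    by (meson continuous_at_imp_continuous_on differentiable_imp_continuous_within)
qed

lemma elasticity_symmetric:
  assumes U: "open U" "F \<in> U" and C: "Ck_on 3 U \<Psi>"
  shows "elasticity \<Psi> F i j k l = elasticity \<Psi> F k l i j"
  unfolding elasticity_eq
proof (rule second_derivatives_commute[OF U])
  show "\<And>G. G \<in> U \<Longrightarrow> \<Psi> differentiable at G"
    "\<And>G. G \<in> U \<Longrightarrow> (\<lambda>G. frechet_derivative \<Psi> (at G) (axis i (axis j 1))) differentiable at G"
    "\<And>G. G \<in> U \<Longrightarrow> (\<lambda>G. frechet_derivative \<Psi> (at G) (axis k (axis l 1))) differentiable at G"
    using C axis_axis_Basis by (simp_all add: eval_nat_numeral)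
  show "continuous_on U (\<lambda>y. frechet_derivative
       (\<lambda>G. frechet_derivative \<Psi> (at G) (axis i (axis j 1))) (at y) (axis k (axis l 1)))"
    "continuous_on U (\<lambda>y. frechet_derivative
       (\<lambda>G. frechet_derivative \<Psi> (at G) (axis k (axis l 1))) (at y) (axis i (axis j 1)))"
    using continuous_on_elasticity[OF U(1) C] unfolding elasticity_eq by blast+
qed

lemma inner_tensor_apply:
  "inner M (tensor_apply L N) =
    (\<Sum>i\<in>UNIV. \<Sum>j\<in>UNIV. \<Sum>k\<in>UNIV. \<Sum>l\<in>UNIV. M $ i $ j * L i j k l * N $ k $ l)"
  by (simp add: inner_vec_def tensor_apply_def sum_distrib_left mult.assoc)

lemma tensor_apply_add: "tensor_apply L (M + N) = tensor_apply L M + tensor_apply L N"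
  by (simp add: tensor_apply_def vec_eq_iff sum.distrib distrib_left)

lemma tensor_apply_scaleR: "tensor_apply L (c *\<^sub>R M) = c *\<^sub>R tensor_apply L M"
  by (simp add: tensor_apply_def vec_eq_iff sum_distrib_left mult_ac)

text \<open>Adjacent swaps carry the summation order i j k l to k l i j, where the symmetry of L
  applies.\<close>

lemma inner_tensor_apply_commute:
  assumes "\<And>i j k l. L i j k l = L k l i j"
  shows "inner M (tensor_apply L N) = inner N (tensor_apply L M)"
proof -
  have "inner M (tensor_apply L N) = (\<Sum>i\<in>UNIV. \<Sum>k\<in>UNIV. \<Sum>j\<in>UNIV. \<Sum>l\<in>UNIV. M $ i $ j * L i j k l * N $ k $ l)"
    unfolding inner_tensor_apply by (intro sum.cong refl sum.swap)
  also have "\<dots> = (\<Sum>k\<in>UNIV. \<Sum>i\<in>UNIV. \<Sum>j\<in>UNIV. \<Sum>l\<in>UNIV. M $ i $ j * L i j k l * N $ k $ l)"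
    by (rule sum.swap)
  also have "\<dots> = (\<Sum>k\<in>UNIV. \<Sum>i\<in>UNIV. \<Sum>l\<in>UNIV. \<Sum>j\<in>UNIV. M $ i $ j * L i j k l * N $ k $ l)"
    by (intro sum.cong refl sum.swap)
  also have "\<dots> = (\<Sum>k\<in>UNIV. \<Sum>l\<in>UNIV. \<Sum>i\<in>UNIV. \<Sum>j\<in>UNIV. M $ i $ j * L i j k l * N $ k $ l)"
    by (intro sum.cong refl sum.swap)
  also have "\<dots> = inner N (tensor_apply L M)"
    unfolding inner_tensor_apply
    by (intro sum.cong refl) (subst assms, simp add: mult_ac)
  finally show ?thesis .
qed

text \<open>Polarisation on unit matrices: with q(M) = M : L : M, nonnegativity of q at M + N and M
  - N gives 2 |M : L : N| <= q(M) + q(N) <= 2 C. Homogeneity does the rest, so a bound on the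
  diagonal suffices.\<close>

lemma inner_tensor_apply_bound:
  fixes L :: "'d::finite tensor4"
  assumes sym: "\<And>i j k l. L i j k l = L k l i j"
    and nonneg: "\<And>M. 0 \<le> inner M (tensor_apply L M)"
    and upper: "\<And>M. inner M (tensor_apply L M) \<le> C * (norm M)\<^sup>2"
  shows "\<bar>inner M (tensor_apply L N)\<bar> \<le> C * norm M * norm N"
proof -
  define q where "q M = inner M (tensor_apply L M)" for M
  have comm: "inner M (tensor_apply L N) = inner N (tensor_apply L M)" for M N
    by (rule inner_tensor_apply_commute[OF sym])
  have expand: "q (s *\<^sub>R M + t *\<^sub>R N) = s\<^sup>2 * q M + 2 * s * t * inner M (tensor_apply L N) + t\<^sup>2 * q N"
    for s t M N
    using comm[of N M]
    by (simp add: q_def tensor_apply_add tensor_apply_scaleR inner_simps power2_eq_square algebra_simps)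
  have unit: "\<bar>inner M (tensor_apply L N)\<bar> \<le> C" if "norm M = 1" "norm N = 1" for M N
  proof -
    have "0 \<le> q (1 *\<^sub>R M + 1 *\<^sub>R N)" "0 \<le> q (1 *\<^sub>R M + (-1) *\<^sub>R N)"
      using nonneg unfolding q_def by blast+
    moreover have "q M \<le> C" "q N \<le> C"
      using upper[of M] upper[of N] that by (simp_all add: q_def)
    ultimately show ?thesis
      unfolding expand by simp
  qed
  show ?thesis
  proof (cases "M = 0 \<or> N = 0")
    case True
    then show ?thesis
      using tensor_apply_scaleR[of L 0 N] by auto
  next
    case False
    have "inner M (tensor_apply L N) = inner (norm M *\<^sub>R sgn M) (tensor_apply L (norm N *\<^sub>R sgn N))"
      using False by (simp add: sgn_div_norm)
    also have "\<dots> = norm M * norm N * inner (sgn M) (tensor_apply L (sgn N))"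
      by (simp only: tensor_apply_scaleR inner_scaleR_left inner_scaleR_right mult_ac)
    finally have "\<bar>inner M (tensor_apply L N)\<bar>
        = (norm M * norm N) * \<bar>inner (sgn M) (tensor_apply L (sgn N))\<bar>"
      by (simp add: abs_mult)
    also have "\<dots> \<le> (norm M * norm N) * C"
      using unit[of "sgn M" "sgn N"] False by (intro mult_left_mono) (simp_all add: norm_sgn)
    finally show ?thesis by (simp add: mult_ac)
  qed
qed

text \<open>Duality: testing with M = L : N bounds the squared norm, and one factor cancels.\<close>

lemma norm_tensor_apply_le:
  assumes "\<And>M N. \<bar>inner M (tensor_apply L N)\<bar> \<le> C * norm M * norm N"
  shows "norm (tensor_apply L N) \<le> C * norm N"
proof (cases "tensor_apply L N = 0")
  case True
  \<comment> \<open>The sign of C is not given; testing with M = N shows that C |N| is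
    nonnegative.\<close>
  have "0 \<le> C * norm N * norm N"
    using assms[of N N] by linarith
  then have "0 \<le> C * norm N"
    by (cases "N = 0") (simp_all add: zero_le_mult_iff)
  then show ?thesis using True by simp
next
  case False
  have "norm (tensor_apply L N) * norm (tensor_apply L N) \<le> C * norm N * norm (tensor_apply L N)"
    using assms[of "tensor_apply L N" N]
    unfolding dot_square_norm by (simp add: power2_eq_square mult_ac)
  then show ?thesis using False by simp
qed

text \<open>Each entry is the form evaluated at two unit basis matrices, and there are d^4 entries.
  This caps \<open>penalty_weight\<close> from above uniformly in mesh and iterate.\<close>

lemma tensor_l1_le:
  fixes L :: "'d::finite tensor4"
  assumes "\<And>M N. \<bar>inner M (tensor_apply L N)\<bar> \<le> C * norm M * norm N"
  shows "tensor_l1 L \<le> real CARD('d) ^ 4 * C"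
proof -
  have "\<bar>L i j k l\<bar> \<le> C" for i j k l
  proof -
    have e: "axis k (axis l (1::real)) $ k' $ l' = (if k' = k then if l' = l then 1 else 0 else 0)"
      for k' l' by (simp add: axis_def)
    have "inner (axis i (axis j 1)) (tensor_apply L (axis k (axis l 1)))
        = (\<Sum>k'\<in>UNIV. \<Sum>l'\<in>UNIV. if k' = k then if l' = l then L i j k' l' else 0 else 0)"
      unfolding inner_axis' tensor_apply_def vec_lambda_beta e
      by (auto intro!: sum.cong)
    also have "\<dots> = (\<Sum>k'\<in>UNIV. if k' = k then (\<Sum>l'\<in>UNIV. if l' = l then L i j k' l' else 0) else 0)"
      by (intro sum.cong) auto
    also have "\<dots> = L i j k l" by simp
    finally have "inner (axis i (axis j 1)) (tensor_apply L (axis k (axis l 1))) = L i j k l" .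
    then show ?thesis
      using assms[of "axis i (axis j 1)" "axis k (axis l 1)"] by (simp add: norm_Basis[OF axis_axis_Basis])
  qed
  then have "tensor_l1 L \<le> (\<Sum>i\<in>(UNIV::'d set). \<Sum>j\<in>(UNIV::'d set). \<Sum>k\<in>(UNIV::'d set). \<Sum>l\<in>(UNIV::'d set). C)"
    unfolding tensor_l1_def by (intro sum_mono) auto
  then show ?thesis by (simp add: eval_nat_numeral mult_ac)
qed

section \<open>Surface measure and outward normals\<close>

lemma sets_hausdorff_measure [measurable_cong, simp]: "sets (hausdorff_measure m) = sets borel"
  using sets.sigma_sets_eq[of borel] by (simp add: hausdorff_measure_def)

lemma space_hausdorff_measure [simp]: "space (hausdorff_measure m) = UNIV"
  by (simp add: hausdorff_measure_def)

text \<open>By the junk-value convention of \<^const>\<open>measure_of\<close>, this bound holds without knowing that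
  the outer measure is countably additive on the Borel sets.\<close>

lemma emeasure_hausdorff_le: "emeasure (hausdorff_measure m) A \<le> hausdorff_outer m A"
  unfolding hausdorff_measure_def emeasure_measure_of_conv by simp

lemma hausdorff_pre_le_card:
  assumes "finite I" "A \<subseteq> (\<Union>i\<in>I. S i)" and "\<And>i. i \<in> I \<Longrightarrow> bounded (S i)"
    and "\<And>i. i \<in> I \<Longrightarrow> diameter (S i) \<le> \<rho>" and "0 \<le> \<rho>" "\<rho> \<le> \<delta>"
  shows "hausdorff_pre m \<delta> A \<le> of_nat (card I) * ennreal (unit_ball_vol (real m) * (\<rho> / 2) ^ m)"
proof -
  obtain h where h: "bij_betw h {0..<card I} I"
    using ex_bij_betw_nat_finite[OF assms(1)] by blast
  \<comment> \<open>The premeasure asks for a sequence of sets, so the finite family is padded with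
    empty ones. They cost 0 even for m = 0, where the power alone would give 1.\<close>
  define C where "C i = (if i < card I then S (h i) else {})" for i
  have hI: "h i \<in> I" if "i < card I" for i
    using h that by (auto simp: bij_betw_def)
  have "A \<subseteq> (\<Union>i. C i)"
  proof
    fix x assume "x \<in> A"
    then obtain j where j: "j \<in> I" "x \<in> S j" using assms(2) by blast
    then obtain i where "i < card I" "h i = j"
      using h bij_betw_imp_surj_on[OF h] by (metis atLeastLessThan_iff imageE)
    then show "x \<in> (\<Union>i. C i)" using j by (auto simp: C_def)
  qed
  moreover have "bounded (C i) \<and> diameter (C i) \<le> \<delta>" for i
    using assms(3-6) hI by (auto simp: C_def intro: order_trans)
  ultimately have "hausdorff_pre m \<delta> A \<le> (\<Sum>i. hausdorff_cost m (C i))"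
    unfolding hausdorff_pre_def by (intro INF_lower) simp
  also have "\<dots> = (\<Sum>i<card I. hausdorff_cost m (C i))"
    by (rule suminf_finite) (auto simp: C_def hausdorff_cost_def)
  also have "\<dots> \<le> (\<Sum>i<card I. ennreal (unit_ball_vol (real m) * (\<rho> / 2) ^ m))"
  proof (rule sum_mono)
    fix i assume i: "i \<in> {..<card I}"
    then have "diameter (C i) \<le> \<rho>" "0 \<le> diameter (C i)"
      using assms(3,4) hI by (auto simp: C_def diameter_ge_0)
    then show "hausdorff_cost m (C i) \<le> ennreal (unit_ball_vol (real m) * (\<rho> / 2) ^ m)"
      by (auto simp: hausdorff_cost_def intro!: ennreal_leI mult_left_mono power_mono)
  qed
  finally show ?thesis by simp
qed

text \<open>A grid with n steps per direction cuts the box into at most (n + 1)^(d-1) pieces, since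
  the flat coordinate is not subdivided, and each piece has diameter at most D / n, where D is the
  sum of the edge lengths. As n + 1 <= 2 n, count times cost stays below a bound free of n and
  \<delta>.\<close>

lemma hausdorff_outer_flat_box_finite:
  fixes a b :: "real^'d"
  assumes ab: "a $ i = b $ i"
  shows "hausdorff_outer (CARD('d) - 1) (cbox a b) < \<infinity>"
proof (cases "cbox a b = {}")
  case True
  have "hausdorff_outer (CARD('d) - 1) (cbox a b) \<le> 0"
    unfolding hausdorff_outer_def True
  proof (rule SUP_least)
    fix \<delta> :: real assume "\<delta> \<in> {0<..}"
    then show "hausdorff_pre (CARD('d) - 1) \<delta> {} \<le> (0::ennreal)"
      using hausdorff_pre_le_card[of "{}" "{}" "\<lambda>_::nat. {}" 0 \<delta>] by auto
  qed
  then show ?thesis by simp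
next
  case False
  then have le: "a $ j \<le> b $ j" for j
    by (simp add: interval_ne_empty_cart)
  define m where "m = CARD('d) - 1"
  define D where "D = (\<Sum>j\<in>UNIV. b $ j - a $ j)"
  have D: "0 \<le> D" unfolding D_def using le by (intro sum_nonneg) simp
  have "hausdorff_pre m \<delta> (cbox a b) \<le> ennreal (unit_ball_vol (real m) * D ^ m)" if "0 < \<delta>" for \<delta>
  proof -
    obtain n where n: "D / \<delta> < real n" using reals_Archimedean2 by blast
    moreover have "0 \<le> D / \<delta>" using D that by simp
    ultimately have n0: "0 < n" using of_nat_0_less_iff by fastforce
    have n\<delta>: "D / real n \<le> \<delta>" using n n0 that by (simp add: field_simps)
    \<comment> \<open>Points on an upper face get index n, hence n + 1 values per direction.
      Division by zero yields index 0 in a collapsed coordinate.\<close>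
    define g :: "real^'d \<Rightarrow> 'd \<Rightarrow> int" where
      "g x j = \<lfloor>real n * (x $ j - a $ j) / (b $ j - a $ j)\<rfloor>" for x j
    define I where "I = PiE (UNIV :: 'd set) (\<lambda>j. if j = i then {0::int} else {0..int n})"
    have "card I = (\<Prod>j\<in>(UNIV::'d set). if j = i then 1 else n + 1)"
      unfolding I_def by (subst card_PiE) (auto intro!: prod.cong)
    also have "\<dots> = (n + 1) ^ m"
      by (simp add: prod.If_cases m_def Compl_eq_Diff_UNIV card_Diff_subset flip: Collect_neg_eq)
    finally have cardI: "card I = (n + 1) ^ m" .
    have gI: "g x \<in> I" if "x \<in> cbox a b" for x
    proof -
      have "0 \<le> real n * (x $ j - a $ j) / (b $ j - a $ j)"
        "real n * (x $ j - a $ j) / (b $ j - a $ j) \<le> real n" for j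
        using that le[of j] by (auto simp: mem_box_cart divide_simps mult_left_mono)
      then have "0 \<le> g x j" "g x j \<le> int n" for j
        by (simp_all add: g_def floor_le_iff add_strict_increasing2 order_le_less_trans[OF _ less_add_one])
      moreover have "g x i = 0" using ab by (simp add: g_def)
      ultimately show ?thesis by (auto simp: I_def PiE_iff)
    qed
    define S where "S f = {x \<in> cbox a b. g x = f}" for f
    have "hausdorff_pre m \<delta> (cbox a b)
        \<le> of_nat (card I) * ennreal (unit_ball_vol (real m) * (D / real n / 2) ^ m)"
    proof (rule hausdorff_pre_le_card)
      show "finite I" unfolding I_def by (intro finite_PiE) auto
      show "cbox a b \<subseteq> (\<Union>f\<in>I. S f)" using gI by (auto simp: S_def)
      show "bounded (S f)" for f
        using bounded_cbox[of a b] by (rule bounded_subset) (auto simp: S_def)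
      show "diameter (S f) \<le> D / real n" for f
      proof (rule diameter_le)
        show "S f \<noteq> {} \<or> 0 \<le> D / real n" using D by simp
        fix x y assume xy: "x \<in> S f" "y \<in> S f"
        have "\<bar>x $ j - y $ j\<bar> \<le> (b $ j - a $ j) / real n" for j
        proof (cases "a $ j = b $ j")
          case True
          then have "x $ j = y $ j" using xy by (auto simp: S_def mem_box_cart intro: order.antisym dest!: spec[of _ j])
          then show ?thesis using True by simp
        next
          case False
          then have w: "0 < b $ j - a $ j" using le[of j] by simp
          have "g x j = g y j" using xy by (simp add: S_def)
          then have "\<bar>real n * (x $ j - a $ j) / (b $ j - a $ j) - real n * (y $ j - a $ j) / (b $ j - a $ j)\<bar> < 1"
            unfolding g_def by linarith
          also have "real n * (x $ j - a $ j) / (b $ j - a $ j) - real n * (y $ j - a $ j) / (b $ j - a $ j)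
              = real n * (x $ j - y $ j) / (b $ j - a $ j)"
            by (simp add: diff_divide_distrib algebra_simps)
          finally have "real n * \<bar>x $ j - y $ j\<bar> < b $ j - a $ j"
            using w by (simp add: abs_mult)
          then show ?thesis using n0 by (simp add: pos_le_divide_eq mult.commute)
        qed
        then have "(\<Sum>j\<in>UNIV. \<bar>(x - y) $ j\<bar>) \<le> (\<Sum>j\<in>UNIV. (b $ j - a $ j) / real n)"
          by (intro sum_mono) simp
        then show "norm (x - y) \<le> D / real n"
          using norm_le_l1_cart[of "x - y"] by (simp add: D_def sum_divide_distrib)
      qed
    qed (use D n\<delta> in auto)
    also have "\<dots> = ennreal (real ((n + 1) ^ m) * (unit_ball_vol (real m) * (D / real n / 2) ^ m))"
      unfolding cardI ennreal_of_nat_eq_real_of_nat using D by (subst ennreal_mult[symmetric]) auto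
    also have "\<dots> \<le> ennreal (unit_ball_vol (real m) * D ^ m)"
    proof (rule ennreal_leI)
      have "real (n + 1) * (D / real n / 2) = D * ((real n + 1) / (2 * real n))"
        using n0 by (simp add: field_simps)
      also have "\<dots> \<le> D * 1"
        using D n0 by (intro mult_left_mono) (simp_all add: divide_simps)
      finally have "(real (n + 1) * (D / real n / 2)) ^ m \<le> D ^ m"
        using D by (intro power_mono) simp_all
      then have "unit_ball_vol (real m) * (real (n + 1) * (D / real n / 2)) ^ m \<le> unit_ball_vol (real m) * D ^ m"
        by (intro mult_left_mono) simp_all
      also have "unit_ball_vol (real m) * (real (n + 1) * (D / real n / 2)) ^ m
          = real ((n + 1) ^ m) * (unit_ball_vol (real m) * (D / real n / 2) ^ m)"
        unfolding power_mult_distrib[of "real (n + 1)"] of_nat_power by (simp only: mult_ac)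
      finally show "real ((n + 1) ^ m) * (unit_ball_vol (real m) * (D / real n / 2) ^ m) \<le> unit_ball_vol (real m) * D ^ m" .
    qed
    finally show ?thesis .
  qed
  then have "hausdorff_outer m (cbox a b) \<le> ennreal (unit_ball_vol (real m) * D ^ m)"
    unfolding hausdorff_outer_def by (intro SUP_least) simp
  then show ?thesis
    unfolding m_def[symmetric] by (simp add: order_le_less_trans)
qed

section \<open>Outward normals: uniqueness and Borel measurability\<close>

lemma is_outward_normal_unique:
  assumes "is_outward_normal \<Omega> x \<nu>" "is_outward_normal \<Omega> x \<nu>'"
  shows "\<nu> = \<nu>'"
proof (rule ccontr)
  assume ne: "\<nu> \<noteq> \<nu>'"
  define c where "c = 1 - inner \<nu> \<nu>'"
  define w where "w = \<nu>' - \<nu>"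
  have n: "norm \<nu> = 1" "norm \<nu>' = 1" using assms by (auto simp: is_outward_normal_def)
  then have n': "inner \<nu> \<nu> = 1" "inner \<nu>' \<nu>' = 1" by (simp_all add: norm_eq_1)
  then have w2: "(norm w)\<^sup>2 = 2 * c"
    unfolding power2_norm_eq_inner by (simp add: w_def c_def inner_diff inner_commute[of \<nu>' \<nu>])
  have w0: "0 < norm w" using ne by (simp add: w_def)
  then have c: "0 < c" using w2 zero_less_power[of "norm w" 2] by linarith
  define \<epsilon> where "\<epsilon> = c / (2 * norm w)"
  have \<epsilon>: "0 < \<epsilon>" "\<epsilon> * norm w < c" using c w0 by (simp_all add: \<epsilon>_def)
  obtain \<delta> where \<delta>: "0 < \<delta>" "\<And>y. y \<in> ball x \<delta> \<Longrightarrow> inner (y - x) \<nu> < - \<epsilon> * norm (y - x) \<Longrightarrow> y \<in> \<Omega>"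
    using assms(1) \<epsilon>(1) unfolding is_outward_normal_def by blast
  obtain \<delta>' where \<delta>': "0 < \<delta>'" "\<And>y. y \<in> ball x \<delta>' \<Longrightarrow> inner (y - x) \<nu>' > \<epsilon> * norm (y - x) \<Longrightarrow> y \<notin> \<Omega>"
    using assms(2) \<epsilon>(1) unfolding is_outward_normal_def by blast
  define s where "s = min \<delta> \<delta>' / (2 * norm w)"
  have s: "0 < s" using \<delta> \<delta>' w0 by (simp add: s_def)
  \<comment> \<open>Along w = \<nu>' - \<nu> the inner product with \<nu> falls and the one with
    \<nu>' rises at the same rate c, and \<epsilon> is small enough for w to lie strictly inside
    both cones. The cone condition of \<nu> puts y inside \<Omega>, that of \<nu>' outside.\<close>
  define y where "y = x + s *\<^sub>R w"
  have sw: "s * norm w < \<delta>" "s * norm w < \<delta>'"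
    using \<delta> \<delta>' w0 by (auto simp: s_def min_def)
  have ball: "y \<in> ball x \<delta>" "y \<in> ball x \<delta>'"
    using sw s by (auto simp: y_def dist_norm)
  have "inner w \<nu> = - c" "inner w \<nu>' = c"
    using n' by (simp_all add: w_def c_def inner_diff inner_commute[of \<nu>' \<nu>])
  moreover have "s * (\<epsilon> * norm w) < s * c" using s \<epsilon> by simp
  ultimately have "inner (y - x) \<nu> < - \<epsilon> * norm (y - x)" "inner (y - x) \<nu>' > \<epsilon> * norm (y - x)"
    using s by (simp_all add: y_def mult_ac)
  then show False using \<delta>(2)[OF ball(1)] \<delta>'(2)[OF ball(2)] by blast
qed

lemma outward_normal_eq: "is_outward_normal \<Omega> x \<nu> \<Longrightarrow> outward_normal \<Omega> x = \<nu>"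
  unfolding outward_normal_def using is_outward_normal_unique by (auto intro!: the_equality)

lemma outward_normal_cases:
  obtains "is_outward_normal \<Omega> x (outward_normal \<Omega> x)"
  | "outward_normal \<Omega> x = 0" "\<nexists>\<nu>. is_outward_normal \<Omega> x \<nu>"
  using outward_normal_eq by (metis outward_normal_def)

lemma norm_outward_normal_le: "norm (outward_normal \<Omega> x) \<le> 1"
  by (rule outward_normal_cases[of \<Omega> x]) (auto simp: is_outward_normal_def)

text \<open>With the tolerances \<epsilon> and \<delta> frozen the condition survives limits in x
  and \<nu>; countably many tolerances then recover the outward normal.\<close>

definition normal_cone_test :: "(real^'d) set \<Rightarrow> real \<Rightarrow> real \<Rightarrow> real^'d \<Rightarrow> real^'d \<Rightarrow> bool" where
  "normal_cone_test \<Omega> \<epsilon> \<delta> x \<nu> \<longleftrightarrow> norm \<nu> = 1 \<and> (\<forall>y \<in> ball x \<delta>.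
     (inner (y - x) \<nu> < - \<epsilon> * norm (y - x) \<longrightarrow> y \<in> \<Omega>) \<and>
     (inner (y - x) \<nu> > \<epsilon> * norm (y - x) \<longrightarrow> y \<notin> \<Omega>))"

text \<open>Replacing \<nu> by \<nu>' changes the inner product with y - x by at most |y - x| |\<nu>
  - \<nu>'|, which the larger tolerance absorbs.\<close>

lemma normal_cone_test_mono:
  assumes "normal_cone_test \<Omega> \<epsilon> \<delta> x \<nu>" "norm \<nu>' = 1" "\<epsilon> + norm (\<nu> - \<nu>') \<le> \<epsilon>'" "\<delta>' \<le> \<delta>"
  shows "normal_cone_test \<Omega> \<epsilon>' \<delta>' x \<nu>'"
  unfolding normal_cone_test_def
proof (intro conjI ballI impI)
  fix y assume y: "y \<in> ball x \<delta>'"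
  have "\<bar>inner (y - x) (\<nu> - \<nu>')\<bar> \<le> norm (y - x) * norm (\<nu> - \<nu>')"
    by (rule Cauchy_Schwarz_ineq2)
  also have "\<dots> \<le> norm (y - x) * (\<epsilon>' - \<epsilon>)"
    using assms(3) by (intro mult_left_mono) auto
  finally have *: "\<bar>inner (y - x) \<nu> - inner (y - x) \<nu>'\<bar> \<le> \<epsilon>' * norm (y - x) - \<epsilon> * norm (y - x)"
    by (simp add: inner_diff_right algebra_simps)
  show "y \<in> \<Omega>" if "inner (y - x) \<nu>' < - \<epsilon>' * norm (y - x)"
    using assms(1,4) y * that unfolding normal_cone_test_def by auto
  show "y \<notin> \<Omega>" if "inner (y - x) \<nu>' > \<epsilon>' * norm (y - x)"
    using assms(1,4) y * that unfolding normal_cone_test_def by auto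
qed (use assms in auto)

text \<open>A strict inequality at the limit point and membership in an open ball both hold
  eventually along the approximating sequence, so the tests there decide whether y belongs to
  \<Omega>, whatever the set \<Omega> is. Compactness of the unit sphere supplies the limiting
  \<nu>.\<close>

lemma closed_normal_cone_test:
  assumes "closed C"
  shows "closed {x. \<exists>\<nu>\<in>C. normal_cone_test \<Omega> \<epsilon> \<delta> x \<nu>}"
  unfolding closed_sequential_limits
proof (intro allI impI; elim conjE)
  fix X x assume X: "\<forall>n. X n \<in> {x. \<exists>\<nu>\<in>C. normal_cone_test \<Omega> \<epsilon> \<delta> x \<nu>}" "X \<longlonglongrightarrow> x"
  then have "\<forall>n. \<exists>\<nu>. \<nu> \<in> C \<and> normal_cone_test \<Omega> \<epsilon> \<delta> (X n) \<nu>"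
    by blast
  then obtain N where N: "\<And>n. N n \<in> C" "\<And>n. normal_cone_test \<Omega> \<epsilon> \<delta> (X n) (N n)"
    using choice[of "\<lambda>n \<nu>. \<nu> \<in> C \<and> normal_cone_test \<Omega> \<epsilon> \<delta> (X n) \<nu>"] by blast
  have "compact (C \<inter> sphere 0 1)"
    using assms by (simp add: closed_Int_compact)
  moreover have "\<forall>n. N n \<in> C \<inter> sphere 0 1"
    using N by (auto simp: normal_cone_test_def)
  ultimately obtain \<nu> r where r: "\<nu> \<in> C \<inter> sphere 0 1" "strict_mono (r :: nat \<Rightarrow> nat)" "(N \<circ> r) \<longlonglongrightarrow> \<nu>"
    unfolding compact_def by metis
  have Xr: "(\<lambda>n. X (r n)) \<longlonglongrightarrow> x" and Nr: "(\<lambda>n. N (r n)) \<longlonglongrightarrow> \<nu>"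
    using LIMSEQ_subseq_LIMSEQ[OF X(2) r(2)] r(3) by (simp_all add: o_def)
  have "normal_cone_test \<Omega> \<epsilon> \<delta> x \<nu>"
    unfolding normal_cone_test_def
  proof (intro conjI ballI impI)
    show "norm \<nu> = 1" using r by simp
    fix y assume y: "y \<in> ball x \<delta>"
    have "(\<lambda>n. dist (X (r n)) y) \<longlonglongrightarrow> dist x y"
      by (intro tendsto_intros Xr)
    then have ev: "\<forall>\<^sub>F n in sequentially. y \<in> ball (X (r n)) \<delta>"
      using y by (simp add: order_tendstoD)
    have lim: "(\<lambda>n. inner (y - X (r n)) (N (r n)) - s * norm (y - X (r n))) \<longlonglongrightarrow> inner (y - x) \<nu> - s * norm (y - x)" for s
      by (intro tendsto_intros Xr Nr)
    show "y \<in> \<Omega>" if "inner (y - x) \<nu> < - \<epsilon> * norm (y - x)"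
    proof -
      have "\<forall>\<^sub>F n in sequentially. inner (y - X (r n)) (N (r n)) - (- \<epsilon>) * norm (y - X (r n)) < 0"
        using that by (intro order_tendstoD(2)[OF lim]) simp
      from eventually_happens[OF eventually_conj[OF ev this]] show ?thesis
        using N(2) unfolding normal_cone_test_def by auto
    qed
    show "y \<notin> \<Omega>" if "inner (y - x) \<nu> > \<epsilon> * norm (y - x)"
    proof -
      have "\<forall>\<^sub>F n in sequentially. inner (y - X (r n)) (N (r n)) - \<epsilon> * norm (y - X (r n)) > 0"
        using that by (intro order_tendstoD(1)[OF lim]) simp
      from eventually_happens[OF eventually_conj[OF ev this]] show ?thesis
        using N(2) unfolding normal_cone_test_def by auto
    qed
  qed
  then show "x \<in> {x. \<exists>\<nu>\<in>C. normal_cone_test \<Omega> \<epsilon> \<delta> x \<nu>}" using r by auto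
qed

text \<open>Compactness of the sphere allows the quantifier over \<open>\<nu>\<close> to move inside, which exhibits the
  set as a countable combination of closed sets.\<close>

lemma is_outward_normal_iff_countable:
  assumes "closed C"
  shows "(\<exists>\<nu>\<in>C. is_outward_normal \<Omega> x \<nu>) \<longleftrightarrow>
    (\<forall>m::nat. \<exists>n::nat. \<exists>\<nu>\<in>C. normal_cone_test \<Omega> (1 / real (Suc m)) (1 / real (Suc n)) x \<nu>)"
    (is "?l \<longleftrightarrow> ?r")
proof
  assume ?l
  then obtain \<nu> where \<nu>: "\<nu> \<in> C" "is_outward_normal \<Omega> x \<nu>" by blast
  show ?r
  proof
    fix m :: nat
    have "0 < 1 / real (Suc m)" by simp
    with \<nu>(2) obtain \<delta> where \<delta>: "0 < \<delta>" "normal_cone_test \<Omega> (1 / real (Suc m)) \<delta> x \<nu>"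
      unfolding is_outward_normal_def normal_cone_test_def by blast
    obtain n where "1 / real (Suc n) < \<delta>"
      using nat_approx_posE[OF \<delta>(1)] .
    then have "normal_cone_test \<Omega> (1 / real (Suc m)) (1 / real (Suc n)) x \<nu>"
      using \<delta>(2) \<nu>(2) by (intro normal_cone_test_mono[OF \<delta>(2)]) (auto simp: is_outward_normal_def)
    then show "\<exists>n. \<exists>\<nu>\<in>C. normal_cone_test \<Omega> (1 / real (Suc m)) (1 / real (Suc n)) x \<nu>"
      using \<nu>(1) by blast
  qed
next
  assume ?r
  then have "\<forall>m. \<exists>z. snd z \<in> C \<and>
      normal_cone_test \<Omega> (1 / real (Suc m)) (1 / real (Suc (fst z))) x (snd z)"
    by simp blast
  from choice[OF this] obtain z where z: "\<forall>m. snd (z m) \<in> C \<and>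
      normal_cone_test \<Omega> (1 / real (Suc m)) (1 / real (Suc (fst (z m)))) x (snd (z m))"
    by blast
  define n where "n m = fst (z m)" for m
  define N where "N m = snd (z m)" for m
  have N: "\<And>m. N m \<in> C" "\<And>m. normal_cone_test \<Omega> (1 / real (Suc m)) (1 / real (Suc (n m))) x (N m)"
    using z by (auto simp: N_def n_def)
  have "compact (C \<inter> sphere 0 1)"
    using assms by (simp add: closed_Int_compact)
  moreover have "\<forall>m. N m \<in> C \<inter> sphere 0 1"
    using N by (auto simp: normal_cone_test_def)
  ultimately obtain \<nu> r where r: "\<nu> \<in> C \<inter> sphere 0 1" "strict_mono (r :: nat \<Rightarrow> nat)" "(N \<circ> r) \<longlonglongrightarrow> \<nu>"
    unfolding compact_def by metis
  have "\<exists>\<delta>>0. normal_cone_test \<Omega> \<epsilon> \<delta> x \<nu>" if "0 < \<epsilon>" for \<epsilon>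
  proof -
    \<comment> \<open>The vector found at tolerance 1 / (r k + 1) is only close to \<nu>; its
      distance to \<nu> is charged to the tolerance by \<open>normal_cone_test_mono\<close>.\<close>
    have "(\<lambda>k. 1 / real (Suc (r k)) + norm (N (r k) - \<nu>)) \<longlonglongrightarrow> 0 + norm (\<nu> - \<nu>)"
      using r(3) LIMSEQ_subseq_LIMSEQ[OF LIMSEQ_Suc[OF lim_1_over_n] r(2)]
      by (intro tendsto_intros) (simp_all add: o_def)
    then have "\<forall>\<^sub>F k in sequentially. 1 / real (Suc (r k)) + norm (N (r k) - \<nu>) < \<epsilon>"
      using that by (intro order_tendstoD(2)) auto
    then obtain k where k: "1 / real (Suc (r k)) + norm (N (r k) - \<nu>) < \<epsilon>"
      using eventually_happens by fastforce
    have "normal_cone_test \<Omega> \<epsilon> (1 / real (Suc (n (r k)))) x \<nu>"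
      by (rule normal_cone_test_mono[OF N(2)]) (use k r in auto)
    then show ?thesis by (intro exI[of _ "1 / real (Suc (n (r k)))"]) auto
  qed
  then have "is_outward_normal \<Omega> x \<nu>"
    using r(1) unfolding is_outward_normal_def normal_cone_test_def by auto
  then show ?l using r(1) by blast
qed

lemma borel_measurable_outward_normal [measurable]: "outward_normal \<Omega> \<in> borel_measurable borel"
proof (rule borel_measurableI)
  have ex: "{x. \<exists>\<nu>\<in>C. is_outward_normal \<Omega> x \<nu>} \<in> sets borel" if "closed C" for C
  proof -
    have "{x. \<exists>\<nu>\<in>C. normal_cone_test \<Omega> \<epsilon> \<delta> x \<nu>} \<in> sets borel" for \<epsilon> \<delta>
      using closed_normal_cone_test[OF that] by (rule borel_closed)
    moreover have "{x. \<exists>\<nu>\<in>C. is_outward_normal \<Omega> x \<nu>} = (\<Inter>m. \<Union>n.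
        {x. \<exists>\<nu>\<in>C. normal_cone_test \<Omega> (1 / real (Suc m)) (1 / real (Suc n)) x \<nu>})"
      unfolding is_outward_normal_iff_countable[OF that] by auto
    ultimately show ?thesis by simp
  qed
  fix S :: "(real^'a) set" assume S: "open S"
  \<comment> \<open>Points without a normal carry the default value 0, so they lie in the complement
    of the preimage exactly when 0 is not in S.\<close>
  have "outward_normal \<Omega> -` S = - ({x. \<exists>\<nu>\<in>- S. is_outward_normal \<Omega> x \<nu>}
      \<union> (if 0 \<in> S then {} else - {x. \<exists>\<nu>\<in>UNIV. is_outward_normal \<Omega> x \<nu>}))" (is "?A = ?B")
  proof (rule set_eqI)
    fix x show "x \<in> ?A \<longleftrightarrow> x \<in> ?B"
      by (rule outward_normal_cases[of \<Omega> x]) (auto dest: outward_normal_eq)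
  qed
  then show "outward_normal \<Omega> -` S \<inter> space borel \<in> sets borel"
    using ex[OF closed_Compl[OF S]] ex[OF closed_UNIV] by (auto intro!: sets.Int borel_comp)
qed

section \<open>Polynomials on cells\<close>

lemma finite_multidegree: "finite {\<alpha> :: 'd::finite \<Rightarrow> nat. \<forall>i. \<alpha> i \<le> p}"
proof -
  have "{\<alpha> :: 'd \<Rightarrow> nat. \<forall>i. \<alpha> i \<le> p} = PiE UNIV (\<lambda>_. {..p})" by auto
  then show ?thesis by (simp add: finite_PiE)
qed

lemma Qpoly_add: "f \<in> Qpoly p \<Longrightarrow> g \<in> Qpoly p \<Longrightarrow> (\<lambda>x. f x + g x) \<in> Qpoly p"
  unfolding Qpoly_def
proof (elim CollectE exE)
  fix c c' assume
    "\<forall>x. f x = (\<Sum>\<alpha> | \<forall>i. \<alpha> i \<le> p. c \<alpha> * (\<Prod>i\<in>UNIV. x $ i ^ \<alpha> i))"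
    "\<forall>x. g x = (\<Sum>\<alpha> | \<forall>i. \<alpha> i \<le> p. c' \<alpha> * (\<Prod>i\<in>UNIV. x $ i ^ \<alpha> i))"
  then have "\<forall>x. f x + g x = (\<Sum>\<alpha> | \<forall>i. \<alpha> i \<le> p. (c \<alpha> + c' \<alpha>) * (\<Prod>i\<in>UNIV. x $ i ^ \<alpha> i))"
    by (simp add: sum.distrib distrib_right)
  then show "(\<lambda>x. f x + g x) \<in> {w. \<exists>c. \<forall>x. w x = (\<Sum>\<alpha> | \<forall>i. \<alpha> i \<le> p. c \<alpha> * (\<Prod>i\<in>UNIV. x $ i ^ \<alpha> i))}"
    by (intro CollectI exI[of _ "\<lambda>\<alpha>. c \<alpha> + c' \<alpha>"])
qed

lemma Qpoly_mult: "f \<in> Qpoly p \<Longrightarrow> (\<lambda>x. r * f x) \<in> Qpoly p"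
  unfolding Qpoly_def
proof (elim CollectE exE)
  fix c assume
    "\<forall>x. f x = (\<Sum>\<alpha> | \<forall>i. \<alpha> i \<le> p. c \<alpha> * (\<Prod>i\<in>UNIV. x $ i ^ \<alpha> i))"
  then have "\<forall>x. r * f x = (\<Sum>\<alpha> | \<forall>i. \<alpha> i \<le> p. (r * c \<alpha>) * (\<Prod>i\<in>UNIV. x $ i ^ \<alpha> i))"
    by (simp add: sum_distrib_left mult.assoc)
  then show "(\<lambda>x. r * f x) \<in> {w. \<exists>c. \<forall>x. w x = (\<Sum>\<alpha> | \<forall>i. \<alpha> i \<le> p. c \<alpha> * (\<Prod>i\<in>UNIV. x $ i ^ \<alpha> i))}"
    by (intro CollectI exI[of _ "\<lambda>\<alpha>. r * c \<alpha>"])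
qed

lemma Qpoly_zero: "(\<lambda>x. 0) \<in> Qpoly p"
  unfolding Qpoly_def by (intro CollectI exI[of _ "\<lambda>_. 0"]) simp

lemma Qpoly_sum: "(\<And>k. k \<in> K \<Longrightarrow> f k \<in> Qpoly p) \<Longrightarrow> (\<lambda>x. \<Sum>k\<in>K. f k x) \<in> Qpoly p"
  by (induction K rule: infinite_finite_induct) (auto intro: Qpoly_zero Qpoly_add)

lemma Qpoly_monomial:
  assumes "\<And>i. \<alpha> i \<le> p"
  shows "(\<lambda>x :: real^'d. \<Prod>i\<in>UNIV. x $ i ^ \<alpha> i) \<in> Qpoly p"
proof -
  have "(\<Sum>\<beta> | \<forall>i. \<beta> i \<le> p. (if \<beta> = \<alpha> then 1 else 0) * (\<Prod>i\<in>UNIV. x $ i ^ \<beta> i)) = (\<Prod>i\<in>UNIV. x $ i ^ \<alpha> i)"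
    for x :: "real^'d"
    by (subst sum.remove[of _ \<alpha>]) (use assms finite_multidegree in \<open>auto intro: sum.neutral\<close>)
  then show ?thesis
    unfolding Qpoly_def by (intro CollectI exI[of _ "\<lambda>\<beta>. if \<beta> = \<alpha> then 1 else 0"]) simp
qed

lemma Qpoly_const: "(\<lambda>x :: real^'d. r) \<in> Qpoly p"
  using Qpoly_mult[OF Qpoly_monomial[of "\<lambda>_. 0" p], of r] by simp

text \<open>The truncated exponent \<open>\<alpha> j - 1\<close> is harmless when
  \<open>\<alpha> j = 0\<close>, because the factor \<open>real (\<alpha> j)\<close>
  vanishes.\<close>

lemma monomial_has_derivative:
  fixes \<alpha> :: "'d::finite \<Rightarrow> nat"
  shows "((\<lambda>x :: real^'d. \<Prod>i\<in>UNIV. x $ i ^ \<alpha> i) has_derivative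
    (\<lambda>h. \<Sum>j\<in>UNIV. h $ j * (real (\<alpha> j) * (\<Prod>i\<in>UNIV. x $ i ^ (\<alpha>(j := \<alpha> j - 1)) i)))) (at x)"
proof -
  have "((\<lambda>x :: real^'d. \<Prod>i\<in>UNIV. x $ i ^ \<alpha> i) has_derivative
    (\<lambda>h. \<Sum>j\<in>UNIV. real (\<alpha> j) * h $ j * x $ j ^ (\<alpha> j - 1) * (\<Prod>i\<in>UNIV - {j}. x $ i ^ \<alpha> i))) (at x)"
    by (intro has_derivative_prod has_derivative_power
        bounded_linear.has_derivative[OF bounded_linear_vec_nth] has_derivative_ident)
  moreover have "x $ j ^ (\<alpha> j - 1) * (\<Prod>i\<in>UNIV - {j}. x $ i ^ \<alpha> i) = (\<Prod>i\<in>UNIV. x $ i ^ (\<alpha>(j := \<alpha> j - 1)) i)" for j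
    by (subst prod.remove[of UNIV j]) (auto intro!: prod.cong)
  ultimately show ?thesis by (simp add: mult_ac)
qed

text \<open>Partial derivatives only lower exponents and so stay in \<open>Qpoly p\<close>. This
  lets the scalar trace inequality act on the entries of gradients and keeps iterated normal
  derivatives polynomial.\<close>

lemma Qpoly_has_derivative:
  assumes "q \<in> Qpoly p"
  obtains D where "\<And>j :: 'd. D j \<in> Qpoly p"
    "\<And>x :: real^'d. (q has_derivative (\<lambda>h. \<Sum>j\<in>UNIV. h $ j * D j x)) (at x)"
proof -
  obtain c where c: "\<And>x. q x = (\<Sum>\<alpha> | \<forall>i. \<alpha> i \<le> p. c \<alpha> * (\<Prod>i\<in>UNIV. x $ i ^ \<alpha> i))"
    using assms unfolding Qpoly_def by blast
  define D where "D j x = (\<Sum>\<alpha> | \<forall>i. \<alpha> i \<le> p. c \<alpha> * (real (\<alpha> j) * (\<Prod>i\<in>UNIV. x $ i ^ (\<alpha>(j := \<alpha> j - 1)) i)))"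
    for j and x :: "real^'d"
  have "D j \<in> Qpoly p" for j
    unfolding D_def by (intro Qpoly_sum Qpoly_mult Qpoly_monomial) (auto intro: order.trans[OF diff_le_self])
  moreover have "(q has_derivative (\<lambda>h. \<Sum>j\<in>UNIV. h $ j * D j x)) (at x)" for x
  proof -
    have "((\<lambda>x. \<Sum>\<alpha> | \<forall>i. \<alpha> i \<le> p. c \<alpha> * (\<Prod>i\<in>UNIV. x $ i ^ \<alpha> i)) has_derivative
      (\<lambda>h. \<Sum>\<alpha> | \<forall>i. \<alpha> i \<le> p. c \<alpha> *
        (\<Sum>j\<in>UNIV. h $ j * (real (\<alpha> j) * (\<Prod>i\<in>UNIV. x $ i ^ (\<alpha>(j := \<alpha> j - 1)) i))))) (at x)"
      by (intro has_derivative_sum has_derivative_mult_right monomial_has_derivative)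
    moreover have "(\<Sum>\<alpha> | \<forall>i. \<alpha> i \<le> p. c \<alpha> *
        (\<Sum>j\<in>UNIV. h $ j * (real (\<alpha> j) * (\<Prod>i\<in>UNIV. x $ i ^ (\<alpha>(j := \<alpha> j - 1)) i))))
      = (\<Sum>j\<in>UNIV. h $ j * D j x)" for h
      unfolding D_def sum_distrib_left
      by (subst sum.swap) (intro sum.cong refl, simp only: mult_ac)
    ultimately show ?thesis by (simp add: c[abs_def])
  qed
  ultimately show ?thesis using that by blast
qed

lemma continuous_on_Qpoly:
  assumes "q \<in> Qpoly p"
  shows "continuous_on S q"
proof (rule Qpoly_has_derivative[OF assms])
  fix D assume "\<And>x. (q has_derivative (\<lambda>h. \<Sum>j\<in>UNIV. h $ j * D j x)) (at x)"
  then show ?thesis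
    by (auto intro: continuous_at_imp_continuous_on has_derivative_continuous)
qed

definition Qpoly_on :: "nat \<Rightarrow> (real^'d) set \<Rightarrow> (real^'d \<Rightarrow> real^'d) \<Rightarrow> bool" where
  "Qpoly_on p T v \<longleftrightarrow> (\<forall>i. \<exists>q \<in> Qpoly p. \<forall>x\<in>T. v x $ i = q x)"

lemma continuous_on_Qpoly_on:
  assumes "Qpoly_on p T v"
  shows "continuous_on T v"
proof -
  have "continuous_on T (\<lambda>x. v x $ i)" for i
  proof -
    obtain q where "q \<in> Qpoly p" "\<forall>x\<in>T. v x $ i = q x"
      using assms unfolding Qpoly_on_def by blast
    then show ?thesis using continuous_on_Qpoly[of q p T] by (simp cong: continuous_on_cong)
  qed
  then have "continuous_on T (\<lambda>x. \<chi> i. v x $ i)"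
    by (intro continuous_on_vec_lambda)
  then show ?thesis by simp
qed

lemma Qpoly_on_has_derivative:
  assumes "Qpoly_on p T v"
  obtains q D where "\<And>i j :: 'd. D i j \<in> Qpoly p"
    "\<And>x :: real^'d. x \<in> T \<Longrightarrow>
      (v has_derivative (\<lambda>h. \<chi> i. \<Sum>j\<in>UNIV. h $ j * D i j x)) (at x within T)"
    "\<And>i. q i \<in> Qpoly p" "\<And>i x. x \<in> T \<Longrightarrow> v x $ i = q i x"
    "\<And>i x. (q i has_derivative (\<lambda>h. \<Sum>j\<in>UNIV. h $ j * D i j x)) (at x)"
proof -
  have "\<forall>i. \<exists>q. q \<in> Qpoly p \<and> (\<forall>x\<in>T. v x $ i = q x)"
    using assms unfolding Qpoly_on_def by blast
  from choice[OF this] obtain q where q: "\<And>i. q i \<in> Qpoly p" "\<And>i x. x \<in> T \<Longrightarrow> v x $ i = q i x"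
    by blast
  have "\<forall>i. \<exists>D. (\<forall>j. D j \<in> Qpoly p) \<and> (\<forall>x. (q i has_derivative (\<lambda>h. \<Sum>j\<in>UNIV. h $ j * D j x)) (at x))"
  proof
    fix i
    show "\<exists>D. (\<forall>j. D j \<in> Qpoly p) \<and> (\<forall>x. (q i has_derivative (\<lambda>h. \<Sum>j\<in>UNIV. h $ j * D j x)) (at x))"
      by (rule Qpoly_has_derivative[OF q(1)]) blast
  qed
  from choice[OF this] obtain D where D: "\<And>i j. D i j \<in> Qpoly p"
    "\<And>i x. (q i has_derivative (\<lambda>h. \<Sum>j\<in>UNIV. h $ j * D i j x)) (at x)"
    by blast
  have "(v has_derivative (\<lambda>h. \<chi> i. \<Sum>j\<in>UNIV. h $ j * D i j x)) (at x within T)" if "x \<in> T" for x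
  proof -
    have "((\<lambda>x. \<chi> i. q i x) has_derivative (\<lambda>h. \<chi> i. \<Sum>j\<in>UNIV. h $ j * D i j x)) (at x within T)"
      unfolding has_derivative_componentwise_within[of "\<lambda>x. \<chi> i. q i x"]
      using has_derivative_at_withinI[OF D(2)] by (auto simp: Basis_vec_def inner_axis)
    moreover have "v y = (\<chi> i. q i y)" if "y \<in> T" for y
      using q(2)[OF that] by (simp add: vec_eq_iff)
    ultimately show ?thesis
      by (intro has_derivative_transform[where g = v and f = "\<lambda>x. \<chi> i. q i x"] that)
  qed
  from that[of D q, OF D(1) this q D(2)] show ?thesis .
qed

context
  fixes T :: "(real^'d) set" and a b :: "real^'d"
  assumes T: "T = cbox a b" and ab: "\<And>i. a $ i < b $ i"
begin

text \<open>In a box with positive edges the derivative within the closed box is unique at boundary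
  points too, so the choice hidden in \<open>frechet_derivative\<close> is determined on faces and
  corners.\<close>

lemma frechet_derivative_within_cell:
  assumes "(v has_derivative v') (at x within T)" "x \<in> T"
  shows "frechet_derivative v (at x within T) = v'"
  unfolding T
proof (rule frechet_derivative_within_cbox)
  show "x \<in> cbox a b" "(v has_derivative v') (at x within cbox a b)"
    using assms T by auto
  show "a \<bullet> i < b \<bullet> i" if "i \<in> Basis" for i
    using that ab by (auto simp: Basis_vec_def inner_axis)
qed

lemma Qpoly_on_cell_grad:
  assumes "Qpoly_on p T v"
  obtains q D where "\<And>i j. D i j \<in> Qpoly p" "\<And>x i j. x \<in> T \<Longrightarrow> cell_grad T v x $ i $ j = D i j x"
    "\<And>i. q i \<in> Qpoly p" "\<And>i x. x \<in> T \<Longrightarrow> v x $ i = q i x"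
    "\<And>i x. (q i has_derivative (\<lambda>h. \<Sum>j\<in>UNIV. h $ j * D i j x)) (at x)"
proof (rule Qpoly_on_has_derivative[OF assms])
  fix q D assume D: "\<And>i j. D i j \<in> Qpoly p"
    "\<And>x. x \<in> T \<Longrightarrow> (v has_derivative (\<lambda>h. \<chi> i. \<Sum>j\<in>UNIV. h $ j * D i j x)) (at x within T)"
    and q: "\<And>i. q i \<in> Qpoly p" "\<And>i x. x \<in> T \<Longrightarrow> v x $ i = q i x"
    "\<And>i x. (q i has_derivative (\<lambda>h. \<Sum>j\<in>UNIV. h $ j * D i j x)) (at x)"
  have "(\<Sum>k\<in>UNIV. axis j 1 $ k * D i k x) = D i j x" for x i j
    by (subst sum.remove[of _ j]) (auto simp: axis_def intro: sum.neutral)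
  then have "cell_grad T v x $ i $ j = D i j x" if "x \<in> T" for x i j
    by (simp add: cell_grad_def matrix_def frechet_derivative_within_cell[OF D(2)[OF that] that])
  from that[of D q, OF D(1) this q] show ?thesis .
qed

lemma continuous_on_cell_grad:
  assumes "Qpoly_on p T v"
  shows "continuous_on T (cell_grad T v)"
proof -
  from assms obtain D where D: "\<And>i j. D i j \<in> Qpoly p" "\<And>x i j. x \<in> T \<Longrightarrow> cell_grad T v x $ i $ j = D i j x"
    by (rule Qpoly_on_cell_grad) blast
  have "continuous_on T (\<lambda>x. \<chi> i j. D i j x)"
    by (intro continuous_on_vec_lambda continuous_on_Qpoly[OF D(1)])
  then show ?thesis
    by (rule continuous_on_eq) (simp add: D vec_eq_iff)
qed

lemma Qpoly_on_directional:
  assumes "Qpoly_on p T v"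
  shows "Qpoly_on p T (\<lambda>x. frechet_derivative v (at x within T) \<nu>)"
proof -
  from assms obtain D where D: "\<And>i j. D i j \<in> Qpoly p"
    "\<And>x. x \<in> T \<Longrightarrow> (v has_derivative (\<lambda>h. \<chi> i. \<Sum>j\<in>UNIV. h $ j * D i j x)) (at x within T)"
    by (rule Qpoly_on_has_derivative) blast
  have "frechet_derivative v (at x within T) \<nu> $ i = (\<Sum>j\<in>UNIV. \<nu> $ j * D i j x)" if "x \<in> T" for x i
    by (simp add: frechet_derivative_within_cell[OF D(2)[OF that] that])
  moreover have "(\<lambda>x. \<Sum>j\<in>UNIV. \<nu> $ j * D i j x) \<in> Qpoly p" for i
    by (intro Qpoly_sum Qpoly_mult D)
  ultimately show ?thesis
    unfolding Qpoly_on_def by (intro allI bexI[of _ "\<lambda>x. \<Sum>j\<in>UNIV. \<nu> $ j * D i j x" for i]) blast+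
qed

text \<open>Polynomiality on T passes through the recursion, which makes each iterated one-sided
  derivative continuous up to the faces, where the ghost penalty evaluates it.\<close>

lemma Qpoly_on_cell_dir_deriv:
  assumes "Qpoly_on p T v"
  shows "Qpoly_on p T (cell_dir_deriv T \<nu> k v)"
proof (induction k)
  case 0
  then show ?case using assms by (simp add: cell_dir_deriv_def)
next
  case (Suc k)
  from Qpoly_on_directional[OF this, of \<nu>] show ?case by (simp add: cell_dir_deriv_def)
qed

end

section \<open>Cartesian meshes\<close>

locale mesh_domain =
  fixes \<Omega> :: "(real^'d) set" and Th :: "(real^'d) set set"
  assumes bounded_domain: "bounded \<Omega>" and open_domain: "open \<Omega>" and domain_ne: "\<Omega> \<noteq> {}"
    and mesh: "cartesian_mesh Th" and covered: "\<Omega> \<subseteq> \<Union> Th"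
begin

lemma meshE:
  obtains N where "\<And>i. finite (N i)" "Th = {cbox a b | a b.
      \<forall>i. a $ i \<in> N i \<and> b $ i \<in> N i \<and> a $ i < b $ i \<and> {a $ i<..<b $ i} \<inter> N i = {}}"
proof -
  obtain N where N: "(\<forall>i. finite (N i) \<and> 2 \<le> card (N i)) \<and> Th = {cbox a b | a b.
      \<forall>i. a $ i \<in> N i \<and> b $ i \<in> N i \<and> a $ i < b $ i \<and> {a $ i<..<b $ i} \<inter> N i = {}}"
    using mesh unfolding cartesian_mesh_def by (rule exE)
  show thesis by (rule that[of N]) (use N in simp_all)
qed

lemma cellE:
  assumes "T \<in> Th"
  obtains a b where "T = cbox a b" "\<And>i. a $ i < b $ i"
proof -
  obtain N where "Th = {cbox a b | a b.
      \<forall>i. a $ i \<in> N i \<and> b $ i \<in> N i \<and> a $ i < b $ i \<and> {a $ i<..<b $ i} \<inter> N i = {}}"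
    by (rule meshE) (rule that)
  with assms show ?thesis using that by auto
qed

lemma finite_mesh: "finite Th"
proof -
  obtain N where N: "\<And>i. finite (N i)"
    and Th: "Th = {cbox a b | a b.
      \<forall>i. a $ i \<in> N i \<and> b $ i \<in> N i \<and> a $ i < b $ i \<and> {a $ i<..<b $ i} \<inter> N i = {}}"
    by (rule meshE) (rule that)
  define A where "A = {a :: real^'d. \<forall>i. a $ i \<in> N i}"
  have "finite (PiE UNIV N)" using N by (intro finite_PiE) auto
  moreover have "A \<subseteq> vec_lambda ` PiE UNIV N"
  proof
    fix a assume "a \<in> A"
    then have "a = vec_lambda (($) a)" "($) a \<in> PiE UNIV N" by (auto simp: A_def)
    then show "a \<in> vec_lambda ` PiE UNIV N" by (metis imageI)
  qed
  ultimately have "finite A" by (meson finite_imageI finite_subset)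
  moreover have "Th \<subseteq> (\<lambda>(a, b). cbox a b) ` (A \<times> A)"
    unfolding Th A_def by auto
  ultimately show ?thesis
    using finite_subset[OF _ finite_imageI[OF finite_cartesian_product]] by blast
qed

text \<open>Distinct cells differ in some coordinate interval. The end points of both intervals are
  grid nodes and neither interval has a node inside, so in that coordinate the open intervals are
  disjoint.\<close>

lemma interior_disjoint:
  assumes "T \<in> Th" "T' \<in> Th" "T \<noteq> T'"
  shows "interior T \<inter> interior T' = {}"
proof -
  obtain N where Th: "Th = {cbox a b | a b.
      \<forall>i. a $ i \<in> N i \<and> b $ i \<in> N i \<and> a $ i < b $ i \<and> {a $ i<..<b $ i} \<inter> N i = {}}"
    by (rule meshE) (rule that)
  obtain a b where T: "T = cbox a b"
    and ab: "\<And>i. a $ i \<in> N i \<and> b $ i \<in> N i \<and> a $ i < b $ i \<and> {a $ i<..<b $ i} \<inter> N i = {}"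
    using assms(1) unfolding Th by auto
  obtain a' b' where T': "T' = cbox a' b'"
    and ab': "\<And>i. a' $ i \<in> N i \<and> b' $ i \<in> N i \<and> a' $ i < b' $ i \<and> {a' $ i<..<b' $ i} \<inter> N i = {}"
    using assms(2) unfolding Th by auto
  have "a \<noteq> a' \<or> b \<noteq> b'" using assms(3) T T' by auto
  then obtain i where "a $ i \<noteq> a' $ i \<or> b $ i \<noteq> b' $ i" by (auto simp: vec_eq_iff)
  moreover have "a $ i \<notin> {a' $ i<..<b' $ i}" "b $ i \<notin> {a' $ i<..<b' $ i}"
    "a' $ i \<notin> {a $ i<..<b $ i}" "b' $ i \<notin> {a $ i<..<b $ i}" "a $ i < b $ i" "a' $ i < b' $ i"
    using ab[of i] ab'[of i] by blast+
  ultimately have "\<not> (a $ i < x \<and> x < b $ i \<and> a' $ i < x \<and> x < b' $ i)" for x :: real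
    by auto
  moreover have "a $ i < x $ i \<and> x $ i < b $ i \<and> a' $ i < x $ i \<and> x $ i < b' $ i"
    if "x \<in> interior T \<inter> interior T'" for x
    using that unfolding T T' interior_cbox by (simp add: mem_box_cart)
  ultimately show ?thesis by blast
qed

lemma closed_cell: "T \<in> Th \<Longrightarrow> closed T"
  by (erule cellE) (simp add: closed_cbox)

lemma compact_cell: "T \<in> Th \<Longrightarrow> compact T"
  by (erule cellE) (simp add: compact_cbox)

lemma convex_cell: "T \<in> Th \<Longrightarrow> convex T"
  by (erule cellE) (simp add: convex_box)

lemma negligible_cell_boundary: "T \<in> Th \<Longrightarrow> negligible (T - interior T)"
  by (erule cellE) (simp add: interior_cbox negligible_frontier_interval)

text \<open>Two boxes meet in a box, and disjoint interiors force it to be empty or flat in some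
  coordinate.\<close>

lemma emeasure_face_finite:
  assumes "T \<in> Th" "T' \<in> Th" "T \<noteq> T'"
  shows "emeasure (hausdorff_measure (CARD('d) - 1)) (T \<inter> T') < \<infinity>"
proof -
  obtain a b where T: "T = cbox a b" using assms(1) by (rule cellE)
  obtain a' b' where T': "T' = cbox a' b'" using assms(2) by (rule cellE)
  obtain c d :: "real^'d" where cd: "T \<inter> T' = cbox c d"
    unfolding T T' Int_interval by blast
  have "box c d = {}"
    using interior_disjoint[OF assms] interior_Int[of T T'] unfolding cd by simp
  then obtain i where i: "d $ i \<le> c $ i" by (auto simp: interval_eq_empty_cart)
  show ?thesis
  proof (cases "cbox c d = {}")
    case True
    then show ?thesis unfolding cd by simp
  next
    case False
    then have "c $ i \<le> d $ i" by (simp add: interval_ne_empty_cart)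
    with i have "c $ i = d $ i" by simp
    then show ?thesis
      unfolding cd by (intro order_le_less_trans[OF emeasure_hausdorff_le] hausdorff_outer_flat_box_finite)
  qed
qed

lemma active_mesh: "T \<in> active \<Omega> Th \<Longrightarrow> T \<in> Th"
  by (simp add: active_def)

lemma finite_active: "finite (active \<Omega> Th)"
  using finite_mesh by (simp add: active_def)

lemma cut_active: "T \<in> cut \<Omega> Th \<Longrightarrow> T \<in> active \<Omega> Th"
  by (simp add: cut_def)

lemma finite_cut: "finite (cut \<Omega> Th)"
  using finite_active by (simp add: cut_def)

lemma domain_subset_active: "\<Omega> \<subseteq> active_domain \<Omega> Th"
  using covered by (auto simp: active_domain_def active_def)

lemma closed_active_domain: "closed (active_domain \<Omega> Th)"
  unfolding active_domain_def using finite_active closed_cell active_mesh by (intro closed_Union) auto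

lemma closure_subset_active: "closure \<Omega> \<subseteq> active_domain \<Omega> Th"
  using domain_subset_active closed_active_domain by (rule closure_minimal)

lemma frontier_subset_active: "frontier \<Omega> \<subseteq> active_domain \<Omega> Th"
  using closure_subset_active by (auto simp: frontier_def)

lemma frontier_subset_cut: "frontier \<Omega> \<subseteq> \<Union> (cut \<Omega> Th)"
  using frontier_subset_active by (auto simp: cut_def active_domain_def)

text \<open>Makes the infimum of the penalty weight over the boundary a genuine greatest lower
  bound.\<close>

lemma frontier_ne: "frontier \<Omega> \<noteq> {}"
  using frontier_not_empty[OF domain_ne] bounded_domain not_bounded_UNIV by blast

lemma mesh_size_pos: "0 < mesh_size Th"
proof -
  obtain T where T: "T \<in> Th" using domain_ne covered by blast
  obtain a b where ab: "T = cbox a b" "\<And>i. a $ i < b $ i" using T by (rule cellE) blast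
  have "a \<noteq> b" using ab(2) by (auto simp: vec_eq_iff order_less_le)
  then have "0 < dist a b" by simp
  also have "\<dots> \<le> diameter T"
    using ab less_imp_le by (intro diameter_bounded_bound) (auto simp: mem_box_cart)
  also have "\<dots> \<le> mesh_size Th"
    unfolding mesh_size_def using T finite_mesh by (intro Max_ge) auto
  finally show ?thesis .
qed

section \<open>The inner cell of a boundary point: existence and measurability\<close>

definition inner_side :: "real^'d \<Rightarrow> (real^'d) set \<Rightarrow> bool" where
  "inner_side x T \<longleftrightarrow> T \<in> active \<Omega> Th \<and> x \<in> T \<and>
     (\<forall>\<^sub>F t in at_right 0. x - t *\<^sub>R outward_normal \<Omega> x \<in> T)"

text \<open>By convexity a single point of the ray in T brings along the segment from x. The limit
  quantifier thus becomes a countable union, as measurability requires.\<close>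

lemma ray_in_cell_iff:
  assumes "T \<in> Th" "x \<in> T"
  shows "(\<forall>\<^sub>F t in at_right 0. x - t *\<^sub>R \<nu> \<in> T) \<longleftrightarrow> (\<exists>n::nat. x - (1 / real (Suc n)) *\<^sub>R \<nu> \<in> T)"
proof
  assume "\<forall>\<^sub>F t in at_right 0. x - t *\<^sub>R \<nu> \<in> T"
  then obtain b where b: "0 < b" "\<And>t. 0 < t \<Longrightarrow> t < b \<Longrightarrow> x - t *\<^sub>R \<nu> \<in> T"
    unfolding eventually_at_right_field by blast
  obtain n where "1 / real (Suc n) < b" using nat_approx_posE[OF b(1)] .
  then show "\<exists>n::nat. x - (1 / real (Suc n)) *\<^sub>R \<nu> \<in> T" using b(2)[of "1 / real (Suc n)"] by auto
next
  assume "\<exists>n::nat. x - (1 / real (Suc n)) *\<^sub>R \<nu> \<in> T"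
  then obtain n where n: "x - (1 / real (Suc n)) *\<^sub>R \<nu> \<in> T" by blast
  have "x - t *\<^sub>R \<nu> \<in> T" if "0 < t" "t < 1 / real (Suc n)" for t
  proof -
    define s where "s = t * real (Suc n)"
    have s: "0 \<le> s" "s \<le> 1" using that by (auto simp: s_def field_simps)
    have "s / real (Suc n) = t" by (simp add: s_def)
    then have "x - t *\<^sub>R \<nu> = (1 - s) *\<^sub>R x + s *\<^sub>R (x - (1 / real (Suc n)) *\<^sub>R \<nu>)"
      by (simp add: scaleR_diff_right scaleR_diff_left)
    also have "\<dots> \<in> T"
      using convexD_alt[OF convex_cell[OF assms(1)] assms(2) n s] .
    finally show ?thesis .
  qed
  then show "\<forall>\<^sub>F t in at_right 0. x - t *\<^sub>R \<nu> \<in> T"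
    unfolding eventually_at_right_field by (intro exI[of _ "1 / real (Suc n)"]) auto
qed

text \<open>The cone condition places short inward steps in \<Omega>; finitely many cells cover
  them, so one cell contains ray points arbitrarily close to x. Closedness adds x itself, and
  convexity fills in the segment. Where no normal exists, the value 0 makes the ray constant and any
  active cell at x serves.\<close>

lemma inner_side_exists:
  assumes x: "x \<in> frontier \<Omega>"
  shows "\<exists>T. inner_side x T"
proof (rule outward_normal_cases[of \<Omega> x])
  assume "outward_normal \<Omega> x = 0"
  then show ?thesis
    using x frontier_subset_active by (auto simp: inner_side_def active_domain_def)
next
  define \<nu> where "\<nu> = outward_normal \<Omega> x"
  assume "is_outward_normal \<Omega> x (outward_normal \<Omega> x)"
  then have n: "norm \<nu> = 1" and *: "\<And>\<epsilon>. 0 < \<epsilon> \<Longrightarrow> \<exists>\<delta>>0. \<forall>y\<in>ball x \<delta>. inner (y - x) \<nu> < - \<epsilon> * norm (y - x) \<longrightarrow> y \<in> \<Omega>"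
    unfolding is_outward_normal_def \<nu>_def by blast+
  obtain \<delta> where \<delta>: "0 < \<delta>" "\<And>y. y \<in> ball x \<delta> \<Longrightarrow> inner (y - x) \<nu> < - (1/2) * norm (y - x) \<Longrightarrow> y \<in> \<Omega>"
    using *[of "1/2"] by auto
  have "inner \<nu> \<nu> = 1" using n by (simp add: norm_eq_1)
  then have "x - t *\<^sub>R \<nu> \<in> \<Omega>" if "0 < t" "t < \<delta>" for t
    using that n by (intro \<delta>(2)) (auto simp: dist_norm)
  then have "\<forall>\<^sub>F t in at_right 0. x - t *\<^sub>R \<nu> \<in> \<Omega>"
    unfolding eventually_at_right_field using \<delta>(1) by blast
  then have "\<forall>\<^sub>F t in at_right 0. \<exists>T\<in>active \<Omega> Th. x - t *\<^sub>R \<nu> \<in> T"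
    by eventually_elim (use domain_subset_active in \<open>auto simp: active_domain_def\<close>)
  then have "\<exists>\<^sub>F t in at_right 0. \<exists>T\<in>active \<Omega> Th. x - t *\<^sub>R \<nu> \<in> T"
    by (rule eventually_frequently[rotated]) simp
  then obtain T where T: "T \<in> active \<Omega> Th" "\<exists>\<^sub>F t in at_right 0. x - t *\<^sub>R \<nu> \<in> T"
    using finite_active by (auto simp: frequently_bex_finite_distrib)
  have "x \<in> T"
  proof (rule ccontr)
    assume "x \<notin> T"
    have "((\<lambda>t. x - t *\<^sub>R \<nu>) \<longlongrightarrow> x - 0 *\<^sub>R \<nu>) (at_right 0)"
      by (intro tendsto_intros)
    then have "\<forall>\<^sub>F t in at_right 0. x - t *\<^sub>R \<nu> \<in> - T"
      using \<open>x \<notin> T\<close> closed_cell[OF active_mesh[OF T(1)]]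
      by (intro topological_tendstoD) auto
    then show False using T(2) by (simp add: frequently_def)
  qed
  obtain t where t: "0 < t" "x - t *\<^sub>R \<nu> \<in> T"
    using frequently_ex[OF frequently_eventually_frequently[OF T(2) eventually_at_right_less]] by blast
  have "x - s *\<^sub>R \<nu> \<in> T" if "0 < s" "s < t" for s
  proof -
    have "x - s *\<^sub>R \<nu> = (1 - s / t) *\<^sub>R x + (s / t) *\<^sub>R (x - t *\<^sub>R \<nu>)"
      using t(1) by (simp add: scaleR_diff_right scaleR_diff_left)
    also have "\<dots> \<in> T"
      using convexD_alt[OF convex_cell[OF active_mesh[OF T(1)]] \<open>x \<in> T\<close> t(2), of "s / t"] that by simp
    finally show ?thesis .
  qed
  then have "\<forall>\<^sub>F t in at_right 0. x - t *\<^sub>R \<nu> \<in> T"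
    unfolding eventually_at_right_field using t(1) by blast
  then show ?thesis
    using T(1) \<open>x \<in> T\<close> by (auto simp: inner_side_def \<nu>_def)
qed

lemma inner_cell_eq: "inner_cell \<Omega> Th x = (SOME T. inner_side x T)"
  by (simp add: inner_cell_def inner_side_def)

lemma inner_cell:
  assumes "x \<in> frontier \<Omega>"
  shows "inner_cell \<Omega> Th x \<in> active \<Omega> Th" "inner_cell \<Omega> Th x \<in> cut \<Omega> Th" "x \<in> inner_cell \<Omega> Th x"
proof -
  have "inner_side x (inner_cell \<Omega> Th x)"
    unfolding inner_cell_eq using inner_side_exists[OF assms] by (rule someI_ex)
  then show "inner_cell \<Omega> Th x \<in> active \<Omega> Th" "x \<in> inner_cell \<Omega> Th x"
    "inner_cell \<Omega> Th x \<in> cut \<Omega> Th"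
    using assms by (auto simp: inner_side_def cut_def)
qed

lemma borel_inner_side: "{x. inner_side x T} \<in> sets borel"
proof (cases "T \<in> active \<Omega> Th")
  case True
  have [measurable]: "T \<in> sets borel"
    using closed_cell[OF active_mesh[OF True]] by (rule borel_closed)
  have "{x. inner_side x T} = {x \<in> space borel. x \<in> T \<and> (\<exists>n::nat. x - (1 / real (Suc n)) *\<^sub>R outward_normal \<Omega> x \<in> T)}"
    using True ray_in_cell_iff[OF active_mesh[OF True]] by (auto simp: inner_side_def)
  also have "\<dots> \<in> sets borel" by measurable
  finally show ?thesis .
qed (simp add: inner_side_def)

text \<open>The choice in \<^const>\<open>inner_cell\<close> depends on \<open>x\<close> only through the set of admissible cells, which
  takes finitely many values.\<close>

lemma borel_inner_cell: "{x \<in> frontier \<Omega>. inner_cell \<Omega> Th x = T} \<in> sets borel"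
proof -
  define F where "F A = (SOME T. T \<in> A)" for A :: "(real^'d) set set"
  \<comment> \<open>The boundary points whose set of admissible cells is exactly A; on them the
    choice is constantly \<open>F A\<close>, provided A consists of active cells.\<close>
  define E where "E A = frontier \<Omega> \<inter> (\<Inter>S\<in>active \<Omega> Th. if S \<in> A then {x. inner_side x S} else - {x. inner_side x S})" for A
  have fr: "frontier \<Omega> \<in> sets borel" by (intro borel_closed) simp
  have "frontier \<Omega> \<inter> (\<Inter>S\<in>B. if S \<in> A then {x. inner_side x S} else - {x. inner_side x S}) \<in> sets borel"
    if "finite B" for A B
    using that
  proof (induction B rule: finite_induct)
    case empty
    then show ?case using fr by simp
  next
    case (insert S B)
    have "(if S \<in> A then {x. inner_side x S} else - {x. inner_side x S}) \<in> sets borel"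
      using borel_inner_side[of S] by (auto intro: borel_comp)
    from sets.Int[OF this insert.IH] show ?case
      by (simp only: INT_insert Int_left_commute)
  qed
  then have E: "E A \<in> sets borel" for A
    unfolding E_def using finite_active by blast
  have "{x \<in> frontier \<Omega>. inner_cell \<Omega> Th x = T} = (\<Union>A\<in>{A \<in> Pow (active \<Omega> Th). F A = T}. E A)"
  proof (intro set_eqI iffI)
    fix x assume x: "x \<in> {x \<in> frontier \<Omega>. inner_cell \<Omega> Th x = T}"
    then have "F {T. inner_side x T} = T" by (simp add: F_def inner_cell_eq)
    moreover have "x \<in> E {T. inner_side x T}" using x by (auto simp: E_def)
    moreover have "{T. inner_side x T} \<subseteq> active \<Omega> Th" by (auto simp: inner_side_def)
    ultimately show "x \<in> (\<Union>A\<in>{A \<in> Pow (active \<Omega> Th). F A = T}. E A)" by blast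
  next
    fix x assume "x \<in> (\<Union>A\<in>{A \<in> Pow (active \<Omega> Th). F A = T}. E A)"
    then obtain A where A: "A \<subseteq> active \<Omega> Th" "F A = T" "x \<in> E A" by blast
    have "S \<in> A \<longleftrightarrow> inner_side x S" for S
    proof (cases "S \<in> active \<Omega> Th")
      case True
      then have "x \<in> (if S \<in> A then {x. inner_side x S} else - {x. inner_side x S})"
        using A(3) by (auto simp: E_def)
      then show ?thesis by (auto split: if_splits)
    next
      case False
      then show ?thesis using A(1) by (auto simp: inner_side_def)
    qed
    then have "A = {T. inner_side x T}" by blast
    then show "x \<in> {x \<in> frontier \<Omega>. inner_cell \<Omega> Th x = T}"
      using A by (simp add: F_def inner_cell_eq E_def)
  qed
  also have "\<dots> \<in> sets borel"
    using E finite_active by (intro sets.finite_UN) auto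
  finally show ?thesis .
qed

end

section \<open>Integration over cells and over the boundary\<close>

lemma space_surface_on [simp]: "space (surface_on S) = S"
  by (simp add: surface_on_def space_restrict_space)

lemma sets_surface_on: "sets (surface_on S) = sets (restrict_space borel S)"
  by (simp add: surface_on_def sets_restrict_space)

lemma borel_measurable_surface_on_cong:
  "borel_measurable (surface_on S) = borel_measurable (restrict_space borel S)"
  by (rule measurable_cong_sets) (simp_all add: sets_surface_on)

lemma nn_integral_surface_on:
  fixes S :: "(real^'d) set"
  assumes "S \<in> sets borel"
  shows "(\<integral>\<^sup>+x. f x \<partial>surface_on S) = (\<integral>\<^sup>+x. f x * indicator S x \<partial>hausdorff_measure (CARD('d) - 1))"
  unfolding surface_on_def using assms by (simp add: nn_integral_restrict_space)

lemma emeasure_surface_on: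
  fixes S :: "(real^'d) set"
  assumes "S \<in> sets borel"
  shows "emeasure (surface_on S) S = emeasure (hausdorff_measure (CARD('d) - 1)) S"
  unfolding surface_on_def using assms by (simp add: emeasure_restrict_space)

lemma finite_measure_surface_on:
  fixes S :: "(real^'d) set"
  assumes "S \<in> sets borel" "emeasure (hausdorff_measure (CARD('d) - 1)) S < \<infinity>"
  shows "finite_measure (surface_on S)"
  using assms by (intro finite_measureI) (simp add: emeasure_surface_on)

lemma integrable_continuous_surface_on:
  fixes f :: "real^'d \<Rightarrow> 'b::{banach, second_countable_topology}"
  assumes "compact S" "emeasure (hausdorff_measure (CARD('d) - 1)) S < \<infinity>" "continuous_on S f"
  shows "integrable (surface_on S) f"
proof -
  have S: "S \<in> sets borel" using assms(1) by (intro borel_closed compact_imp_closed)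
  obtain B where "\<And>x. x \<in> S \<Longrightarrow> norm (f x) \<le> B"
    using compact_imp_bounded[OF compact_continuous_image[OF assms(3,1)]] by (auto simp: bounded_iff)
  moreover have "f \<in> borel_measurable (surface_on S)"
    unfolding borel_measurable_surface_on_cong
    using assms(3) by (rule borel_measurable_continuous_on_restrict)
  ultimately show ?thesis
    by (intro finite_measure.integrable_const_bound[OF finite_measure_surface_on[OF S assms(2)], of _ B]
        AE_I2) auto
qed

text \<open>Reduces gradients to their entries, because the trace inequality is stated for
  scalars.\<close>

lemma L2sq_eq_sum_components:
  fixes f :: "'a \<Rightarrow> real^'n^'m"
  assumes "\<And>i j. (\<lambda>x. f x $ i $ j) \<in> borel_measurable M"
  shows "L2sq M f = (\<Sum>i\<in>UNIV. \<Sum>j\<in>UNIV. L2sq M (\<lambda>x. f x $ i $ j))"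
proof -
  have "ennreal ((norm (f x))\<^sup>2) = (\<Sum>i\<in>UNIV. \<Sum>j\<in>UNIV. ennreal ((norm (f x $ i $ j))\<^sup>2))" for x
  proof -
    have "(norm (f x))\<^sup>2 = (\<Sum>i\<in>UNIV. \<Sum>j\<in>UNIV. (norm (f x $ i $ j))\<^sup>2)"
      by (simp add: norm_vec_def L2_set_def real_sqrt_pow2 sum_nonneg)
    then show ?thesis by (simp only: sum_ennreal sum_nonneg zero_le_power2)
  qed
  then have "L2sq M f = (\<integral>\<^sup>+x. (\<Sum>i\<in>UNIV. \<Sum>j\<in>UNIV. ennreal ((norm (f x $ i $ j))\<^sup>2)) \<partial>M)"
    unfolding L2sq_def by presburger
  also have "\<dots> = (\<Sum>i\<in>UNIV. \<integral>\<^sup>+x. (\<Sum>j\<in>UNIV. ennreal ((norm (f x $ i $ j))\<^sup>2)) \<partial>M)"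
    using assms by (intro nn_integral_sum) measurable
  also have "\<dots> = (\<Sum>i\<in>UNIV. \<Sum>j\<in>UNIV. L2sq M (\<lambda>x. f x $ i $ j))"
    unfolding L2sq_def using assms by (intro sum.cong refl nn_integral_sum) measurable
  finally show ?thesis .
qed

text \<open>Translates the extended-valued quantities of the assumed inequalities into the real
  integrals of the forms.\<close>

lemma ennreal_norm_sq_integral:
  fixes f :: "'a \<Rightarrow> 'b::real_normed_vector"
  assumes "integrable M (\<lambda>x. (norm (f x))\<^sup>2)"
  shows "L2sq M f = ennreal (\<integral>x. (norm (f x))\<^sup>2 \<partial>M)"
  unfolding L2sq_def using assms by (intro nn_integral_eq_integral) auto

context mesh_domain
begin

section \<open>Volume integrals of cellwise continuous functions\<close>

definition mesh_interior :: "(real^'d) set" where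
  "mesh_interior = (\<Union>T\<in>active \<Omega> Th. interior T)"

lemma open_mesh_interior: "open mesh_interior"
  by (auto simp: mesh_interior_def)

lemma mesh_interior_subset: "mesh_interior \<subseteq> active_domain \<Omega> Th"
  using interior_subset by (auto simp: mesh_interior_def active_domain_def)

lemma negligible_skeleton: "negligible (active_domain \<Omega> Th - mesh_interior)"
proof -
  have "negligible (\<Union>T\<in>active \<Omega> Th. T - interior T)"
    using finite_active negligible_cell_boundary active_mesh by (intro negligible_Union) auto
  then show ?thesis
    by (rule negligible_subset) (auto simp: active_domain_def mesh_interior_def)
qed

lemma domain_lmeasurable: "\<Omega> \<in> lmeasurable"
  using bounded_domain open_domain by (rule lmeasurable_open)

lemma domain_sets_lebesgue: "\<Omega> \<in> sets lebesgue"
  using domain_lmeasurable by (rule fmeasurableD)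

lemma AE_mesh_interior: "AE x in lebesgue_on \<Omega>. x \<in> mesh_interior"
proof -
  have "active_domain \<Omega> Th - mesh_interior \<in> null_sets lebesgue"
    using negligible_skeleton negligible_iff_null_sets by blast
  then have "AE x in lebesgue. x \<notin> active_domain \<Omega> Th - mesh_interior"
    by (rule AE_not_in)
  then have "AE x in lebesgue. x \<in> \<Omega> \<longrightarrow> x \<in> mesh_interior"
    by eventually_elim (use domain_subset_active in auto)
  then show ?thesis
    using domain_sets_lebesgue by (subst AE_restrict_space_iff) auto
qed

text \<open>On the mesh skeleton f is arbitrary. The skeleton is null and Lebesgue measure is
  complete, so that part of a preimage is measurable whatever f does there.\<close>

lemma measurable_on_domain:
  fixes f :: "real^'d \<Rightarrow> 'b::topological_space"
  assumes "continuous_on mesh_interior f"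
  shows "f \<in> borel_measurable (lebesgue_on \<Omega>)"
proof (rule borel_measurableI)
  fix S :: "'b set" assume S: "open S"
  have "open (f -` S \<inter> mesh_interior)"
    using assms S continuous_on_open_vimage[OF open_mesh_interior] by blast
  then have "f -` S \<inter> mesh_interior \<inter> \<Omega> \<in> sets lebesgue"
    using borel_open[OF open_Int[OF _ open_domain]] by (simp del: Int_assoc)
  moreover have "negligible (f -` S \<inter> (\<Omega> - mesh_interior))"
    by (rule negligible_subset[OF negligible_skeleton]) (use domain_subset_active in auto)
  then have "f -` S \<inter> (\<Omega> - mesh_interior) \<in> sets lebesgue"
    by (rule negligible_imp_sets)
  ultimately have "f -` S \<inter> mesh_interior \<inter> \<Omega> \<union> f -` S \<inter> (\<Omega> - mesh_interior) \<in> sets lebesgue"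
    by (rule sets.Un)
  also have "f -` S \<inter> mesh_interior \<inter> \<Omega> \<union> f -` S \<inter> (\<Omega> - mesh_interior) = f -` S \<inter> space (lebesgue_on \<Omega>)"
    by auto
  finally show "f -` S \<inter> space (lebesgue_on \<Omega>) \<in> sets (lebesgue_on \<Omega>)"
    using domain_sets_lebesgue by (simp add: sets_restrict_space_iff)
qed

lemma integrable_on_domain:
  fixes f :: "real^'d \<Rightarrow> 'b::{banach, second_countable_topology}"
  assumes "continuous_on mesh_interior f" "\<And>x. x \<in> mesh_interior \<Longrightarrow> norm (f x) \<le> B"
  shows "integrable (lebesgue_on \<Omega>) f"
proof (rule finite_measure.integrable_const_bound[OF finite_measure_lebesgue_on[OF domain_lmeasurable]])
  show "AE x in lebesgue_on \<Omega>. norm (f x) \<le> B"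
    using AE_mesh_interior by eventually_elim (rule assms)
qed (rule measurable_on_domain[OF assms(1)])

lemma Vh_Qpoly_on: "v \<in> Vh p \<Omega> Th \<Longrightarrow> T \<in> active \<Omega> Th \<Longrightarrow> Qpoly_on p T v"
  by (simp add: Vh_def Qpoly_on_def)

lemma Vh_continuous: "v \<in> Vh p \<Omega> Th \<Longrightarrow> continuous_on (active_domain \<Omega> Th) v"
  by (simp add: Vh_def)

lemma Vh_continuous_cell: "v \<in> Vh p \<Omega> Th \<Longrightarrow> T \<in> active \<Omega> Th \<Longrightarrow> continuous_on T v"
  by (intro continuous_on_Qpoly_on Vh_Qpoly_on)

lemma grad_interior:
  assumes "x \<in> interior T"
  shows "grad v x = cell_grad T v x"
  using at_within_interior[OF assms] by (simp add: grad_def cell_grad_def)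

lemma Vh_continuous_cell_grad:
  assumes "v \<in> Vh p \<Omega> Th" "T \<in> active \<Omega> Th"
  shows "continuous_on T (cell_grad T v)"
proof -
  obtain a b where "T = cbox a b" "\<And>i. a $ i < b $ i"
    using active_mesh[OF assms(2)] by (rule cellE) (rule that)
  from continuous_on_cell_grad[OF this Vh_Qpoly_on[OF assms]] show ?thesis .
qed

lemma Vh_cell_grad_Qpoly:
  assumes "v \<in> Vh p \<Omega> Th" "T \<in> active \<Omega> Th"
  obtains q D where "\<And>i j. D i j \<in> Qpoly p" "\<And>x i j. x \<in> T \<Longrightarrow> cell_grad T v x $ i $ j = D i j x"
    "\<And>i. q i \<in> Qpoly p" "\<And>i x. x \<in> T \<Longrightarrow> v x $ i = q i x"
    "\<And>i x. (q i has_derivative (\<lambda>h. \<Sum>j\<in>UNIV. h $ j * D i j x)) (at x)"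
proof -
  obtain a b where "T = cbox a b" "\<And>i. a $ i < b $ i"
    using active_mesh[OF assms(2)] by (rule cellE) (rule that)
  from Qpoly_on_cell_grad[OF this Vh_Qpoly_on[OF assms] that] show ?thesis .
qed

lemma continuous_on_mesh_interior:
  assumes "\<And>T. T \<in> active \<Omega> Th \<Longrightarrow> continuous_on T (f T)"
    and "\<And>T x. T \<in> active \<Omega> Th \<Longrightarrow> x \<in> interior T \<Longrightarrow> g x = f T x"
  shows "continuous_on mesh_interior g"
  unfolding mesh_interior_def
proof (rule continuous_on_open_UN)
  fix T assume T: "T \<in> active \<Omega> Th"
  have "continuous_on (interior T) (f T)"
    using assms(1)[OF T] interior_subset by (rule continuous_on_subset)
  then show "continuous_on (interior T) g"
    using assms(2)[OF T] by (simp cong: continuous_on_cong)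
qed simp

lemma Vh_continuous_on_grad:
  assumes "v \<in> Vh p \<Omega> Th"
  shows "continuous_on mesh_interior (grad v)"
  by (rule continuous_on_mesh_interior[where f = "\<lambda>T. cell_grad T v"])
    (use Vh_continuous_cell_grad grad_interior assms in blast)+

lemma bounded_over_cells:
  fixes f :: "(real^'d) set \<Rightarrow> real^'d \<Rightarrow> 'b::real_normed_vector"
  assumes "\<And>T. T \<in> active \<Omega> Th \<Longrightarrow> continuous_on T (f T)"
  obtains B where "0 \<le> B" "\<And>T x. T \<in> active \<Omega> Th \<Longrightarrow> x \<in> T \<Longrightarrow> norm (f T x) \<le> B"
proof -
  have "bounded (\<Union>T\<in>active \<Omega> Th. f T ` T)"
    by (intro bounded_UN finite_active ballI compact_imp_bounded compact_continuous_image assms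
        compact_cell active_mesh)
  then obtain B where "0 < B" "\<forall>y\<in>(\<Union>T\<in>active \<Omega> Th. f T ` T). norm y \<le> B"
    unfolding bounded_pos by blast
  then show ?thesis using that[of B] by auto
qed

text \<open>Finitely many compact cells give a common bound, and \<Omega> has finite measure. On the
  faces g is left open, since \<open>grad\<close> may be an unspecified value there.\<close>

lemma integrable_cellwise:
  fixes f :: "(real^'d) set \<Rightarrow> real^'d \<Rightarrow> 'b::{banach, second_countable_topology}"
  assumes f: "\<And>T. T \<in> active \<Omega> Th \<Longrightarrow> continuous_on T (f T)"
    and g: "\<And>T x. T \<in> active \<Omega> Th \<Longrightarrow> x \<in> interior T \<Longrightarrow> g x = f T x"
  shows "integrable (lebesgue_on \<Omega>) g"
proof -
  obtain B where B: "\<And>T x. T \<in> active \<Omega> Th \<Longrightarrow> x \<in> T \<Longrightarrow> norm (f T x) \<le> B"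
    using bounded_over_cells[OF f] by blast
  show ?thesis
  proof (rule integrable_on_domain)
    show "continuous_on mesh_interior g" using f g by (rule continuous_on_mesh_interior)
    show "norm (g x) \<le> B" if "x \<in> mesh_interior" for x
      using that B g interior_subset by (fastforce simp: mesh_interior_def)
  qed
qed

text \<open>Cell boundaries are null and cell interiors disjoint, so at each point at most one term
  counts and no overlap constant enters.\<close>

lemma sum_L2sq_cell_grad_le:
  assumes v: "v \<in> Vh p \<Omega> Th"
  shows "(\<Sum>T\<in>active \<Omega> Th. L2sq (lebesgue_on T) (cell_grad T v))
    \<le> L2sq (lebesgue_on (active_domain \<Omega> Th)) (grad v)"
proof -
  define f where "f T x = ennreal ((norm (cell_grad T v x))\<^sup>2) * indicator (interior T) x" for T x
  have "L2sq (lebesgue_on T) (cell_grad T v) = (\<integral>\<^sup>+x. f T x \<partial>lebesgue)" if T: "T \<in> active \<Omega> Th" for T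
  proof -
    have "T \<in> sets lebesgue"
      using compact_cell[OF active_mesh[OF T]] lmeasurable_compact fmeasurableD by blast
    then have "L2sq (lebesgue_on T) (cell_grad T v)
        = (\<integral>\<^sup>+x. ennreal ((norm (cell_grad T v x))\<^sup>2) * indicator T x \<partial>lebesgue)"
      unfolding L2sq_def by (intro nn_integral_restrict_space) simp
    also have "\<dots> = (\<integral>\<^sup>+x. f T x \<partial>lebesgue)"
    proof (rule nn_integral_cong_AE)
      have "AE x in lebesgue. x \<notin> T - interior T"
        using negligible_cell_boundary[OF active_mesh[OF T]] negligible_iff_null_sets
        by (intro AE_not_in) blast
      then show "AE x in lebesgue. ennreal ((norm (cell_grad T v x))\<^sup>2) * indicator T x = f T x"
        by eventually_elim (use interior_subset in \<open>auto simp: f_def indicator_def\<close>)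
    qed
    finally show ?thesis .
  qed
  moreover have "f T \<in> borel_measurable lebesgue" if T: "T \<in> active \<Omega> Th" for T
  proof -
    have "continuous_on (interior T) (\<lambda>x. (norm (cell_grad T v x))\<^sup>2)"
      using Vh_continuous_cell_grad[OF v T] interior_subset
      by (intro continuous_intros) (rule continuous_on_subset)
    then have "(\<lambda>x. (norm (cell_grad T v x))\<^sup>2) \<in> borel_measurable (lebesgue_on (interior T))"
      by (rule continuous_imp_measurable_on_sets_lebesgue) simp
    then have "(\<lambda>x. ennreal ((norm (cell_grad T v x))\<^sup>2)) \<in> borel_measurable (lebesgue_on (interior T))"
      by measurable
    then show ?thesis
      unfolding f_def by (subst (asm) borel_measurable_restrict_space_iff_ennreal) auto
  qed
  ultimately have "(\<Sum>T\<in>active \<Omega> Th. L2sq (lebesgue_on T) (cell_grad T v))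
      = (\<integral>\<^sup>+x. (\<Sum>T\<in>active \<Omega> Th. f T x) \<partial>lebesgue)"
    by (simp add: nn_integral_sum)
  also have "\<dots> \<le> (\<integral>\<^sup>+x. ennreal ((norm (grad v x))\<^sup>2) * indicator (active_domain \<Omega> Th) x \<partial>lebesgue)"
  proof (rule nn_integral_mono)
    fix x
    show "(\<Sum>T\<in>active \<Omega> Th. f T x) \<le> ennreal ((norm (grad v x))\<^sup>2) * indicator (active_domain \<Omega> Th) x"
    proof (cases "\<exists>T\<in>active \<Omega> Th. x \<in> interior T")
      case True
      then obtain T where T: "T \<in> active \<Omega> Th" "x \<in> interior T" by blast
      have "f S x = 0" if "S \<in> active \<Omega> Th - {T}" for S
        using interior_disjoint[of S T] that T active_mesh by (auto simp: f_def indicator_def)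
      then have "(\<Sum>T\<in>active \<Omega> Th. f T x) = f T x"
        using T(1) finite_active by (subst sum.remove[of _ T]) auto
      moreover have "x \<in> active_domain \<Omega> Th"
        using T interior_subset by (auto simp: active_domain_def)
      ultimately show ?thesis
        using T grad_interior[OF T(2)] by (simp add: f_def)
    next
      case False
      then have "(\<Sum>T\<in>active \<Omega> Th. f T x) = 0" by (intro sum.neutral) (auto simp: f_def)
      then show ?thesis by simp
    qed
  qed
  also have "\<dots> = L2sq (lebesgue_on (active_domain \<Omega> Th)) (grad v)"
    unfolding L2sq_def using closed_active_domain
    by (intro nn_integral_restrict_space[symmetric]) (simp add: borel_closed)
  finally show ?thesis .
qed

lemma compact_frontier_domain: "compact (frontier \<Omega>)"
  using bounded_domain by (rule compact_frontier_bounded)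

lemma borel_frontier: "frontier \<Omega> \<in> sets borel"
  by (intro borel_closed) simp

text \<open>\<open>inner_cell\<close> takes finitely many values on the boundary, each on a Borel
  set, and on each such set the function is the restriction of one continuous function.\<close>

lemma measurable_boundary:
  assumes f: "\<And>T. T \<in> active \<Omega> Th \<Longrightarrow> continuous_on T (f T)"
  shows "(\<lambda>x. f (inner_cell \<Omega> Th x) x) \<in> borel_measurable (surface_on (frontier \<Omega>))"
  unfolding borel_measurable_surface_on_cong
proof (rule borel_measurableI)
  fix S :: "'a set" assume S: "open S"
  have "{x \<in> frontier \<Omega>. inner_cell \<Omega> Th x = T} \<inter> (f T -` S \<inter> T) \<in> sets borel" if "T \<in> active \<Omega> Th" for T
  proof -
    have "T \<in> sets borel" using closed_cell[OF active_mesh[OF that]] by (rule borel_closed)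
    moreover have "f T -` S \<inter> T \<in> sets (restrict_space borel T)"
      using measurable_sets[OF borel_measurable_continuous_on_restrict[OF f[OF that]] borel_open[OF S]]
      by (simp add: space_restrict_space)
    ultimately have "f T -` S \<inter> T \<in> sets borel" by (simp add: sets_restrict_space_iff)
    then show ?thesis using borel_inner_cell by blast
  qed
  then have "(\<Union>T\<in>active \<Omega> Th. {x \<in> frontier \<Omega>. inner_cell \<Omega> Th x = T} \<inter> (f T -` S \<inter> T)) \<in> sets borel"
    using finite_active by (intro sets.finite_UN) auto
  also have "(\<Union>T\<in>active \<Omega> Th. {x \<in> frontier \<Omega>. inner_cell \<Omega> Th x = T} \<inter> (f T -` S \<inter> T))
      = (\<lambda>x. f (inner_cell \<Omega> Th x) x) -` S \<inter> frontier \<Omega>"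
    using inner_cell by auto
  finally show "(\<lambda>x. f (inner_cell \<Omega> Th x) x) -` S \<inter> space (restrict_space borel (frontier \<Omega>))
      \<in> sets (restrict_space borel (frontier \<Omega>))"
    using borel_frontier by (simp add: sets_restrict_space_iff space_restrict_space)
qed

end

section \<open>Boundary integrals under the trace inequality\<close>

locale traced_mesh_domain = mesh_domain \<Omega> Th for \<Omega> :: "(real^'d) set" and Th +
  fixes p :: nat and C_T :: real
  assumes trace: "trace_inequality p C_T \<Omega> Th" and C_T: "0 < C_T"
begin

lemma frontier_cell_finite:
  assumes "T \<in> cut \<Omega> Th"
  shows "emeasure (hausdorff_measure (CARD('d) - 1)) (frontier \<Omega> \<inter> T) < \<infinity>"
proof -
  have T: "T \<in> Th" using assms by (simp add: cut_def active_def)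
  have S: "frontier \<Omega> \<inter> T \<in> sets borel"
    using closed_cell[OF T] by (intro borel_closed closed_Int) auto
  have "ennreal (mesh_size Th) * L2sq (surface_on (frontier \<Omega> \<inter> T)) (\<lambda>x :: real^'d. 1::real)
      \<le> ennreal C_T * L2sq (lebesgue_on T) (\<lambda>x :: real^'d. 1::real)"
    using trace assms Qpoly_const unfolding trace_inequality_def by blast
  also have "L2sq (lebesgue_on T) (\<lambda>x :: real^'d. 1::real) = emeasure lebesgue T"
    using lmeasurable_compact[OF compact_cell[OF T]]
    by (simp add: L2sq_def emeasure_restrict_space)
  also have "L2sq (surface_on (frontier \<Omega> \<inter> T)) (\<lambda>x :: real^'d. 1::real)
      = emeasure (hausdorff_measure (CARD('d) - 1)) (frontier \<Omega> \<inter> T)"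
    using S by (simp add: L2sq_def emeasure_surface_on)
  also have "ennreal C_T * emeasure lebesgue T < \<infinity>"
    using fmeasurableD2[OF lmeasurable_compact[OF compact_cell[OF T]]]
    by (simp only: ennreal_mult_less_top infinity_ennreal_def) (auto simp: top.not_eq_extremum)
  finally show ?thesis
    using mesh_size_pos by (auto simp: ennreal_mult_less_top)
qed

lemma frontier_finite: "emeasure (hausdorff_measure (CARD('d) - 1)) (frontier \<Omega>) < \<infinity>"
proof -
  have S: "frontier \<Omega> \<inter> T \<in> sets borel" if "T \<in> cut \<Omega> Th" for T
    using closed_cell[OF active_mesh[OF cut_active[OF that]]] by (intro borel_closed closed_Int) auto
  have "frontier \<Omega> = (\<Union>T\<in>cut \<Omega> Th. frontier \<Omega> \<inter> T)"
    using frontier_subset_cut by auto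
  then have "emeasure (hausdorff_measure (CARD('d) - 1)) (frontier \<Omega>)
      = emeasure (hausdorff_measure (CARD('d) - 1)) (\<Union>T\<in>cut \<Omega> Th. frontier \<Omega> \<inter> T)"
    by simp
  also have "\<dots> \<le> (\<Sum>T\<in>cut \<Omega> Th. emeasure (hausdorff_measure (CARD('d) - 1)) (frontier \<Omega> \<inter> T))"
    using S finite_cut by (intro emeasure_subadditive_finite) auto
  also have "\<dots> < \<infinity>"
    using frontier_cell_finite by (simp add: ennreal_sum_less_top finite_cut)
  finally show ?thesis .
qed

lemma integrable_boundary:
  fixes f :: "(real^'d) set \<Rightarrow> real^'d \<Rightarrow> 'b::{banach, second_countable_topology}"
  assumes f: "\<And>T. T \<in> active \<Omega> Th \<Longrightarrow> continuous_on T (f T)"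
  shows "integrable (surface_on (frontier \<Omega>)) (\<lambda>x. f (inner_cell \<Omega> Th x) x)"
proof -
  obtain B where "\<And>T x. T \<in> active \<Omega> Th \<Longrightarrow> x \<in> T \<Longrightarrow> norm (f T x) \<le> B"
    using bounded_over_cells[OF f] by blast
  then have "\<And>x. x \<in> frontier \<Omega> \<Longrightarrow> norm (f (inner_cell \<Omega> Th x) x) \<le> B"
    using inner_cell by blast
  then show ?thesis
    by (intro finite_measure.integrable_const_bound[OF
          finite_measure_surface_on[OF borel_frontier frontier_finite], of _ B]
        AE_I2 measurable_boundary f) auto
qed

text \<open>The gradient entries on a cut cell are polynomials in \<open>Qpoly p\<close>, so the
  trace inequality applies entrywise and adds up with the same constant. Every boundary point is
  charged to its inner cell, which is cut.\<close>

lemma boundary_grad_trace: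
  assumes v: "v \<in> Vh p \<Omega> Th"
  shows "ennreal (mesh_size Th) * L2sq (surface_on (frontier \<Omega>)) (boundary_grad \<Omega> Th v)
    \<le> ennreal C_T * L2sq (lebesgue_on (active_domain \<Omega> Th)) (grad v)"
proof -
  define H :: "(real^'d) measure" where "H = hausdorff_measure (CARD('d) - 1)"
  define f where "f T x = ennreal ((norm (cell_grad T v x))\<^sup>2)" for T x
  have cell: "ennreal (mesh_size Th) * (\<integral>\<^sup>+x. f T x * indicator (frontier \<Omega> \<inter> T) x \<partial>H)
      \<le> ennreal C_T * L2sq (lebesgue_on T) (cell_grad T v)" if T: "T \<in> cut \<Omega> Th" for T
  proof -
    have TT: "T \<in> Th" "T \<in> active \<Omega> Th" using T by (auto simp: cut_def active_def)
    have S: "frontier \<Omega> \<inter> T \<in> sets borel"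
      using closed_cell[OF TT(1)] by (intro borel_closed closed_Int) auto
    obtain D where D: "\<And>i j. D i j \<in> Qpoly p" "\<And>x i j. x \<in> T \<Longrightarrow> cell_grad T v x $ i $ j = D i j x"
      by (rule Vh_cell_grad_Qpoly[OF v TT(2)]) blast
    have eq: "cell_grad T v x = (\<chi> i j. D i j x)" if "x \<in> T" for x
      using D(2)[OF that] by (simp add: vec_eq_iff)
    have "(\<integral>\<^sup>+x. f T x * indicator (frontier \<Omega> \<inter> T) x \<partial>H) = L2sq (surface_on (frontier \<Omega> \<inter> T)) (cell_grad T v)"
      unfolding L2sq_def nn_integral_surface_on[OF S] f_def H_def ..
    also have "\<dots> = L2sq (surface_on (frontier \<Omega> \<inter> T)) (\<lambda>x. \<chi> i j. D i j x)"
      unfolding L2sq_def by (intro nn_integral_cong) (simp add: eq)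
    also have "\<dots> = (\<Sum>i\<in>UNIV. \<Sum>j\<in>UNIV. L2sq (surface_on (frontier \<Omega> \<inter> T)) (D i j))"
      by (subst L2sq_eq_sum_components) (auto simp: borel_measurable_surface_on_cong
          intro!: borel_measurable_continuous_on_restrict continuous_on_Qpoly[OF D(1)])
    finally have "ennreal (mesh_size Th) * (\<integral>\<^sup>+x. f T x * indicator (frontier \<Omega> \<inter> T) x \<partial>H)
        = (\<Sum>i\<in>UNIV. \<Sum>j\<in>UNIV. ennreal (mesh_size Th) * L2sq (surface_on (frontier \<Omega> \<inter> T)) (D i j))"
      by (simp add: sum_distrib_left)
    also have "\<dots> \<le> (\<Sum>i\<in>UNIV. \<Sum>j\<in>UNIV. ennreal C_T * L2sq (lebesgue_on T) (D i j))"
      using trace T D(1) unfolding trace_inequality_def by (intro sum_mono) blast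
    also have "\<dots> = ennreal C_T * (\<Sum>i\<in>UNIV. \<Sum>j\<in>UNIV. L2sq (lebesgue_on T) (D i j))"
      by (simp add: sum_distrib_left)
    also have "(\<Sum>i\<in>UNIV. \<Sum>j\<in>UNIV. L2sq (lebesgue_on T) (D i j)) = L2sq (lebesgue_on T) (\<lambda>x. \<chi> i j. D i j x)"
      using fmeasurableD[OF lmeasurable_compact[OF compact_cell[OF TT(1)]]]
      by (subst L2sq_eq_sum_components)
        (auto intro!: continuous_imp_measurable_on_sets_lebesgue continuous_on_Qpoly[OF D(1)])
    also have "\<dots> = L2sq (lebesgue_on T) (cell_grad T v)"
      unfolding L2sq_def by (intro nn_integral_cong) (simp add: eq)
    finally show ?thesis .
  qed
  have "L2sq (surface_on (frontier \<Omega>)) (boundary_grad \<Omega> Th v)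
      = (\<integral>\<^sup>+x. f (inner_cell \<Omega> Th x) x * indicator (frontier \<Omega>) x \<partial>H)"
    unfolding L2sq_def nn_integral_surface_on[OF borel_frontier] boundary_grad_def f_def H_def ..
  \<comment> \<open>A point shared by several cut cells is counted once for each of them; this only
    enlarges the right-hand side.\<close>
  also have "\<dots> \<le> (\<integral>\<^sup>+x. (\<Sum>T\<in>cut \<Omega> Th. f T x * indicator (frontier \<Omega> \<inter> T) x) \<partial>H)"
  proof (rule nn_integral_mono)
    fix x
    show "f (inner_cell \<Omega> Th x) x * indicator (frontier \<Omega>) x
        \<le> (\<Sum>T\<in>cut \<Omega> Th. f T x * indicator (frontier \<Omega> \<inter> T) x)"
    proof (cases "x \<in> frontier \<Omega>")
      case True
      then have "f (inner_cell \<Omega> Th x) x * indicator (frontier \<Omega>) x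
          = f (inner_cell \<Omega> Th x) x * indicator (frontier \<Omega> \<inter> inner_cell \<Omega> Th x) x"
        using inner_cell by simp
      also have "\<dots> \<le> (\<Sum>T\<in>cut \<Omega> Th. f T x * indicator (frontier \<Omega> \<inter> T) x)"
        using inner_cell(2)[OF True] finite_cut
        by (intro member_le_sum[where f = "\<lambda>T. f T x * indicator (frontier \<Omega> \<inter> T) x"]) auto
      finally show ?thesis .
    qed simp
  qed
  also have "\<dots> = (\<Sum>T\<in>cut \<Omega> Th. \<integral>\<^sup>+x. f T x * indicator (frontier \<Omega> \<inter> T) x \<partial>H)"
  proof (rule nn_integral_sum)
    fix T assume T: "T \<in> cut \<Omega> Th"
    then have TT: "T \<in> Th" "T \<in> active \<Omega> Th" by (auto simp: cut_def active_def)
    have S: "frontier \<Omega> \<inter> T \<in> sets borel"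
      using closed_cell[OF TT(1)] by (intro borel_closed closed_Int) auto
    have "continuous_on (frontier \<Omega> \<inter> T) (\<lambda>x. (norm (cell_grad T v x))\<^sup>2)"
      by (intro continuous_intros continuous_on_subset[OF Vh_continuous_cell_grad[OF v TT(2)]]) auto
    then have "(\<lambda>x. (norm (cell_grad T v x))\<^sup>2) \<in> borel_measurable (restrict_space borel (frontier \<Omega> \<inter> T))"
      by (rule borel_measurable_continuous_on_restrict)
    then have "f T \<in> borel_measurable (restrict_space borel (frontier \<Omega> \<inter> T))"
      unfolding f_def by measurable
    then show "(\<lambda>x. f T x * indicator (frontier \<Omega> \<inter> T) x) \<in> borel_measurable H"
      using S unfolding H_def
      by (simp add: borel_measurable_restrict_space_iff_ennreal cong: measurable_cong_sets)
  qed
  finally have "ennreal (mesh_size Th) * L2sq (surface_on (frontier \<Omega>)) (boundary_grad \<Omega> Th v)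
      \<le> (\<Sum>T\<in>cut \<Omega> Th. ennreal (mesh_size Th) * (\<integral>\<^sup>+x. f T x * indicator (frontier \<Omega> \<inter> T) x \<partial>H))"
    unfolding sum_distrib_left[symmetric] by (rule mult_left_mono) simp
  also have "\<dots> \<le> (\<Sum>T\<in>cut \<Omega> Th. ennreal C_T * L2sq (lebesgue_on T) (cell_grad T v))"
    by (intro sum_mono cell)
  also have "\<dots> \<le> (\<Sum>T\<in>active \<Omega> Th. ennreal C_T * L2sq (lebesgue_on T) (cell_grad T v))"
    by (intro sum_mono2 finite_active) (auto simp: cut_def)
  also have "\<dots> \<le> ennreal C_T * L2sq (lebesgue_on (active_domain \<Omega> Th)) (grad v)"
    unfolding sum_distrib_left[symmetric] by (intro mult_left_mono sum_L2sq_cell_grad_le[OF v]) simp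
  finally show ?thesis .
qed

end

section \<open>Finite element functions in the Sobolev space\<close>

text \<open>Along the segment from x to y the sets of C pull back to closed sets of parameters on
  which f is Lipschitz with constant M |y - x|, and gluing on the unit interval applies. The
  constant does not grow with the number of sets crossed.\<close>

lemma lipschitz_on_UNIV_closed_Union:
  fixes f :: "'a::real_normed_vector \<Rightarrow> 'b::metric_space"
  assumes fin: "finite C" and cl: "\<And>T. T \<in> C \<Longrightarrow> closed T"
    and lip: "\<And>T. T \<in> C \<Longrightarrow> M-lipschitz_on T f" and cover: "\<Union>C = UNIV"
  shows "M-lipschitz_on UNIV f"
proof (rule lipschitz_onI)
  obtain T where "T \<in> C" using cover by blast
  then show M: "0 \<le> M" using lip lipschitz_on_nonneg by blast
  fix x y :: 'a
  define \<gamma> where "\<gamma> t = x + t *\<^sub>R (y - x)" for t :: real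
  have cont: "continuous_on UNIV \<gamma>" unfolding \<gamma>_def by (intro continuous_intros)
  have "(M * norm (y - x))-lipschitz_on {0..1} (f \<circ> \<gamma>)"
  proof (rule lipschitz_on_closed_Union)
    show "closed (\<gamma> -` T)" if "T \<in> C" for T
      using cont cl[OF that] by (simp add: continuous_on_closed_vimage)
    show "(M * norm (y - x))-lipschitz_on (\<gamma> -` T) (f \<circ> \<gamma>)" if "T \<in> C" for T
    proof (rule lipschitz_onI)
      fix s t assume st: "s \<in> \<gamma> -` T" "t \<in> \<gamma> -` T"
      have "dist (\<gamma> s) (\<gamma> t) = norm ((s - t) *\<^sub>R (y - x))"
        by (simp add: \<gamma>_def dist_norm scaleR_diff_left)
      then have "dist (\<gamma> s) (\<gamma> t) = norm (y - x) * dist s t"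
        by (simp add: dist_real_def)
      moreover have "dist (f (\<gamma> s)) (f (\<gamma> t)) \<le> M * dist (\<gamma> s) (\<gamma> t)"
        using lipschitz_onD[OF lip[OF that]] st by simp
      ultimately show "dist ((f \<circ> \<gamma>) s) ((f \<circ> \<gamma>) t) \<le> M * norm (y - x) * dist s t"
        by (simp add: mult.assoc)
    qed (use M in simp)
    show "{0..1} \<subseteq> (\<Union>T\<in>C. \<gamma> -` T)" using cover by blast
  qed (use fin M in auto)
  from lipschitz_onD[OF this, of 0 1] show "dist (f x) (f y) \<le> M * dist x y"
    by (simp add: \<gamma>_def dist_norm norm_minus_commute)
qed

lemma lipschitz_on_compact_convex:
  fixes f :: "real^'n \<Rightarrow> real"
  assumes "compact T" "convex T"
    and f: "\<And>x. x \<in> T \<Longrightarrow> (f has_derivative (\<lambda>h. \<Sum>j\<in>UNIV. h $ j * D j x)) (at x)"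
    and D: "\<And>j. continuous_on T (D j)"
  obtains C where "C-lipschitz_on T f"
proof -
  have "compact ((\<lambda>x. \<Sum>j\<in>UNIV. \<bar>D j x\<bar>) ` T)"
    by (intro compact_continuous_image continuous_intros D assms)
  then have "bounded ((\<lambda>x. \<Sum>j\<in>UNIV. \<bar>D j x\<bar>) ` T)" by (rule compact_imp_bounded)
  then obtain B where "0 < B" "\<forall>y \<in> (\<lambda>x. \<Sum>j\<in>UNIV. \<bar>D j x\<bar>) ` T. norm y \<le> B"
    unfolding bounded_pos by blast
  then have B: "0 < B" "\<And>x. x \<in> T \<Longrightarrow> (\<Sum>j\<in>UNIV. \<bar>D j x\<bar>) \<le> B"
    by (auto simp: abs_le_iff)
  have "B-lipschitz_on T f"
  proof (rule bounded_derivative_imp_lipschitz)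
    fix x assume x: "x \<in> T"
    show "(f has_derivative (\<lambda>h. \<Sum>j\<in>UNIV. h $ j * D j x)) (at x within T)"
      using f[OF x] by (rule has_derivative_at_withinI)
    show "onorm (\<lambda>h. \<Sum>j\<in>UNIV. h $ j * D j x) \<le> B"
    proof (rule onorm_le)
      fix h :: "real^'n"
      have "norm (\<Sum>j\<in>UNIV. h $ j * D j x) \<le> (\<Sum>j\<in>UNIV. norm h * \<bar>D j x\<bar>)"
        by (intro order.trans[OF norm_sum] sum_mono) (simp add: abs_mult mult_right_mono component_le_norm_cart)
      also have "\<dots> = (\<Sum>j\<in>UNIV. \<bar>D j x\<bar>) * norm h" by (simp add: sum_distrib_left mult.commute)
      also have "\<dots> \<le> B * norm h" using B(2)[OF x] by (intro mult_right_mono) auto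
      finally show "norm (\<Sum>j\<in>UNIV. h $ j * D j x) \<le> B * norm h" .
    qed
  qed (use assms B in auto)
  then show ?thesis using that by blast
qed

text \<open>Integration by parts without boundary terms: the difference quotients have vanishing integral
  by translation invariance, and they are dominated by the Lipschitz constant.\<close>

lemma integral_directional_derivative_eq_0:
  fixes f :: "'a::euclidean_space \<Rightarrow> real"
  assumes lip: "L-lipschitz_on UNIV f" and supp: "\<And>x. R < norm x \<Longrightarrow> f x = 0"
    and g: "AE x in lebesgue. \<exists>F. (f has_derivative F) (at x) \<and> F e = g x"
    and meas: "g \<in> borel_measurable lebesgue"
  shows "(\<integral>x. g x \<partial>lebesgue) = 0"
proof -
  define q where "q n x = real (Suc n) * (f (x + inverse (real (Suc n)) *\<^sub>R e) - f x)" for n x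
  have cont: "continuous_on UNIV f" using lip by (rule lipschitz_on_continuous_on)
  then have fb: "f \<in> borel_measurable borel" by (rule borel_measurable_continuous_onI)
  have shift: "f \<in> borel_measurable lborel" "(\<lambda>x. f (x + c)) \<in> borel_measurable lborel" for c
  proof -
    have "continuous_on UNIV (\<lambda>x. f (x + c))"
      by (rule continuous_on_compose2[OF cont]) (auto intro!: continuous_intros)
    then show "(\<lambda>x. f (x + c)) \<in> borel_measurable lborel"
      using borel_measurable_continuous_onI by simp
  qed (use fb in simp)
  have L: "0 \<le> L" using lip by (rule lipschitz_on_nonneg)
  obtain B where B: "\<And>x. \<bar>f x\<bar> \<le> B"
  proof -
    have "bounded (f ` cball 0 R)"
      by (intro compact_imp_bounded compact_continuous_image continuous_on_subset[OF cont]) auto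
    then obtain B where "0 < B" "\<forall>y\<in>f ` cball 0 R. norm y \<le> B"
      unfolding bounded_pos by blast
    then have "\<bar>f x\<bar> \<le> B" for x
      using supp[of x] by (cases "norm x \<le> R") auto
    then show ?thesis using that by blast
  qed
  have cball: "integrable lborel (indicator (cball 0 r) :: 'a \<Rightarrow> real)" for r
    using emeasure_bounded_finite[of "cball (0::'a) r"] by (simp add: integrable_indicator_iff)
  have int: "integrable lborel f"
  proof (rule Bochner_Integration.integrable_bound)
    show "integrable lborel (\<lambda>x. B * indicator (cball (0::'a) R) x)"
      by (intro integrable_mult_right cball)
    show "AE x in lborel. norm (f x) \<le> norm (B * indicator (cball 0 R) x)"
    proof (rule AE_I2)
      fix x show "norm (f x) \<le> norm (B * indicator (cball 0 R) x)"
        using B[of x] supp[of x] by (cases "norm x \<le> R") (auto simp: indicator_def)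
    qed
  qed (use fb in simp)
  have trans: "integrable lborel (\<lambda>x. f (x + c))" "(\<integral>x. f (x + c) \<partial>lborel) = (\<integral>x. f x \<partial>lborel)" for c
  proof -
    have d: "distr lborel borel ((+) c) = lborel" by (rule lborel_distr_plus)
    have "integrable (distr lborel borel ((+) c)) f" unfolding d by (rule int)
    then show "integrable lborel (\<lambda>x. f (x + c))"
      by (subst (asm) integrable_distr_eq) (auto simp: fb add.commute)
    have "(\<integral>x. f x \<partial>lborel) = (\<integral>x. f x \<partial>distr lborel borel ((+) c))" unfolding d ..
    also have "\<dots> = (\<integral>x. f (c + x) \<partial>lborel)" by (rule integral_distr) (auto simp: fb)
    finally show "(\<integral>x. f (x + c) \<partial>lborel) = (\<integral>x. f x \<partial>lborel)" by (simp add: add.commute)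
  qed
  have qm: "q n \<in> borel_measurable lborel" for n
    unfolding q_def using shift by (intro borel_measurable_times borel_measurable_diff) auto
  have q0: "(\<integral>x. q n x \<partial>lebesgue) = 0" for n
  proof -
    have "(\<integral>x. q n x \<partial>lebesgue) = (\<integral>x. q n x \<partial>lborel)"
      using qm by (intro integral_completion)
    also have "\<dots> = 0" unfolding q_def using trans int by simp
    finally show ?thesis .
  qed
  have "(\<lambda>n. \<integral>x. q n x \<partial>lebesgue) \<longlonglongrightarrow> (\<integral>x. g x \<partial>lebesgue)"
  proof (rule integral_dominated_convergence)
    show "q n \<in> borel_measurable lebesgue" for n
      using qm by (rule measurable_completion)
    \<comment> \<open>The steps 1 / (n + 1) are at most 1, so every quotient vanishes outside the
      ball of radius R + |e|; inside, the Lipschitz constant bounds it.\<close>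
    show "integrable lebesgue (\<lambda>x. (L * norm e) * indicator (cball (0::'a) (R + norm e)) x)"
      using cball by (intro integrable_mult_right) (simp add: integrable_completion)
    show "AE x in lebesgue. (\<lambda>n. q n x) \<longlonglongrightarrow> g x"
      using g
    proof eventually_elim
      case (elim x)
      then obtain F where F: "(f has_derivative F) (at x)" "F e = g x" by blast
      have lin: "linear F" using F(1) by (rule has_derivative_linear)
      have "((\<lambda>t. x + t *\<^sub>R e) has_derivative (\<lambda>t. t *\<^sub>R e)) (at 0)"
        by (auto intro!: derivative_eq_intros)
      from has_derivative_compose[OF this, of f F] F(1)
      have "((\<lambda>t. f (x + t *\<^sub>R e)) has_derivative (\<lambda>t. F (t *\<^sub>R e))) (at 0)" by simp
      then have "((\<lambda>t. f (x + t *\<^sub>R e)) has_field_derivative g x) (at 0)"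
        unfolding has_field_derivative_def
        by (rule has_derivative_eq_rhs) (simp add: linear_cmul[OF lin] F(2) fun_eq_iff mult.commute)
      then have "((\<lambda>t. (f (x + t *\<^sub>R e) - f x) / t) \<longlongrightarrow> g x) (at 0)"
        by (simp add: DERIV_def)
      moreover have "filterlim (\<lambda>n. inverse (real (Suc n))) (at 0) sequentially"
        using LIMSEQ_inverse_real_of_nat by (simp add: filterlim_at)
      ultimately have "(\<lambda>n. (f (x + inverse (real (Suc n)) *\<^sub>R e) - f x) / inverse (real (Suc n))) \<longlonglongrightarrow> g x"
        by (rule filterlim_compose)
      then show ?case by (simp add: q_def field_simps)
    qed
    show "AE x in lebesgue. norm (q n x) \<le> (L * norm e) * indicator (cball (0::'a) (R + norm e)) x" for n
    proof (rule AE_I2)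
      fix x :: 'a
      let ?t = "inverse (real (Suc n))"
      have t: "0 < ?t" "?t \<le> 1" by (simp_all add: divide_simps flip: One_nat_def)
      show "norm (q n x) \<le> (L * norm e) * indicator (cball (0::'a) (R + norm e)) x"
      proof (cases "x \<in> cball 0 (R + norm e)")
        case True
        have "dist (f (x + ?t *\<^sub>R e)) (f x) \<le> L * dist (x + ?t *\<^sub>R e) x"
          using lip by (rule lipschitz_onD) auto
        then have "\<bar>f (x + ?t *\<^sub>R e) - f x\<bar> \<le> ?t * (L * norm e)"
          by (simp add: dist_norm mult_ac)
        then have "real (Suc n) * \<bar>f (x + ?t *\<^sub>R e) - f x\<bar> \<le> real (Suc n) * (?t * (L * norm e))"
          by (rule mult_left_mono) simp
        also have "\<dots> = L * norm e" by (simp add: field_simps)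
        finally show ?thesis using True by (simp add: q_def abs_mult)
      next
        case False
        then have "R + norm e < norm x" by simp
        moreover have "norm x \<le> norm (x + ?t *\<^sub>R e) + norm (?t *\<^sub>R e)"
          using norm_triangle_ineq4[of "x + ?t *\<^sub>R e" "?t *\<^sub>R e"] by simp
        moreover have "norm (?t *\<^sub>R e) \<le> norm e" using t by (simp add: mult_left_le_one_le)
        moreover have "0 \<le> norm e" by simp
        ultimately have "R < norm (x + ?t *\<^sub>R e)" "R < norm x" by linarith+
        then show ?thesis using supp False by (simp add: q_def)
      qed
    qed
  qed (rule meas)
  then show ?thesis unfolding q0 by (simp add: LIMSEQ_const_iff)
qed

context mesh_domain
begin

text \<open>The product of a component of v with \<phi>, extended by 0, is Lipschitz with compact
  support, so its partial derivative integrates to 0; off the null skeleton that derivative is given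
  by the product rule. Conformity of v enters because one function agrees with a polynomial times
  \<phi> on each closed cell, faces included. This replaces the cancellation of face terms.\<close>

lemma Vh_weak_gradient:
  assumes v: "v \<in> Vh p \<Omega> Th" and \<phi>: "test_function \<Omega> \<phi>"
  shows "(\<integral>x. v x $ i * frechet_derivative \<phi> (at x) (axis j 1) \<partial>lebesgue_on \<Omega>)
    = - (\<integral>x. grad v x $ i $ j * \<phi> x \<partial>lebesgue_on \<Omega>)"
proof -
  obtain K where K: "compact K" "K \<subseteq> \<Omega>" "\<And>x. x \<notin> K \<Longrightarrow> \<phi> x = 0"
    using \<phi> unfolding test_function_def by blast
  define \<phi>' where "\<phi>' k x = frechet_derivative \<phi> (at x) (axis k 1)" for k x
  have "Ck_on (Suc 0) UNIV \<phi>" using \<phi> unfolding test_function_def by blast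
  then have diff: "\<phi> differentiable (at x)" and cont': "continuous_on UNIV (\<phi>' k)" for x k
    by (auto simp: \<phi>'_def axis_in_Basis_iff)
  have \<phi>d: "(\<phi> has_derivative (\<lambda>h. \<Sum>k\<in>UNIV. h $ k * \<phi>' k x)) (at x)" for x
  proof -
    have lin: "linear (frechet_derivative \<phi> (at x))" using diff by (rule linear_frechet_derivative)
    have "frechet_derivative \<phi> (at x) h = (\<Sum>k\<in>UNIV. h $ k * \<phi>' k x)" for h
    proof -
      have "frechet_derivative \<phi> (at x) h = frechet_derivative \<phi> (at x) (\<Sum>k\<in>UNIV. h $ k *\<^sub>R axis k 1)"
        by (simp add: basis_expansion flip: scalar_mult_eq_scaleR)
      then show ?thesis by (simp add: linear_sum[OF lin] linear_cmul[OF lin] \<phi>'_def)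
    qed
    then have "frechet_derivative \<phi> (at x) = (\<lambda>h. \<Sum>k\<in>UNIV. h $ k * \<phi>' k x)" by blast
    then show ?thesis using diff frechet_derivative_works by metis
  qed
  have cont: "continuous_on S \<phi>" for S
    using diff by (intro continuous_at_imp_continuous_on) (auto intro: differentiable_imp_continuous_within)
  have \<phi>'0: "\<phi>' k x = 0" if "x \<notin> K" for k x
  proof -
    have "open (- K)" using K(1) by (simp add: compact_imp_closed open_Compl)
    then have "(\<phi> has_derivative (\<lambda>h. 0)) (at x)"
      by (rule has_derivative_transform_within_open[OF has_derivative_const]) (use that K in auto)
    then show ?thesis unfolding \<phi>'_def by (simp add: frechet_derivative_at[symmetric])
  qed
  define f where "f x = (if x \<in> \<Omega> then v x $ i * \<phi> x else 0)" for x
  have product: "\<exists>D q. (\<forall>k. continuous_on T (D k)) \<and>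
      (\<forall>x. (q has_derivative (\<lambda>h. \<Sum>k\<in>UNIV. h $ k * D k x)) (at x)) \<and>
      (\<forall>x\<in>T. f x = q x) \<and> (\<forall>x\<in>T. D j x = cell_grad T v x $ i $ j * \<phi> x + v x $ i * \<phi>' j x)"
    if T: "T \<in> active \<Omega> Th" for T
  proof -
    obtain q D where D: "\<And>i j. D i j \<in> Qpoly p" "\<And>x i j. x \<in> T \<Longrightarrow> cell_grad T v x $ i $ j = D i j x"
      and q: "\<And>i. q i \<in> Qpoly p" "\<And>i x. x \<in> T \<Longrightarrow> v x $ i = q i x"
      "\<And>i x. (q i has_derivative (\<lambda>h. \<Sum>j\<in>UNIV. h $ j * D i j x)) (at x)"
      by (rule Vh_cell_grad_Qpoly[OF v T]) (rule that)
    have "((\<lambda>x. q i x * \<phi> x) has_derivative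
        (\<lambda>h. \<Sum>k\<in>UNIV. h $ k * (D i k x * \<phi> x + q i x * \<phi>' k x))) (at x)" for x
      by (rule has_derivative_eq_rhs[OF has_derivative_mult[OF q(3) \<phi>d]])
        (simp add: fun_eq_iff sum_distrib_left sum_distrib_right sum.distrib[symmetric] algebra_simps)
    moreover have "continuous_on T (\<lambda>x. D i k x * \<phi> x + q i x * \<phi>' k x)" for k
      by (intro continuous_intros cont continuous_on_Qpoly[OF D(1)] continuous_on_Qpoly[OF q(1)]
          continuous_on_subset[OF cont']) auto
    moreover have "f x = q i x * \<phi> x" if "x \<in> T" for x
      using q(2)[OF that] K by (auto simp: f_def)
    ultimately show ?thesis
      using q(2) D(2) by (intro exI[of _ "\<lambda>k x. D i k x * \<phi> x + q i x * \<phi>' k x"] exI[of _ "\<lambda>x. q i x * \<phi> x"]) simp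
  qed
  have "\<exists>C. C-lipschitz_on T f" if T: "T \<in> active \<Omega> Th" for T
  proof -
    obtain D q where D: "\<And>k. continuous_on T (D k)"
      "\<And>x. (q has_derivative (\<lambda>h. \<Sum>k\<in>UNIV. h $ k * D k x)) (at x)" "\<And>x. x \<in> T \<Longrightarrow> f x = q x"
      using product[OF T] by blast
    obtain C where "C-lipschitz_on T q"
      using lipschitz_on_compact_convex[OF compact_cell[OF active_mesh[OF T]]
          convex_cell[OF active_mesh[OF T]] D(2,1)] by blast
    then have "C-lipschitz_on T f" by (rule lipschitz_on_transform) (rule D(3))
    then show ?thesis ..
  qed
  then obtain C where C: "\<And>T. T \<in> active \<Omega> Th \<Longrightarrow> (C T)-lipschitz_on T f" by metis
  define M where "M = (\<Sum>T\<in>active \<Omega> Th. \<bar>C T\<bar>)"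
  have M: "0 \<le> M" unfolding M_def by (intro sum_nonneg) simp
  have lip: "M-lipschitz_on UNIV f"
  proof (rule lipschitz_on_UNIV_closed_Union)
    \<comment> \<open>The zero set of \<phi> takes care of everything outside \<Omega>; together
      with the active cells it exhausts the space.\<close>
    show "finite (insert {x. \<phi> x = 0} (active \<Omega> Th))" using finite_active by simp
    show "closed T" if "T \<in> insert {x. \<phi> x = 0} (active \<Omega> Th)" for T
      using that closed_cell active_mesh continuous_closed_preimage_constant[OF cont closed_UNIV]
      by auto
    show "M-lipschitz_on T f" if "T \<in> insert {x. \<phi> x = 0} (active \<Omega> Th)" for T
      using that
    proof
      assume T: "T \<in> active \<Omega> Th"
      have "\<bar>C T\<bar> \<le> M"
        unfolding M_def using finite_active T by (intro member_le_sum[where f = "\<lambda>T. \<bar>C T\<bar>"]) auto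
      then show ?thesis by (intro lipschitz_on_le[OF C[OF T]]) simp
    next
      assume "T = {x. \<phi> x = 0}"
      then show ?thesis using M by (auto simp: f_def intro!: lipschitz_onI)
    qed
    show "\<Union> (insert {x. \<phi> x = 0} (active \<Omega> Th)) = UNIV"
      using K domain_subset_active by (auto simp: active_domain_def)
  qed
  obtain R where R: "\<And>x. x \<in> \<Omega> \<Longrightarrow> norm x \<le> R" using bounded_domain by (auto simp: bounded_iff)
  define g where "g x = (if x \<in> \<Omega> then grad v x $ i $ j * \<phi> x + v x $ i * \<phi>' j x else 0)" for x
  \<comment> \<open>Inside K a point off the skeleton is interior to one cell, where the product
    rule applies; outside K the product is 0 near x.\<close>
  have deriv: "\<exists>F. (f has_derivative F) (at x) \<and> F (axis j 1) = g x"
    if off: "x \<notin> active_domain \<Omega> Th - mesh_interior" for x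
  proof (cases "x \<in> K")
    case True
    then have x: "x \<in> \<Omega>" using K by blast
    then obtain T where T: "T \<in> active \<Omega> Th" "x \<in> interior T"
      using off domain_subset_active by (auto simp: mesh_interior_def)
    obtain D q where D: "\<And>x. (q has_derivative (\<lambda>h. \<Sum>k\<in>UNIV. h $ k * D k x)) (at x)"
      "\<And>x. x \<in> T \<Longrightarrow> f x = q x" "\<And>x. x \<in> T \<Longrightarrow> D j x = cell_grad T v x $ i $ j * \<phi> x + v x $ i * \<phi>' j x"
      using product[OF T(1)] by blast
    have xT: "x \<in> T" using T interior_subset by blast
    have fd: "(f has_derivative (\<lambda>h. \<Sum>k\<in>UNIV. h $ k * D k x)) (at x)"
      by (rule has_derivative_transform_within_open[OF D(1) open_interior T(2)])
        (use D(2) interior_subset in fastforce)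
    have "(\<Sum>k\<in>UNIV. axis j 1 $ k * D k x) = D j x"
      by (subst sum.remove[of _ j]) (auto simp: axis_def intro: sum.neutral)
    then show ?thesis
      using fd x grad_interior[OF T(2)] D(3)[OF xT]
      by (intro exI[of _ "\<lambda>h. \<Sum>k\<in>UNIV. h $ k * D k x"]) (simp add: g_def)
  next
    case False
    have "open (- K)" using K(1) by (simp add: compact_imp_closed open_Compl)
    then have fd: "(f has_derivative (\<lambda>h. 0)) (at x)"
      by (rule has_derivative_transform_within_open[OF has_derivative_const]) (use False K in \<open>auto simp: f_def\<close>)
    then show ?thesis
      using False K \<phi>'0 by (intro exI[of _ "\<lambda>h. 0"]) (simp add: g_def)
  qed
  have AE: "AE x in lebesgue. x \<notin> active_domain \<Omega> Th - mesh_interior"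
    using negligible_skeleton negligible_iff_null_sets by (intro AE_not_in) blast
  have int1: "integrable (lebesgue_on \<Omega>) (\<lambda>x. grad v x $ i $ j * \<phi> x)"
    by (rule integrable_cellwise[where f = "\<lambda>T x. cell_grad T v x $ i $ j * \<phi> x"])
      (auto simp: grad_interior intro!: continuous_intros cont Vh_continuous_cell_grad[OF v])
  have int2: "integrable (lebesgue_on \<Omega>) (\<lambda>x. v x $ i * \<phi>' j x)"
    by (rule integrable_cellwise[where f = "\<lambda>T x. v x $ i * \<phi>' j x"])
      (auto intro!: continuous_intros continuous_on_subset[OF cont'] Vh_continuous_cell[OF v])
  have gm: "g \<in> borel_measurable lebesgue"
    unfolding g_def borel_measurable_if[OF domain_sets_lebesgue]
    using int1 int2 by (intro borel_measurable_add) auto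
  have "(\<integral>x. g x \<partial>lebesgue) = 0"
  proof (rule integral_directional_derivative_eq_0[OF lip _ _ gm])
    show "f x = 0" if "R < norm x" for x using R that by (force simp: f_def)
    show "AE x in lebesgue. \<exists>F. (f has_derivative F) (at x) \<and> F (axis j 1) = g x"
      using AE by eventually_elim (rule deriv)
  qed
  moreover have "(\<integral>x. g x \<partial>lebesgue) = (\<integral>x. grad v x $ i $ j * \<phi> x + v x $ i * \<phi>' j x \<partial>lebesgue_on \<Omega>)"
    using domain_sets_lebesgue
    by (subst integral_restrict_space) (auto simp: g_def indicator_def intro!: Bochner_Integration.integral_cong)
  ultimately show ?thesis
    using int1 int2 by (simp add: \<phi>'_def)
qed

lemma Vh_square_integrable:
  assumes "v \<in> Vh p \<Omega> Th"
  shows "square_integrable (lebesgue_on \<Omega>) v" "square_integrable (lebesgue_on \<Omega>) (grad v)"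
proof -
  have "continuous_on mesh_interior v"
    using Vh_continuous[OF assms] mesh_interior_subset by (rule continuous_on_subset)
  then have 1: "v \<in> borel_measurable (lebesgue_on \<Omega>)" by (rule measurable_on_domain)
  have 2: "grad v \<in> borel_measurable (lebesgue_on \<Omega>)"
    using Vh_continuous_on_grad[OF assms] by (rule measurable_on_domain)
  have "integrable (lebesgue_on \<Omega>) (\<lambda>x. (norm (v x))\<^sup>2)"
    by (rule integrable_cellwise[where f = "\<lambda>T x. (norm (v x))\<^sup>2"])
      (auto intro!: continuous_intros Vh_continuous_cell[OF assms])
  moreover have "integrable (lebesgue_on \<Omega>) (\<lambda>x. (norm (grad v x))\<^sup>2)"
    by (rule integrable_cellwise[where f = "\<lambda>T x. (norm (cell_grad T v x))\<^sup>2"])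
      (auto simp: grad_interior intro!: continuous_intros Vh_continuous_cell_grad[OF assms])
  ultimately show "square_integrable (lebesgue_on \<Omega>) v" "square_integrable (lebesgue_on \<Omega>) (grad v)"
    using 1 2 by (auto simp: square_integrable_def ennreal_norm_sq_integral)
qed

lemma Vh_H1: "v \<in> Vh p \<Omega> Th \<Longrightarrow> H1_with_gradient \<Omega> v (grad v)"
  unfolding H1_with_gradient_def using Vh_square_integrable Vh_weak_gradient by blast

end

context traced_mesh_domain
begin

text \<open>Since v is continuous up to the boundary, the constant sequence approximates it, and its
  own restriction is the trace.\<close>

lemma Vh_H1_trace:
  assumes v: "v \<in> Vh p \<Omega> Th"
  shows "H1_trace \<Omega> v (grad v) v"
proof -
  have c: "continuous_on (frontier \<Omega>) v"
    using Vh_continuous[OF v] frontier_subset_active by (rule continuous_on_subset)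
  then have "v \<in> borel_measurable (surface_on (frontier \<Omega>))"
    unfolding borel_measurable_surface_on_cong by (rule borel_measurable_continuous_on_restrict)
  moreover have "integrable (surface_on (frontier \<Omega>)) (\<lambda>x. (norm (v x))\<^sup>2)"
    by (intro integrable_continuous_surface_on compact_frontier_domain frontier_finite continuous_intros c)
  ultimately have "square_integrable (surface_on (frontier \<Omega>)) v"
    by (simp add: square_integrable_def ennreal_norm_sq_integral)
  moreover have "continuous_on (closure \<Omega>) v"
    using Vh_continuous[OF v] closure_subset_active by (rule continuous_on_subset)
  moreover have "L2sq M (\<lambda>x. 0 :: 'z::real_normed_vector) = 0" for M :: "'y measure"
    by (simp add: L2sq_def)
  ultimately show ?thesis
    unfolding H1_trace_def using Vh_H1[OF v]
    by (intro conjI exI[of _ "\<lambda>_. v"] exI[of _ "\<lambda>_. grad v"]) (simp_all add: L2sq_def)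
qed

end

section \<open>Young's inequality and the ghost penalty\<close>

text \<open>Pointwise Young inequality with weight t, integrated. If f is not integrable its
  integral is 0 by convention, so the bound survives; measurability of products with the normal
  therefore never has to be established.\<close>

lemma integral_young:
  fixes a :: "'a \<Rightarrow> 'b::real_normed_vector" and b :: "'a \<Rightarrow> 'c::real_normed_vector" and f :: "'a \<Rightarrow> real"
  assumes a: "integrable M (\<lambda>x. (norm (a x))\<^sup>2)" and b: "integrable M (\<lambda>x. (norm (b x))\<^sup>2)"
    and f: "AE x in M. \<bar>f x\<bar> \<le> C * norm (a x) * norm (b x)" and C: "0 \<le> C" and t: "0 < t"
  shows "\<bar>\<integral>x. f x \<partial>M\<bar> \<le> C / 2 * (t * (\<integral>x. (norm (a x))\<^sup>2 \<partial>M) + (\<integral>x. (norm (b x))\<^sup>2 \<partial>M) / t)"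
proof (cases "integrable M f")
  case True
  have young: "C * y * z \<le> C / 2 * (t * y\<^sup>2 + z\<^sup>2 / t)" for y z :: real
  proof -
    have "0 \<le> (t * y - z)\<^sup>2 / t" using t by simp
    also have "\<dots> = t * y\<^sup>2 - 2 * y * z + z\<^sup>2 / t"
      using t by (simp add: power2_eq_square field_simps)
    finally have "2 * (y * z) \<le> t * y\<^sup>2 + z\<^sup>2 / t" by simp
    from mult_left_mono[OF this, of "C / 2"] show ?thesis using C by (simp add: mult_ac)
  qed
  have "\<bar>\<integral>x. f x \<partial>M\<bar> \<le> (\<integral>x. \<bar>f x\<bar> \<partial>M)" by (rule integral_abs_bound)
  also have "\<dots> \<le> (\<integral>x. C / 2 * (t * (norm (a x))\<^sup>2 + (norm (b x))\<^sup>2 / t) \<partial>M)"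
  proof (rule integral_mono_AE)
    show "AE x in M. \<bar>f x\<bar> \<le> C / 2 * (t * (norm (a x))\<^sup>2 + (norm (b x))\<^sup>2 / t)"
      using f by eventually_elim (rule order.trans[OF _ young])
  qed (use True a b in auto)
  also have "\<dots> = C / 2 * (t * (\<integral>x. (norm (a x))\<^sup>2 \<partial>M) + (\<integral>x. (norm (b x))\<^sup>2 \<partial>M) / t)"
    using a b by simp
  finally show ?thesis .
next
  case False
  then have "(\<integral>x. f x \<partial>M) = 0" by (rule not_integrable_integral_eq)
  moreover have "0 \<le> C / 2 * (t * (\<integral>x. (norm (a x))\<^sup>2 \<partial>M) + (\<integral>x. (norm (b x))\<^sup>2 \<partial>M) / t)"
    using C t by (intro mult_nonneg_nonneg add_nonneg_nonneg divide_nonneg_pos integral_nonneg) auto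
  ultimately show ?thesis by simp
qed

text \<open>The best weight is t = sqrt (b / a), where the bound becomes the product of the square
  roots. When a or b vanishes, a sufficiently large or small t shows that X is not positive.\<close>

lemma le_sqrt_of_young:
  assumes X: "\<And>t. 0 < t \<Longrightarrow> X \<le> K / 2 * (t * a + b / t)" and "0 \<le> K" "0 \<le> a" "0 \<le> b"
  shows "X \<le> K * sqrt a * sqrt b"
proof (cases "K = 0 \<or> a = 0 \<or> b = 0")
  case False
  then have pos: "0 < K" "0 < a" "0 < b" using assms(2-4) by auto
  define x y where "x = sqrt a" and "y = sqrt b"
  have xy: "0 < x" "0 < y" "a = x * x" "b = y * y" using pos by (simp_all add: x_def y_def)
  have "X \<le> K / 2 * (y / x * a + b / (y / x))" using X[of "y / x"] xy by simp
  also have "\<dots> = K * x * y" unfolding xy(3,4) using xy(1,2) by (simp add: field_simps)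
  finally show ?thesis by (simp add: x_def y_def)
next
  case True
  have "X \<le> 0"
  proof (rule ccontr)
    assume "\<not> X \<le> 0"
    then have X0: "0 < X" by simp
    consider "K = 0" | "0 < K" "a = 0" | "0 < K" "b = 0" using True assms(2) by linarith
    then show False
    proof cases
      case 1
      then show False using X[of 1] X0 by simp
    next
      case 2
      define t where "t = (K * b + 1) / X"
      have Kb: "0 \<le> K * b" using 2 assms by simp
      then have t: "0 < t" "t * X = K * b + 1" using X0 by (simp_all add: t_def)
      have "X \<le> K * b / 2 / t" using X[OF t(1)] 2 by simp
      then have "t * X \<le> K * b / 2" using t(1) by (simp add: pos_le_divide_eq mult.commute)
      then show False using t(2) Kb by simp
    next
      case 3
      define t where "t = X / (K * a + 1)"
      have Ka: "0 \<le> K * a" using 3 assms by simp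
      then have t: "0 < t" "t * (K * a + 1) = X" using X0 by (simp_all add: t_def)
      have "X \<le> t * (K * a) / 2" using X[OF t(1)] 3 by (simp add: mult_ac)
      also have "\<dots> \<le> t * (K * a)" using t(1) Ka by simp
      also have "\<dots> < X" using t by (simp add: distrib_left)
      finally show False by simp
    qed
  qed
  then show ?thesis using assms by (auto intro: order.trans)
qed

lemma norm_matrix_vector_mult_le:
  fixes A :: "real^'n^'m"
  shows "norm (A *v x) \<le> norm A * norm x"
proof -
  have "norm (A *v x) = L2_set (\<lambda>i. norm (inner (A $ i) x)) UNIV"
    by (simp add: norm_vec_def matrix_vector_mul_component)
  also have "\<dots> \<le> L2_set (\<lambda>i. norm (A $ i) * norm x) UNIV"
    by (intro L2_set_mono) (auto intro: Cauchy_Schwarz_ineq2)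
  also have "\<dots> = norm A * norm x"
    by (simp add: norm_vec_def[of A] L2_set_left_distrib)
  finally show ?thesis .
qed

lemma continuous_on_inner_tensor_apply:
  assumes "\<And>i j k l. continuous_on S (\<lambda>x. L x i j k l)" "continuous_on S M" "continuous_on S N"
  shows "continuous_on S (\<lambda>x. inner (M x) (tensor_apply (L x) (N x)))"
  unfolding inner_tensor_apply by (intro continuous_intros assms)

lemma continuous_on_tensor_l1:
  assumes "\<And>i j k l. continuous_on S (\<lambda>x. L x i j k l)"
  shows "continuous_on S (\<lambda>x. tensor_l1 (L x))"
  unfolding tensor_l1_def by (intro continuous_intros assms)

context mesh_domain
begin

text \<open>The jump is a difference of two functions that are polynomial on a compact face of
  finite measure. Any pair of sides that \<open>SOME\<close> may pick has this property.\<close>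

lemma ghost_face_jump:
  assumes "F \<in> ghost_faces \<Omega> Th" "v \<in> Vh p \<Omega> Th"
  shows "integrable (surface_on F) (\<lambda>x. (norm (normal_jump \<Omega> Th F k v x))\<^sup>2)"
proof -
  define S where "S = (SOME S. face_sides \<Omega> Th F S)"
  have "\<exists>S. face_sides \<Omega> Th F S" using assms(1) by (simp add: ghost_faces_def)
  then have "face_sides \<Omega> Th F S" unfolding S_def by (rule someI_ex)
  then obtain Tp Tm where S: "S = (Tp, Tm)" and T: "Tp \<in> active \<Omega> Th" "Tm \<in> active \<Omega> Th"
    "Tp \<noteq> Tm" and F: "F = Tp \<inter> Tm"
    by (cases S) (auto simp: face_sides_def cut_def)
  have cont: "continuous_on T (cell_dir_deriv T \<nu> k v)" if T: "T \<in> active \<Omega> Th" for T \<nu>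
  proof -
    obtain a b where "T = cbox a b" "\<And>i. a $ i < b $ i"
      using active_mesh[OF T] by (rule cellE) (rule that)
    from Qpoly_on_cell_dir_deriv[OF this Vh_Qpoly_on[OF assms(2) T]] show ?thesis
      by (rule continuous_on_Qpoly_on)
  qed
  have "normal_jump \<Omega> Th F k v = (\<lambda>x. cell_dir_deriv Tp (face_normal F) k v x - cell_dir_deriv Tm (face_normal F) k v x)"
    using S by (simp add: normal_jump_def S_def fun_eq_iff)
  then have "continuous_on F (\<lambda>x. (norm (normal_jump \<Omega> Th F k v x))\<^sup>2)"
    using T F by (auto intro!: continuous_intros intro: continuous_on_subset[OF cont])
  then show ?thesis
    using emeasure_face_finite[OF T(1,2)[THEN active_mesh] T(3)] compact_cell[OF active_mesh[OF T(1)]]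
      closed_cell[OF active_mesh[OF T(2)]] unfolding F
    by (intro integrable_continuous_surface_on compact_Int_closed) auto
qed

lemma ghost_face_bounded: "F \<in> ghost_faces \<Omega> Th \<Longrightarrow> bounded F"
  using compact_imp_bounded[OF compact_cell] active_mesh
  by (auto simp: ghost_faces_def face_sides_def cut_def intro: bounded_Int)

lemma ghost_form_nonneg:
  assumes "F \<in> ghost_faces \<Omega> Th"
  shows "0 \<le> ghost_form p \<Omega> Th F v v"
  unfolding ghost_form_def using diameter_ge_0[OF ghost_face_bounded[OF assms]]
  by (intro sum_nonneg mult_nonneg_nonneg divide_nonneg_pos integral_nonneg) auto

text \<open>Each order k is treated separately with the same t; boundedness of the face makes its
  diameter, and hence the weights, nonnegative.\<close>

lemma ghost_form_young:
  assumes F: "F \<in> ghost_faces \<Omega> Th" and uv: "u \<in> Vh p \<Omega> Th" "v \<in> Vh p \<Omega> Th" and t: "0 < t"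
  shows "ghost_form p \<Omega> Th F u v \<le> 1 / 2 * (t * ghost_form p \<Omega> Th F u u + ghost_form p \<Omega> Th F v v / t)"
proof -
  define c where "c k = diameter F ^ (2 * k - 1) / (fact k)\<^sup>2" for k
  have c: "0 \<le> c k" for k
    using diameter_ge_0[OF ghost_face_bounded[OF F]] by (simp add: c_def)
  define I where "I w z k = (\<integral>x. inner (normal_jump \<Omega> Th F k w x) (normal_jump \<Omega> Th F k z x) \<partial>surface_on F)"
    for w z :: "real^'d \<Rightarrow> real^'d" and k
  have I: "I u v k \<le> 1 / 2 * (t * I u u k + I v v k / t)" for k
    using integral_young[OF ghost_face_jump[OF F uv(1)] ghost_face_jump[OF F uv(2)] _ zero_le_one t,
        of "\<lambda>x. inner (normal_jump \<Omega> Th F k u x) (normal_jump \<Omega> Th F k v x)" k k]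
    by (simp add: I_def Cauchy_Schwarz_ineq2 dot_square_norm)
  have "(\<Sum>k=1..p. c k * I u v k) \<le> (\<Sum>k=1..p. c k * (1 / 2 * (t * I u u k + I v v k / t)))"
    by (intro sum_mono mult_left_mono I c)
  also have "\<dots> = 1 / 2 * (t * (\<Sum>k=1..p. c k * I u u k) + (\<Sum>k=1..p. c k * I v v k) / t)"
    by (simp add: sum_distrib_left sum_divide_distrib sum.distrib algebra_simps)
  finally show ?thesis by (simp add: ghost_form_def c_def I_def)
qed

lemma ghost_penalty_nonneg: "0 \<le> \<gamma>A \<Longrightarrow> 0 \<le> ghost_penalty p \<gamma>A \<Omega> Th v v"
  unfolding ghost_penalty_def by (intro mult_nonneg_nonneg sum_nonneg ghost_form_nonneg)

lemma ghost_penalty_young: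
  assumes uv: "u \<in> Vh p \<Omega> Th" "v \<in> Vh p \<Omega> Th" and t: "0 < t" and \<gamma>A: "0 \<le> \<gamma>A"
  shows "ghost_penalty p \<gamma>A \<Omega> Th u v
    \<le> 1 / 2 * (t * ghost_penalty p \<gamma>A \<Omega> Th u u + ghost_penalty p \<gamma>A \<Omega> Th v v / t)"
proof -
  have "ghost_penalty p \<gamma>A \<Omega> Th u v
    \<le> \<gamma>A * (\<Sum>F\<in>ghost_faces \<Omega> Th. 1 / 2 * (t * ghost_form p \<Omega> Th F u u + ghost_form p \<Omega> Th F v v / t))"
    unfolding ghost_penalty_def by (intro mult_left_mono sum_mono ghost_form_young uv t \<gamma>A)
  also have "\<dots> = 1 / 2 * (t * ghost_penalty p \<gamma>A \<Omega> Th u u + ghost_penalty p \<gamma>A \<Omega> Th v v / t)"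
    by (simp add: ghost_penalty_def sum_distrib_left sum_divide_distrib sum.distrib algebra_simps)
  finally show ?thesis .
qed

end

section \<open>The linearised Nitsche form\<close>

text \<open>Here G is the gradient energy, S the strain energy, B the boundary mass, b its quotient
  by h, s the ghost energy, V the volume form, c1 and c2 the consistency terms, P the penalty. With
  \<open>K = C_L\<^sup>2 / m\<close>, Korn extracts m G / C_K from V at the price
  \<open>K * (h\<^sub>0 * b)\<close>; the consistency terms consume half of that gradient part, half
  of s, and K b / \<epsilon>. The penalty supplies
  \<open>K * (1 / \<epsilon> + h\<^sub>0 + 1) * b\<close>, so one K b is left over.\<close>

lemma coercivity_arithmetic:
  fixes G S B b s V c1 c2 P h h\<^sub>0 c_L C_L C_K C_T C_G \<gamma>A \<gamma>_D \<eta> \<epsilon> m :: real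
  assumes pos: "0 < C_T" "0 < C_G" "0 < C_K" "0 < \<gamma>A" "0 < c_L" "c_L \<le> C_L" "0 < \<eta>" "0 < \<epsilon>"
    and nonneg: "0 \<le> G" "0 \<le> S" "0 \<le> b" "0 \<le> s" and B: "B \<le> h\<^sub>0 * b" and h\<^sub>0: "0 < h\<^sub>0"
    and m: "m = min c_L 1"
    and \<epsilon>: "\<epsilon> * (C_T * C_G) \<le> 1 / (2 * C_K)" "\<epsilon> * (C_T * C_G) \<le> \<gamma>A / 2"
    and V: "c_L * S \<le> V" and korn: "G \<le> C_K * (S + B)"
    and c: "c1 \<le> 1 / 2 * (m * \<epsilon> * (C_T * C_G * (G + s / \<gamma>A)) + C_L\<^sup>2 / (m * \<epsilon>) * b)"
      "c2 \<le> 1 / 2 * (m * \<epsilon> * (C_T * C_G * (G + s / \<gamma>A)) + C_L\<^sup>2 / (m * \<epsilon>) * b)"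
    and P: "\<gamma>_D * \<eta> * b \<le> P"
    and \<gamma>_D: "C_L\<^sup>2 / (m * \<eta>) * (1 / \<epsilon> + h\<^sub>0 + 1) \<le> \<gamma>_D"
  shows "min (m / (2 * C_K)) (min (1 / 2) (C_L\<^sup>2 / m)) * (G + b + s) \<le> V - c1 - c2 + P + s"
proof -
  define K where "K = C_L\<^sup>2 / m"
  have m0: "0 < m" "m \<le> 1" "m \<le> c_L" using m pos by auto
  \<comment> \<open>Charging Korn's boundary term at rate K instead of m lets the threshold depend
    on the single combination \<open>C_L\<^sup>2 / (m * \<eta>)\<close>.\<close>
  have "m * m \<le> C_L * C_L" using m0 pos by (intro mult_mono) auto
  then have mK: "m \<le> K" using m0 by (simp add: K_def pos_le_divide_eq power2_eq_square)
  have "G / C_K \<le> S + B" using korn pos by (simp add: pos_divide_le_eq mult.commute)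
  then have "m * (G / C_K) \<le> m * S + m * B"
    using mult_left_mono[of "G / C_K" "S + B" m] m0 by (simp only: distrib_left)
  moreover have "m * S \<le> c_L * S" using m0 nonneg by (intro mult_right_mono) auto
  moreover have "m * B \<le> m * (h\<^sub>0 * b)" using B m0 by (intro mult_left_mono) auto
  moreover have "m * (h\<^sub>0 * b) \<le> K * (h\<^sub>0 * b)" using mK h\<^sub>0 nonneg by (intro mult_right_mono) auto
  ultimately have 1: "m * (G / C_K) \<le> V + K * (h\<^sub>0 * b)" using V by linarith
  have "\<epsilon> * (C_T * C_G) * G \<le> 1 / (2 * C_K) * G" using \<epsilon>(1) nonneg by (intro mult_right_mono) auto
  moreover have "\<epsilon> * (C_T * C_G) * (s / \<gamma>A) \<le> \<gamma>A / 2 * (s / \<gamma>A)"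
    using \<epsilon>(2) nonneg pos by (intro mult_right_mono) auto
  moreover have "\<gamma>A / 2 * (s / \<gamma>A) = s / 2" "1 / (2 * C_K) * G = G / (2 * C_K)"
    using pos by simp_all
  moreover have "\<epsilon> * (C_T * C_G * (G + s / \<gamma>A)) = \<epsilon> * (C_T * C_G) * G + \<epsilon> * (C_T * C_G) * (s / \<gamma>A)"
    by (simp only: distrib_left mult.assoc)
  ultimately have "\<epsilon> * (C_T * C_G * (G + s / \<gamma>A)) \<le> G / (2 * C_K) + s / 2"
    by linarith
  then have "m * (\<epsilon> * (C_T * C_G * (G + s / \<gamma>A))) \<le> m * (G / (2 * C_K) + s / 2)"
    using m0 by (intro mult_left_mono) auto
  moreover have "m * (s / 2) \<le> s / 2" using m0 nonneg mult_right_mono[of m 1 "s / 2"] by simp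
  ultimately have 2: "m * \<epsilon> * (C_T * C_G * (G + s / \<gamma>A)) \<le> m * (G / (2 * C_K)) + s / 2"
    by (simp add: distrib_left mult.assoc)
  have 3: "C_L\<^sup>2 / (m * \<epsilon>) * b = K * (b / \<epsilon>)" by (simp add: K_def)
  have "C_L\<^sup>2 / (m * \<eta>) * (1 / \<epsilon> + h\<^sub>0 + 1) * (\<eta> * b) \<le> \<gamma>_D * (\<eta> * b)"
    using \<gamma>_D pos nonneg by (intro mult_right_mono) auto
  also have "C_L\<^sup>2 / (m * \<eta>) * (1 / \<epsilon> + h\<^sub>0 + 1) * (\<eta> * b) = K * ((1 / \<epsilon> + h\<^sub>0 + 1) * b)"
    using pos m0 by (simp add: K_def)
  also have "\<dots> = K * (b / \<epsilon>) + K * (h\<^sub>0 * b) + K * b" by (simp add: distrib_left distrib_right)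
  finally have 4: "K * (b / \<epsilon>) + K * (h\<^sub>0 * b) + K * b \<le> P" using P by (simp add: mult.assoc)
  have 5: "m * (G / C_K) = 2 * (m * (G / (2 * C_K)))" by simp
  have "min (m / (2 * C_K)) (min (1 / 2) K) * (G + b + s)
      = min (m / (2 * C_K)) (min (1 / 2) K) * G + min (m / (2 * C_K)) (min (1 / 2) K) * b
        + min (m / (2 * C_K)) (min (1 / 2) K) * s"
    by (simp add: distrib_left)
  also have "\<dots> \<le> m / (2 * C_K) * G + K * b + 1 / 2 * s"
    using nonneg by (intro add_mono mult_right_mono) auto
  also have "\<dots> = m * (G / (2 * C_K)) + K * b + s / 2" by simp
  finally have 6: "min (m / (2 * C_K)) (min (1 / 2) K) * (G + b + s) \<le> m * (G / (2 * C_K)) + K * b + s / 2" .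
  \<comment> \<open>Generalising the nonlinear products to variables leaves a purely linear
    balance.\<close>
  have "l \<le> V - c1 - c2 + P + s"
    if "l \<le> g + k + s / 2" "g' \<le> V + q" "x \<le> g + s / 2" "e + q + k \<le> P" "g' = 2 * g"
      "c1 \<le> 1 / 2 * (x + e)" "c2 \<le> 1 / 2 * (x + e)" for l g k g' q x e
  proof -
    have "c1 + c2 \<le> x + e" using that(6,7) by simp
    then show ?thesis using that(1-5) by simp
  qed
  from this[OF 6 1 2 4 5 c[unfolded 3]] show ?thesis unfolding K_def .
qed

locale nitsche_domain = traced_mesh_domain \<Omega> Th p C_T
  for \<Omega> :: "(real^'d) set" and Th p C_T +
  fixes C_G C_K \<gamma>A c_L C_L \<mu>\<^sub>e :: real and \<Psi> :: "real^'d^'d \<Rightarrow> real" and ubar :: "real^'d \<Rightarrow> real^'d"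
  assumes extension: "extension_inequality p \<gamma>A C_G \<Omega> Th" and korn: "korn_inequality C_K \<Omega>"
    and C_G: "0 < C_G" and C_K: "0 < C_K" and \<gamma>A: "0 < \<gamma>A" and c_L: "0 < c_L" "c_L \<le> C_L"
    and \<mu>\<^sub>e: "0 < \<mu>\<^sub>e" and ubar: "ubar \<in> Vh p \<Omega> Th"
    and elliptic: "uniformly_elliptic c_L C_L \<Omega> Th \<Psi> ubar"
begin

text \<open>The lower bound sees only the symmetric part of M. That still makes the form
  nonnegative, as Cauchy--Schwarz requires; control of the full gradient has to wait for
  Korn.\<close>

lemma elasticity_attained:
  assumes "F \<in> attained_gradients \<Omega> Th ubar"
  shows "c_L * (norm (sym_part M))\<^sup>2 \<le> inner M (tensor_apply (elasticity \<Psi> F) M)"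
    and "\<bar>inner M (tensor_apply (elasticity \<Psi> F) N)\<bar> \<le> C_L * norm M * norm N"
    and "norm (tensor_apply (elasticity \<Psi> F) N) \<le> C_L * norm N"
    and "tensor_l1 (elasticity \<Psi> F) \<le> real CARD('d) ^ 4 * C_L"
proof -
  obtain U where U: "open U" "attained_gradients \<Omega> Th ubar \<subseteq> U" "Ck_on 3 U \<Psi>"
    using elliptic unfolding uniformly_elliptic_def by blast
  have sym: "elasticity \<Psi> F i j k l = elasticity \<Psi> F k l i j" for i j k l
    using U assms by (intro elasticity_symmetric) auto
  have low: "c_L * (norm (sym_part M))\<^sup>2 \<le> inner M (tensor_apply (elasticity \<Psi> F) M)"
    and up: "inner M (tensor_apply (elasticity \<Psi> F) M) \<le> C_L * (norm M)\<^sup>2" for M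
    using elliptic assms unfolding uniformly_elliptic_def by blast+
  have nonneg: "0 \<le> inner M (tensor_apply (elasticity \<Psi> F) M)" for M
    using c_L by (intro order.trans[OF _ low]) simp
  have bound: "\<bar>inner M (tensor_apply (elasticity \<Psi> F) N)\<bar> \<le> C_L * norm M * norm N" for M N
    using sym nonneg up by (rule inner_tensor_apply_bound)
  show "c_L * (norm (sym_part M))\<^sup>2 \<le> inner M (tensor_apply (elasticity \<Psi> F) M)"
    "\<bar>inner M (tensor_apply (elasticity \<Psi> F) N)\<bar> \<le> C_L * norm M * norm N"
    "norm (tensor_apply (elasticity \<Psi> F) N) \<le> C_L * norm N"
    "tensor_l1 (elasticity \<Psi> F) \<le> real CARD('d) ^ 4 * C_L"
    using low bound norm_tensor_apply_le[OF bound] tensor_l1_le[OF bound] by blast+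
qed

lemma cell_attained:
  "T \<in> active \<Omega> Th \<Longrightarrow> x \<in> T \<Longrightarrow> mat 1 + cell_grad T ubar x \<in> attained_gradients \<Omega> Th ubar"
  unfolding attained_gradients_def by blast

lemma domain_attained:
  assumes "x \<in> mesh_interior"
  shows "mat 1 + grad ubar x \<in> attained_gradients \<Omega> Th ubar"
  using assms grad_interior cell_attained interior_subset
  by (fastforce simp: mesh_interior_def)

lemma boundary_attained:
  assumes "x \<in> frontier \<Omega>"
  shows "mat 1 + boundary_grad \<Omega> Th ubar x \<in> attained_gradients \<Omega> Th ubar"
  unfolding boundary_grad_def using inner_cell[OF assms] by (intro cell_attained)

lemma continuous_on_cell_elasticity:
  assumes T: "T \<in> active \<Omega> Th"
  shows "continuous_on T (\<lambda>x. elasticity \<Psi> (mat 1 + cell_grad T ubar x) i j k l)"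
proof -
  obtain U where U: "open U" "attained_gradients \<Omega> Th ubar \<subseteq> U" "Ck_on 3 U \<Psi>"
    using elliptic unfolding uniformly_elliptic_def by blast
  have "continuous_on T (\<lambda>x. mat 1 + cell_grad T ubar x)"
    by (intro continuous_intros Vh_continuous_cell_grad[OF ubar T])
  then show ?thesis
    by (rule continuous_on_compose2[OF continuous_on_elasticity[OF U(1,3)]])
      (use U(2) cell_attained[OF T] in blast)
qed

section \<open>The parts of the form: integrability and basic estimates\<close>

definition grad_energy :: "(real^'d \<Rightarrow> real^'d) \<Rightarrow> real" where
  "grad_energy v = (\<integral>x. (norm (grad v x))\<^sup>2 \<partial>lebesgue_on \<Omega>)"
definition strain_energy :: "(real^'d \<Rightarrow> real^'d) \<Rightarrow> real" where
  "strain_energy v = (\<integral>x. (norm (sym_part (grad v x)))\<^sup>2 \<partial>lebesgue_on \<Omega>)"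
text \<open>Unscaled, as in Korn's inequality; the energy norm contains it divided by h.\<close>

definition boundary_mass :: "(real^'d \<Rightarrow> real^'d) \<Rightarrow> real" where
  "boundary_mass v = (\<integral>x. (norm (v x))\<^sup>2 \<partial>surface_on (frontier \<Omega>))"
definition boundary_grad_energy :: "(real^'d \<Rightarrow> real^'d) \<Rightarrow> real" where
  "boundary_grad_energy v = (\<integral>x. (norm (boundary_grad \<Omega> Th v x))\<^sup>2 \<partial>surface_on (frontier \<Omega>))"
abbreviation h :: real where "h \<equiv> mesh_size Th"
abbreviation ghost :: "(real^'d \<Rightarrow> real^'d) \<Rightarrow> (real^'d \<Rightarrow> real^'d) \<Rightarrow> real" where
  "ghost u v \<equiv> ghost_penalty p \<gamma>A \<Omega> Th u v"
definition volume_form :: "(real^'d \<Rightarrow> real^'d) \<Rightarrow> (real^'d \<Rightarrow> real^'d) \<Rightarrow> real" where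
  "volume_form u v = (\<integral>x. inner (grad u x) (tensor_apply (volume_elasticity \<Psi> ubar x) (grad v x)) \<partial>lebesgue_on \<Omega>)"
definition consistency_form :: "(real^'d \<Rightarrow> real^'d) \<Rightarrow> (real^'d \<Rightarrow> real^'d) \<Rightarrow> real" where
  "consistency_form u v = (\<integral>x. inner (v x)
     (tensor_apply (boundary_elasticity \<Omega> Th \<Psi> ubar x) (boundary_grad \<Omega> Th u x)
        *v outward_normal \<Omega> x) \<partial>surface_on (frontier \<Omega>))"
definition penalty_form :: "real \<Rightarrow> (real^'d \<Rightarrow> real^'d) \<Rightarrow> (real^'d \<Rightarrow> real^'d) \<Rightarrow> real" where
  "penalty_form \<gamma>_D u v = (\<integral>x. \<gamma>_D * penalty_weight \<Omega> Th \<Psi> \<mu>\<^sub>e ubar x / h * inner (u x) (v x)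
     \<partial>surface_on (frontier \<Omega>))"

lemma A_form_eq: "A_form p \<Omega> Th \<Psi> \<mu>\<^sub>e \<gamma>A \<gamma>_D ubar u v = volume_form u v - consistency_form u v - consistency_form v u + penalty_form \<gamma>_D u v + ghost u v"
  unfolding A_form_def volume_form_def consistency_form_def penalty_form_def ..

lemma nonneg [simp]: "0 \<le> grad_energy v" "0 \<le> strain_energy v" "0 \<le> boundary_mass v" "0 \<le> ghost v v" "0 \<le> boundary_grad_energy v"
  using \<gamma>A by (simp_all add: grad_energy_def strain_energy_def boundary_mass_def boundary_grad_energy_def ghost_penalty_nonneg)

lemma energy_norm_eq: "energy_norm p \<gamma>A \<Omega> Th v = sqrt (grad_energy v + boundary_mass v / h + ghost v v)"
proof -
  have "(h powr (- 1 / 2))\<^sup>2 = 1 / h"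
    using mesh_size_pos by (simp add: power2_eq_square powr_add[symmetric] powr_minus_divide)
  then have "(norm (h powr (- 1 / 2) *\<^sub>R w))\<^sup>2 = (norm w)\<^sup>2 / h" for w :: "real^'d"
    by (simp add: power_mult_distrib)
  then show ?thesis by (simp add: energy_norm_def grad_energy_def boundary_mass_def)
qed

context
  fixes v assumes v: "v \<in> Vh p \<Omega> Th"
begin

lemma integrable_grad: "integrable (lebesgue_on \<Omega>) (\<lambda>x. (norm (grad v x))\<^sup>2)"
  by (rule integrable_cellwise[where f = "\<lambda>T x. (norm (cell_grad T v x))\<^sup>2"])
    (auto simp: grad_interior intro!: continuous_intros Vh_continuous_cell_grad[OF v])

lemma integrable_sym_grad: "integrable (lebesgue_on \<Omega>) (\<lambda>x. (norm (sym_part (grad v x)))\<^sup>2)"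
proof (rule integrable_cellwise[where f = "\<lambda>T x. (norm (sym_part (cell_grad T v x)))\<^sup>2"])
  fix T assume T: "T \<in> active \<Omega> Th"
  have "continuous_on T (\<lambda>x. transpose (cell_grad T v x))"
    unfolding transpose_def by (intro continuous_intros Vh_continuous_cell_grad[OF v T])
  then show "continuous_on T (\<lambda>x. (norm (sym_part (cell_grad T v x)))\<^sup>2)"
    unfolding sym_part_def by (intro continuous_intros Vh_continuous_cell_grad[OF v T])
qed (simp add: grad_interior)

lemma integrable_boundary_value: "integrable (surface_on (frontier \<Omega>)) (\<lambda>x. (norm (v x))\<^sup>2)"
  by (intro integrable_continuous_surface_on compact_frontier_domain frontier_finite continuous_intros
      continuous_on_subset[OF Vh_continuous[OF v] frontier_subset_active])

lemma integrable_boundary_grad: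
  "integrable (surface_on (frontier \<Omega>)) (\<lambda>x. (norm (boundary_grad \<Omega> Th v x))\<^sup>2)"
  unfolding boundary_grad_def
  by (rule integrable_boundary[where f = "\<lambda>T x. (norm (cell_grad T v x))\<^sup>2"])
    (intro continuous_intros Vh_continuous_cell_grad[OF v])

lemma korn_Vh: "grad_energy v \<le> C_K * (strain_energy v + boundary_mass v)"
proof -
  have "L2sq (lebesgue_on \<Omega>) (grad v) \<le> ennreal C_K *
      (L2sq (lebesgue_on \<Omega>) (\<lambda>x. sym_part (grad v x)) + L2sq (surface_on (frontier \<Omega>)) v)"
    using korn Vh_H1[OF v] Vh_H1_trace[OF v] unfolding korn_inequality_def by blast
  then have "ennreal (grad_energy v) \<le> ennreal C_K * (ennreal (strain_energy v) + ennreal (boundary_mass v))"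
    unfolding ennreal_norm_sq_integral[OF integrable_grad] ennreal_norm_sq_integral[OF integrable_sym_grad]
      ennreal_norm_sq_integral[OF integrable_boundary_value] grad_energy_def strain_energy_def boundary_mass_def .
  also have "\<dots> = ennreal (C_K * (strain_energy v + boundary_mass v))"
    using C_K by (simp add: ennreal_mult)
  finally show ?thesis using C_K by (simp add: ennreal_le_iff)
qed

lemma boundary_grad_Vh: "boundary_grad_energy v \<le> C_T * C_G * (grad_energy v + ghost v v / \<gamma>A) / h"
proof -
  have "ennreal h * ennreal (boundary_grad_energy v) = ennreal h * L2sq (surface_on (frontier \<Omega>)) (boundary_grad \<Omega> Th v)"
    unfolding boundary_grad_energy_def ennreal_norm_sq_integral[OF integrable_boundary_grad] ..
  also have "\<dots> \<le> ennreal C_T * L2sq (lebesgue_on (active_domain \<Omega> Th)) (grad v)"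
    by (rule boundary_grad_trace[OF v])
  also have "\<dots> \<le> ennreal C_T * (ennreal C_G * (L2sq (lebesgue_on \<Omega>) (grad v) + ennreal (ghost v v / \<gamma>A)))"
    using extension v unfolding extension_inequality_def by (intro mult_left_mono) auto
  also have "\<dots> = ennreal (C_T * C_G * (grad_energy v + ghost v v / \<gamma>A))"
    unfolding ennreal_norm_sq_integral[OF integrable_grad] grad_energy_def[symmetric]
    using C_T C_G \<gamma>A by (simp add: ennreal_mult mult.assoc)
  finally have "ennreal (h * boundary_grad_energy v) \<le> ennreal (C_T * C_G * (grad_energy v + ghost v v / \<gamma>A))"
    using mesh_size_pos by (simp add: ennreal_mult)
  then have "h * boundary_grad_energy v \<le> C_T * C_G * (grad_energy v + ghost v v / \<gamma>A)"
    using C_T C_G \<gamma>A by (simp add: ennreal_le_iff)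
  then show ?thesis using mesh_size_pos by (simp add: pos_le_divide_eq mult.commute)
qed

lemma volume_coercive: "c_L * strain_energy v \<le> volume_form v v"
proof -
  have "c_L * strain_energy v = (\<integral>x. c_L * (norm (sym_part (grad v x)))\<^sup>2 \<partial>lebesgue_on \<Omega>)"
    by (simp add: strain_energy_def)
  also have "\<dots> \<le> volume_form v v"
    unfolding volume_form_def
  proof (rule integral_mono_AE)
    show "integrable (lebesgue_on \<Omega>) (\<lambda>x. c_L * (norm (sym_part (grad v x)))\<^sup>2)"
      using integrable_sym_grad by simp
    show "integrable (lebesgue_on \<Omega>) (\<lambda>x. inner (grad v x) (tensor_apply (volume_elasticity \<Psi> ubar x) (grad v x)))"
      by (rule integrable_cellwise[where f = "\<lambda>T x. inner (cell_grad T v x)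
            (tensor_apply (elasticity \<Psi> (mat 1 + cell_grad T ubar x)) (cell_grad T v x))"])
        (auto simp: grad_interior volume_elasticity_def
          intro!: continuous_on_inner_tensor_apply continuous_on_cell_elasticity Vh_continuous_cell_grad[OF v])
    show "AE x in lebesgue_on \<Omega>. c_L * (norm (sym_part (grad v x)))\<^sup>2
        \<le> inner (grad v x) (tensor_apply (volume_elasticity \<Psi> ubar x) (grad v x))"
      using AE_mesh_interior
      by eventually_elim (simp add: volume_elasticity_def elasticity_attained(1) domain_attained)
  qed
  finally show ?thesis .
qed

lemma penalty_coercive:
  assumes w: "\<And>x. x \<in> frontier \<Omega> \<Longrightarrow> \<eta> \<le> penalty_weight \<Omega> Th \<Psi> \<mu>\<^sub>e ubar x" and "0 \<le> \<gamma>_D"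
  shows "\<gamma>_D * \<eta> * (boundary_mass v / h) \<le> penalty_form \<gamma>_D v v"
proof -
  have "\<gamma>_D * \<eta> * (boundary_mass v / h) = (\<integral>x. \<gamma>_D * \<eta> / h * (norm (v x))\<^sup>2 \<partial>surface_on (frontier \<Omega>))"
    by (simp add: boundary_mass_def)
  also have "\<dots> \<le> penalty_form \<gamma>_D v v"
    unfolding penalty_form_def
  proof (rule integral_mono_AE)
    show "integrable (surface_on (frontier \<Omega>)) (\<lambda>x. \<gamma>_D * \<eta> / h * (norm (v x))\<^sup>2)"
      using integrable_boundary_value by simp
    show "integrable (surface_on (frontier \<Omega>))
        (\<lambda>x. \<gamma>_D * penalty_weight \<Omega> Th \<Psi> \<mu>\<^sub>e ubar x / h * inner (v x) (v x))"
      unfolding penalty_weight_def boundary_elasticity_def boundary_grad_def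
      by (rule integrable_boundary[where f = "\<lambda>T x. \<gamma>_D *
            max (2 * \<mu>\<^sub>e) (tensor_l1 (elasticity \<Psi> (mat 1 + cell_grad T ubar x)) / 2) / h * inner (v x) (v x)"])
        (use mesh_size_pos in \<open>auto intro!: continuous_intros continuous_on_tensor_l1
          continuous_on_cell_elasticity Vh_continuous_cell[OF v]\<close>)
    show "AE x in surface_on (frontier \<Omega>). \<gamma>_D * \<eta> / h * (norm (v x))\<^sup>2
        \<le> \<gamma>_D * penalty_weight \<Omega> Th \<Psi> \<mu>\<^sub>e ubar x / h * inner (v x) (v x)"
      using w assms(2) mesh_size_pos unfolding dot_square_norm
      by (intro AE_I2 mult_right_mono divide_right_mono mult_left_mono) auto
  qed
  finally show ?thesis .
qed

end

section \<open>Upper bounds with a free Young weight\<close>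

lemma volume_young:
  assumes "u \<in> Vh p \<Omega> Th" "v \<in> Vh p \<Omega> Th" "0 < t"
  shows "\<bar>volume_form u v\<bar> \<le> C_L / 2 * (t * grad_energy u + grad_energy v / t)"
  unfolding volume_form_def grad_energy_def
proof (rule integral_young)
  show "AE x in lebesgue_on \<Omega>. \<bar>inner (grad u x) (tensor_apply (volume_elasticity \<Psi> ubar x) (grad v x))\<bar>
      \<le> C_L * norm (grad u x) * norm (grad v x)"
    using AE_mesh_interior
    by eventually_elim (simp add: volume_elasticity_def elasticity_attained(2) domain_attained)
qed (use assms c_L integrable_grad in auto)

lemma consistency_young:
  assumes uv: "u \<in> Vh p \<Omega> Th" "v \<in> Vh p \<Omega> Th" and t: "0 < t"
  shows "\<bar>consistency_form u v\<bar> \<le> C_L / 2 * (t * (C_T * C_G * (grad_energy u + ghost u u / \<gamma>A)) + boundary_mass v / h / t)"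
proof -
  \<comment> \<open>The Young weight is t h rather than t: it cancels the 1 / h in the bound for the
    boundary gradient and leaves the boundary mass divided by h, as in the energy norm.\<close>
  have "\<bar>consistency_form u v\<bar> \<le> C_L / 2 * (t * h * boundary_grad_energy u + boundary_mass v / (t * h))"
    unfolding consistency_form_def boundary_grad_energy_def boundary_mass_def
  proof (rule integral_young)
    show "AE x in surface_on (frontier \<Omega>).
        \<bar>inner (v x) (tensor_apply (boundary_elasticity \<Omega> Th \<Psi> ubar x) (boundary_grad \<Omega> Th u x)
          *v outward_normal \<Omega> x)\<bar> \<le> C_L * norm (boundary_grad \<Omega> Th u x) * norm (v x)"
    proof (rule AE_I2)
      fix x assume "x \<in> space (surface_on (frontier \<Omega>))"
      then have x: "x \<in> frontier \<Omega>" by simp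
      let ?\<sigma> = "tensor_apply (boundary_elasticity \<Omega> Th \<Psi> ubar x) (boundary_grad \<Omega> Th u x)"
      have "\<bar>inner (v x) (?\<sigma> *v outward_normal \<Omega> x)\<bar> \<le> norm (v x) * norm (?\<sigma> *v outward_normal \<Omega> x)"
        by (rule Cauchy_Schwarz_ineq2)
      also have "\<dots> \<le> norm (v x) * (norm ?\<sigma> * norm (outward_normal \<Omega> x))"
        by (intro mult_left_mono norm_matrix_vector_mult_le) simp
      also have "\<dots> \<le> norm (v x) * (norm ?\<sigma> * 1)"
        by (intro mult_left_mono norm_outward_normal_le) auto
      also have "\<dots> \<le> norm (v x) * (C_L * norm (boundary_grad \<Omega> Th u x))"
        using elasticity_attained(3)[OF boundary_attained[OF x]]
        by (intro mult_left_mono) (simp_all add: boundary_elasticity_def)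
      finally show "\<bar>inner (v x) (?\<sigma> *v outward_normal \<Omega> x)\<bar> \<le> C_L * norm (boundary_grad \<Omega> Th u x) * norm (v x)"
        by (simp add: mult_ac)
    qed
  qed (use uv t c_L mesh_size_pos integrable_boundary_grad integrable_boundary_value in auto)
  also have "\<dots> \<le> C_L / 2 * (t * h * (C_T * C_G * (grad_energy u + ghost u u / \<gamma>A) / h) + boundary_mass v / (t * h))"
    using c_L t mesh_size_pos boundary_grad_Vh[OF uv(1)]
    by (intro mult_left_mono add_right_mono) auto
  also have "\<dots> = C_L / 2 * (t * (C_T * C_G * (grad_energy u + ghost u u / \<gamma>A)) + boundary_mass v / h / t)"
    using mesh_size_pos t by (simp add: mult.commute)
  finally show ?thesis .
qed

text \<open>The tensor enters the upper bound only through \<open>C_L\<close> and the dimension,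
  hence uniformly in mesh and iterate.\<close>

lemma penalty_weight_bounds:
  assumes "x \<in> frontier \<Omega>"
  shows "2 * \<mu>\<^sub>e \<le> penalty_weight \<Omega> Th \<Psi> \<mu>\<^sub>e ubar x"
    and "penalty_weight \<Omega> Th \<Psi> \<mu>\<^sub>e ubar x \<le> max (2 * \<mu>\<^sub>e) (real CARD('d) ^ 4 * C_L / 2)"
  using elasticity_attained(4)[OF boundary_attained[OF assms]]
  by (auto simp: penalty_weight_def boundary_elasticity_def)

lemma penalty_young:
  assumes uv: "u \<in> Vh p \<Omega> Th" "v \<in> Vh p \<Omega> Th" and t: "0 < t" and \<gamma>_D: "0 \<le> \<gamma>_D"
    and W: "max (2 * \<mu>\<^sub>e) (real CARD('d) ^ 4 * C_L / 2) \<le> W"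
  shows "\<bar>penalty_form \<gamma>_D u v\<bar> \<le> \<gamma>_D * W / 2 * (t * (boundary_mass u / h) + boundary_mass v / h / t)"
proof -
  have W0: "0 \<le> W" using W \<mu>\<^sub>e by simp
  have "\<bar>penalty_form \<gamma>_D u v\<bar> \<le> \<gamma>_D * W / h / 2 * (t * boundary_mass u + boundary_mass v / t)"
    unfolding penalty_form_def boundary_mass_def
  proof (rule integral_young)
    show "AE x in surface_on (frontier \<Omega>).
        \<bar>\<gamma>_D * penalty_weight \<Omega> Th \<Psi> \<mu>\<^sub>e ubar x / h * inner (u x) (v x)\<bar> \<le> \<gamma>_D * W / h * norm (u x) * norm (v x)"
    proof (rule AE_I2)
      fix x assume "x \<in> space (surface_on (frontier \<Omega>))"
      then have w: "0 \<le> penalty_weight \<Omega> Th \<Psi> \<mu>\<^sub>e ubar x" "penalty_weight \<Omega> Th \<Psi> \<mu>\<^sub>e ubar x \<le> W"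
        using penalty_weight_bounds[of x] W \<mu>\<^sub>e by auto
      have "\<bar>\<gamma>_D * penalty_weight \<Omega> Th \<Psi> \<mu>\<^sub>e ubar x / h * inner (u x) (v x)\<bar>
          = \<gamma>_D * penalty_weight \<Omega> Th \<Psi> \<mu>\<^sub>e ubar x / h * \<bar>inner (u x) (v x)\<bar>"
        using w \<gamma>_D mesh_size_pos by (simp add: abs_mult)
      also have "\<dots> \<le> \<gamma>_D * W / h * (norm (u x) * norm (v x))"
        using w \<gamma>_D W0 mesh_size_pos
        by (intro mult_mono divide_right_mono Cauchy_Schwarz_ineq2 mult_left_mono) auto
      finally show "\<bar>\<gamma>_D * penalty_weight \<Omega> Th \<Psi> \<mu>\<^sub>e ubar x / h * inner (u x) (v x)\<bar>
          \<le> \<gamma>_D * W / h * norm (u x) * norm (v x)"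
        by (simp add: mult.assoc)
    qed
  qed (use uv t \<gamma>_D W0 mesh_size_pos integrable_boundary_value in auto)
  then show ?thesis by (simp add: distrib_left mult_ac)
qed

lemma penalty_infimum:
  shows "2 * \<mu>\<^sub>e \<le> (INF x \<in> frontier \<Omega>. penalty_weight \<Omega> Th \<Psi> \<mu>\<^sub>e ubar x)"
    and "x \<in> frontier \<Omega> \<Longrightarrow>
      (INF x \<in> frontier \<Omega>. penalty_weight \<Omega> Th \<Psi> \<mu>\<^sub>e ubar x) \<le> penalty_weight \<Omega> Th \<Psi> \<mu>\<^sub>e ubar x"
  using penalty_weight_bounds(1) frontier_ne
  by (auto intro!: cINF_greatest cINF_lower bdd_belowI2[where m = "2 * \<mu>\<^sub>e"])

lemma A_form_coercive:
  assumes v: "v \<in> Vh p \<Omega> Th" and h\<^sub>0: "h \<le> h\<^sub>0"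
    and \<eta>: "0 < \<eta>" "\<And>x. x \<in> frontier \<Omega> \<Longrightarrow> \<eta> \<le> penalty_weight \<Omega> Th \<Psi> \<mu>\<^sub>e ubar x"
    and \<epsilon>: "0 < \<epsilon>" "\<epsilon> * (C_T * C_G) \<le> 1 / (2 * C_K)" "\<epsilon> * (C_T * C_G) \<le> \<gamma>A / 2"
    and \<gamma>_D: "C_L\<^sup>2 / (min c_L 1 * \<eta>) * (1 / \<epsilon> + h\<^sub>0 + 1) \<le> \<gamma>_D"
  shows "min (min c_L 1 / (2 * C_K)) (min (1 / 2) (C_L\<^sup>2 / min c_L 1)) * (energy_norm p \<gamma>A \<Omega> Th v)\<^sup>2
    \<le> A_form p \<Omega> Th \<Psi> \<mu>\<^sub>e \<gamma>A \<gamma>_D ubar v v"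
proof -
  define m where "m = min c_L 1"
  have m: "0 < m" using c_L by (simp add: m_def)
  have CL: "0 < C_L" using c_L by simp
  have "0 \<le> C_L\<^sup>2 / (min c_L 1 * \<eta>) * (1 / \<epsilon> + h\<^sub>0 + 1)"
    using m \<eta>(1) \<epsilon>(1) h\<^sub>0 mesh_size_pos by (intro mult_nonneg_nonneg) (auto simp: m_def[symmetric])
  then have \<gamma>_D0: "0 \<le> \<gamma>_D" using \<gamma>_D by linarith
  \<comment> \<open>The weight \<open>m * \<epsilon> / C_L\<close> moves \<open>C_L\<close> entirely
    to the boundary term and produces the factor \<open>C_L\<^sup>2 / (m * \<epsilon>)\<close>,
    which the penalty is calibrated to match.\<close>
  have "consistency_form v v \<le> C_L / 2 * (m * \<epsilon> / C_L * (C_T * C_G * (grad_energy v + ghost v v / \<gamma>A)) + boundary_mass v / h / (m * \<epsilon> / C_L))"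
    using consistency_young[OF v v, of "m * \<epsilon> / C_L"] m \<epsilon>(1) CL by simp
  also have "\<dots> = 1 / 2 * (m * \<epsilon> * (C_T * C_G * (grad_energy v + ghost v v / \<gamma>A)) + C_L\<^sup>2 / (m * \<epsilon>) * (boundary_mass v / h))"
    using CL m \<epsilon>(1) mesh_size_pos by (simp add: field_simps power2_eq_square)
  finally have cv: "consistency_form v v \<le> 1 / 2 * (m * \<epsilon> * (C_T * C_G * (grad_energy v + ghost v v / \<gamma>A)) + C_L\<^sup>2 / (m * \<epsilon>) * (boundary_mass v / h))" .
  \<comment> \<open>Korn contributes the unscaled boundary mass; the upper bound on the mesh size
    compares it with the scaled one.\<close>
  have Bh: "boundary_mass v \<le> h\<^sub>0 * (boundary_mass v / h)"
    using mult_right_mono[OF h\<^sub>0, of "boundary_mass v / h"] mesh_size_pos by simp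
  have h0: "0 < h\<^sub>0" using h\<^sub>0 mesh_size_pos by simp
  have "min (m / (2 * C_K)) (min (1 / 2) (C_L\<^sup>2 / m)) * (grad_energy v + boundary_mass v / h + ghost v v)
      \<le> volume_form v v - consistency_form v v - consistency_form v v + penalty_form \<gamma>_D v v + ghost v v"
    by (rule coercivity_arithmetic[OF C_T C_G C_K \<gamma>A c_L \<eta>(1) \<epsilon>(1) _ _ _ _ Bh h0 m_def \<epsilon>(2,3)
          volume_coercive[OF v] korn_Vh[OF v] cv cv penalty_coercive[OF v \<eta>(2) \<gamma>_D0]])
      (use \<gamma>_D mesh_size_pos in \<open>auto simp: m_def\<close>)
  moreover have "(energy_norm p \<gamma>A \<Omega> Th v)\<^sup>2 = grad_energy v + boundary_mass v / h + ghost v v"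
    unfolding energy_norm_eq using mesh_size_pos by (intro real_sqrt_pow2) auto
  ultimately show ?thesis unfolding A_form_eq m_def by simp
qed

text \<open>All five parts are bounded by multiples of one quantity Q = t E(u) + E(v) / t, and
  \<open>le_sqrt_of_young\<close> optimises t once for their sum. The summands of the constant stem,
  in order, from the volume term, the two consistency terms, the penalty and the ghost
  penalty.\<close>

lemma A_form_bounded:
  assumes uv: "u \<in> Vh p \<Omega> Th" "v \<in> Vh p \<Omega> Th" and \<gamma>_D: "0 \<le> \<gamma>_D"
    and W: "max (2 * \<mu>\<^sub>e) (real CARD('d) ^ 4 * C_L / 2) \<le> W"
  shows "A_form p \<Omega> Th \<Psi> \<mu>\<^sub>e \<gamma>A \<gamma>_D ubar u v
    \<le> (C_L + 2 * C_L * (1 + C_T * C_G * (1 + 1 / \<gamma>A)) + \<gamma>_D * W + 1)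
      * energy_norm p \<gamma>A \<Omega> Th u * energy_norm p \<gamma>A \<Omega> Th v"
  unfolding energy_norm_eq
proof (rule le_sqrt_of_young)
  \<comment> \<open>The second summand covers the boundary gradient, the 1 covers the boundary mass,
    so that one factor serves both halves of a consistency bound.\<close>
  define K where "K = 1 + C_T * C_G * (1 + 1 / \<gamma>A)"
  define E where "E v = grad_energy v + boundary_mass v / h + ghost v v" for v
  have CL: "0 < C_L" using c_L by simp
  have W0: "0 \<le> W" using W \<mu>\<^sub>e by simp
  have K: "0 \<le> K" "1 \<le> K" using C_T C_G \<gamma>A by (auto simp: K_def)
  have Bh: "0 \<le> boundary_mass v / h" for v using mesh_size_pos by simp
  have E: "grad_energy v \<le> E v" "boundary_mass v / h \<le> E v" "ghost v v \<le> E v" "0 \<le> E v" for v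
    using Bh[of v] by (simp_all add: E_def)
  have KE: "C_T * C_G * (grad_energy v + ghost v v / \<gamma>A) \<le> K * E v" "boundary_mass v / h \<le> K * E v" for v
  proof -
    have "grad_energy v + ghost v v / \<gamma>A \<le> E v + E v / \<gamma>A"
      using E \<gamma>A by (intro add_mono divide_right_mono) auto
    also have "\<dots> = (1 + 1 / \<gamma>A) * E v" by (simp add: distrib_right)
    finally have "C_T * C_G * (grad_energy v + ghost v v / \<gamma>A) \<le> C_T * C_G * ((1 + 1 / \<gamma>A) * E v)"
      using C_T C_G by (intro mult_left_mono) auto
    also have "\<dots> \<le> K * E v" using E(4)[of v] by (simp add: K_def distrib_right mult.assoc)
    finally show "C_T * C_G * (grad_energy v + ghost v v / \<gamma>A) \<le> K * E v" .
    show "boundary_mass v / h \<le> K * E v"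
      using E[of v] mult_right_mono[OF K(2) E(4)[of v]] by linarith
  qed
  show "0 \<le> C_L + 2 * C_L * (1 + C_T * C_G * (1 + 1 / \<gamma>A)) + \<gamma>_D * W + 1"
    using CL K W0 \<gamma>_D by (simp flip: K_def)
  show "0 \<le> grad_energy u + boundary_mass u / h + ghost u u" "0 \<le> grad_energy v + boundary_mass v / h + ghost v v"
    using E(4) by (simp_all add: E_def)
  fix t :: real assume t: "0 < t"
  define Q where "Q = t * E u + E v / t"
  have 1: "volume_form u v \<le> C_L / 2 * Q"
  proof -
    have "volume_form u v \<le> C_L / 2 * (t * grad_energy u + grad_energy v / t)" using volume_young[OF uv t] by simp
    also have "\<dots> \<le> C_L / 2 * Q"
      unfolding Q_def using CL t E by (intro mult_left_mono add_mono divide_right_mono) auto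
    finally show ?thesis .
  qed
  have 2: "- consistency_form u v \<le> C_L / 2 * (K * Q)"
  proof -
    have "- consistency_form u v \<le> C_L / 2 * (t * (C_T * C_G * (grad_energy u + ghost u u / \<gamma>A)) + boundary_mass v / h / t)"
      using consistency_young[OF uv t] by simp
    also have "\<dots> \<le> C_L / 2 * (t * (K * E u) + K * E v / t)"
      using CL t KE by (intro mult_left_mono add_mono divide_right_mono) auto
    finally show ?thesis by (simp add: Q_def distrib_left mult_ac)
  qed
  have 3: "- consistency_form v u \<le> C_L / 2 * (K * Q)"
  proof -
    \<comment> \<open>With u and v exchanged the weight is 1 / t, so that u still carries t and v
      still carries 1 / t.\<close>
    have "- consistency_form v u \<le> C_L / 2 * (1 / t * (C_T * C_G * (grad_energy v + ghost v v / \<gamma>A)) + boundary_mass u / h / (1 / t))"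
      using consistency_young[OF uv(2,1), of "1 / t"] t by simp
    also have "\<dots> \<le> C_L / 2 * (1 / t * (K * E v) + K * E u / (1 / t))"
      using CL t KE by (intro mult_left_mono add_mono divide_right_mono) auto
    finally show ?thesis by (simp add: Q_def distrib_left mult_ac add.commute)
  qed
  have 4: "penalty_form \<gamma>_D u v \<le> \<gamma>_D * W / 2 * Q"
  proof -
    have "penalty_form \<gamma>_D u v \<le> \<gamma>_D * W / 2 * (t * (boundary_mass u / h) + boundary_mass v / h / t)"
      using penalty_young[OF uv t \<gamma>_D W] by simp
    also have "\<dots> \<le> \<gamma>_D * W / 2 * Q"
      unfolding Q_def using \<gamma>_D W0 t E by (intro mult_left_mono add_mono divide_right_mono) auto
    finally show ?thesis .
  qed
  have 5: "ghost u v \<le> 1 / 2 * Q"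
  proof -
    have "ghost u v \<le> 1 / 2 * (t * ghost u u + ghost v v / t)"
      using \<gamma>A by (intro ghost_penalty_young uv t) simp
    also have "\<dots> \<le> 1 / 2 * Q"
      unfolding Q_def using t E by (intro mult_left_mono add_mono divide_right_mono) auto
    finally show ?thesis .
  qed
  have "A_form p \<Omega> Th \<Psi> \<mu>\<^sub>e \<gamma>A \<gamma>_D ubar u v
      \<le> C_L / 2 * Q + C_L / 2 * (K * Q) + C_L / 2 * (K * Q) + \<gamma>_D * W / 2 * Q + 1 / 2 * Q"
    unfolding A_form_eq using 1 2 3 4 5 by linarith
  also have "\<dots> = (C_L + 2 * C_L * K + \<gamma>_D * W + 1) / 2 * Q"
    by (simp add: field_simps)
  finally show "A_form p \<Omega> Th \<Psi> \<mu>\<^sub>e \<gamma>A \<gamma>_D ubar u v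
      \<le> (C_L + 2 * C_L * (1 + C_T * C_G * (1 + 1 / \<gamma>A)) + \<gamma>_D * W + 1) / 2 *
        (t * (grad_energy u + boundary_mass u / h + ghost u u) + (grad_energy v + boundary_mass v / h + ghost v v) / t)"
    by (simp only: Q_def E_def K_def)
qed

end

theorem proposition1:
  fixes p :: nat and C_T C_G C_K h\<^sub>0 E\<^sub>e \<alpha> :: real
  assumes "1 \<le> p" and "0 < C_T" and "0 < C_G" and "0 < C_K" and "0 < h\<^sub>0" and "0 < E\<^sub>e" and "0 < \<alpha>"
  shows
    "\<exists>\<Gamma> :: real \<Rightarrow> real. (\<forall>\<kappa>>0. 0 < \<Gamma> \<kappa>) \<and>
       (\<forall>\<sigma> c_L C_L \<eta>_min \<eta>_max \<gamma>\<^sub>0.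
          0 < \<sigma> \<and> 0 < c_L \<and> c_L \<le> C_L \<and> 0 < \<eta>_min \<and> \<gamma>\<^sub>0 = \<Gamma> (C_L\<^sup>2 / (min c_L 1 * \<eta>_min)) \<longrightarrow>
          (\<exists>c_s>0. \<forall>\<gamma>_D\<ge>\<gamma>\<^sub>0. \<exists>C_s>0.
             \<forall>(\<Omega> :: (real^'d) set) Th \<Psi> \<mu>\<^sub>e ubar.
               bounded \<Omega> \<and> lipschitz_domain \<Omega> \<and>
               cartesian_mesh Th \<and> quasi_uniform \<sigma> Th \<and> \<Omega> \<subseteq> \<Union> Th \<and> mesh_size Th \<le> h\<^sub>0 \<and>
               trace_inequality p C_T \<Omega> Th \<and>
               extension_inequality p (\<alpha> * E\<^sub>e) C_G \<Omega> Th \<and>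
               korn_inequality C_K \<Omega> \<and>
               0 < \<mu>\<^sub>e \<and> ubar \<in> Vh p \<Omega> Th \<and>
               uniformly_elliptic c_L C_L \<Omega> Th \<Psi> ubar \<and>
               \<eta>_min = (INF x \<in> frontier \<Omega>. penalty_weight \<Omega> Th \<Psi> \<mu>\<^sub>e ubar x) \<and>
               \<eta>_max = (SUP x \<in> frontier \<Omega>. penalty_weight \<Omega> Th \<Psi> \<mu>\<^sub>e ubar x) \<longrightarrow>
               2 * \<mu>\<^sub>e \<le> \<eta>_min \<and>
               (\<forall>v \<in> Vh p \<Omega> Th.
                  A_form p \<Omega> Th \<Psi> \<mu>\<^sub>e (\<alpha> * E\<^sub>e) \<gamma>_D ubar v v \<ge> c_s * (energy_norm p (\<alpha> * E\<^sub>e) \<Omega> Th v)\<^sup>2) \<and>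
               (\<forall>u \<in> Vh p \<Omega> Th. \<forall>v \<in> Vh p \<Omega> Th.
                  A_form p \<Omega> Th \<Psi> \<mu>\<^sub>e (\<alpha> * E\<^sub>e) \<gamma>_D ubar u v
                    \<le> C_s * energy_norm p (\<alpha> * E\<^sub>e) \<Omega> Th u * energy_norm p (\<alpha> * E\<^sub>e) \<Omega> Th v)))"
proof -
  let ?\<gamma>A = "\<alpha> * E\<^sub>e"
  \<comment> \<open>The boundary gradient is controlled by gradient and ghost energy: the first
    entry keeps its gradient part within half of what Korn supplies, the second its ghost part
    within half of the ghost energy.\<close>
  define \<epsilon> where "\<epsilon> = min (1 / (2 * C_K)) (?\<gamma>A / 2) / (C_T * C_G)"
  define \<Gamma> where "\<Gamma> \<kappa> = \<kappa> * (1 / \<epsilon> + h\<^sub>0 + 1)" for \<kappa> :: real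
  have \<gamma>A: "0 < ?\<gamma>A" using assms by simp
  have \<epsilon>: "0 < \<epsilon>" "\<epsilon> * (C_T * C_G) \<le> 1 / (2 * C_K)" "\<epsilon> * (C_T * C_G) \<le> ?\<gamma>A / 2"
    using assms \<gamma>A by (simp_all add: \<epsilon>_def)
  have \<Gamma>: "0 < \<Gamma> \<kappa>" if "0 < \<kappa>" for \<kappa>
    unfolding \<Gamma>_def using that \<epsilon>(1) assms by (intro mult_pos_pos add_pos_pos) auto
  show ?thesis (is "\<exists>\<Gamma>. _ \<and> (\<forall>\<sigma> c_L C_L \<eta>_min \<eta>_max \<gamma>\<^sub>0. _ \<longrightarrow>
    (\<exists>c_s>0. \<forall>\<gamma>_D\<ge>\<gamma>\<^sub>0. \<exists>C_s>0. ?claim \<sigma> c_L C_L \<eta>_min \<eta>_max \<gamma>_D c_s C_s))")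
  proof (intro exI[of _ \<Gamma>] conjI allI impI; (elim conjE)?)
    show "0 < \<Gamma> \<kappa>" if "0 < \<kappa>" for \<kappa> using that by (rule \<Gamma>)
  next
    fix \<sigma> c_L C_L \<eta>_min \<eta>_max \<gamma>\<^sub>0 :: real
    assume c: "0 < c_L" "c_L \<le> C_L" "0 < \<eta>_min" and \<gamma>\<^sub>0: "\<gamma>\<^sub>0 = \<Gamma> (C_L\<^sup>2 / (min c_L 1 * \<eta>_min))"
    \<comment> \<open>The entries are what absorption leaves for the gradient, the ghost and the
      boundary part, in that order. None of them involves \<open>\<gamma>_D\<close>, which is
      quantified later.\<close>
    define c_s where "c_s = min (min c_L 1 / (2 * C_K)) (min (1 / 2) (C_L\<^sup>2 / min c_L 1))"
    have C_L: "0 < C_L" using c by simp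
    then have c_s: "0 < c_s" using c assms by (auto simp: c_s_def)
    have "0 < C_L\<^sup>2 / (min c_L 1 * \<eta>_min)" using c C_L by (intro divide_pos_pos mult_pos_pos) auto
    then have \<gamma>\<^sub>0_pos: "0 < \<gamma>\<^sub>0" unfolding \<gamma>\<^sub>0 by (rule \<Gamma>)
    \<comment> \<open>The boundedness constant must be fixed before \<open>\<mu>\<^sub>e\<close> is
      introduced. Since \<open>2 * \<mu>\<^sub>e \<le> \<eta>_min\<close>, the number
      \<open>\<eta>_min\<close> stands in for it.\<close>
    define W where "W = max \<eta>_min (real CARD('d) ^ 4 * C_L / 2)"
    have W: "0 \<le> W" using c by (simp add: W_def)
    define C_s where "C_s \<gamma>_D = C_L + 2 * C_L * (1 + C_T * C_G * (1 + 1 / ?\<gamma>A)) + \<gamma>_D * W + 1"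
      for \<gamma>_D :: real
    have C_s: "0 < C_s \<gamma>_D" if "\<gamma>\<^sub>0 \<le> \<gamma>_D" for \<gamma>_D
      unfolding C_s_def using that \<gamma>\<^sub>0_pos C_L assms \<gamma>A W
      by (intro add_nonneg_pos add_nonneg_nonneg mult_nonneg_nonneg) auto
    have claim: "?claim \<sigma> c_L C_L \<eta>_min \<eta>_max \<gamma>_D c_s (C_s \<gamma>_D)" if \<gamma>_D: "\<gamma>\<^sub>0 \<le> \<gamma>_D" for \<gamma>_D
    proof (intro allI impI, elim conjE)
      fix \<Omega> :: "(real^'d) set" and Th \<Psi> \<mu>\<^sub>e ubar
      assume "bounded \<Omega>" "lipschitz_domain \<Omega>" "cartesian_mesh Th" "\<Omega> \<subseteq> \<Union> Th"
        and h: "mesh_size Th \<le> h\<^sub>0" and "trace_inequality p C_T \<Omega> Th"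
          "extension_inequality p ?\<gamma>A C_G \<Omega> Th" "korn_inequality C_K \<Omega>" "0 < \<mu>\<^sub>e"
          "ubar \<in> Vh p \<Omega> Th" "uniformly_elliptic c_L C_L \<Omega> Th \<Psi> ubar"
        and \<eta>_min: "\<eta>_min = (INF x \<in> frontier \<Omega>. penalty_weight \<Omega> Th \<Psi> \<mu>\<^sub>e ubar x)"
      then interpret nitsche_domain \<Omega> Th p C_T C_G C_K ?\<gamma>A c_L C_L \<mu>\<^sub>e \<Psi> ubar
        using assms \<gamma>A c by unfold_locales (auto simp: lipschitz_domain_def)
      have \<mu>: "2 * \<mu>\<^sub>e \<le> \<eta>_min" unfolding \<eta>_min by (rule penalty_infimum(1))
      then have "max (2 * \<mu>\<^sub>e) (real CARD('d) ^ 4 * C_L / 2) \<le> W" by (auto simp: W_def)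
      then show "2 * \<mu>\<^sub>e \<le> \<eta>_min \<and>
          (\<forall>v \<in> Vh p \<Omega> Th.
            A_form p \<Omega> Th \<Psi> \<mu>\<^sub>e ?\<gamma>A \<gamma>_D ubar v v \<ge> c_s * (energy_norm p ?\<gamma>A \<Omega> Th v)\<^sup>2) \<and>
          (\<forall>u \<in> Vh p \<Omega> Th. \<forall>v \<in> Vh p \<Omega> Th.
            A_form p \<Omega> Th \<Psi> \<mu>\<^sub>e ?\<gamma>A \<gamma>_D ubar u v
              \<le> C_s \<gamma>_D * energy_norm p ?\<gamma>A \<Omega> Th u * energy_norm p ?\<gamma>A \<Omega> Th v)"
        using \<mu> A_form_bounded \<gamma>_D \<gamma>\<^sub>0_pos
          A_form_coercive[OF _ h c(3) penalty_infimum(2)[folded \<eta>_min] \<epsilon> \<gamma>_D[unfolded \<gamma>\<^sub>0 \<Gamma>_def]]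
        unfolding c_s_def C_s_def by auto
    qed
    show "\<exists>c_s>0. \<forall>\<gamma>_D\<ge>\<gamma>\<^sub>0. \<exists>C_s>0. ?claim \<sigma> c_L C_L \<eta>_min \<eta>_max \<gamma>_D c_s C_s"
    proof (rule exI[of _ c_s], intro conjI c_s allI impI)
      fix \<gamma>_D assume \<gamma>_D: "\<gamma>\<^sub>0 \<le> \<gamma>_D"
      show "\<exists>C_s>0. ?claim \<sigma> c_L C_L \<eta>_min \<eta>_max \<gamma>_D c_s C_s"
        by (rule exI[of _ "C_s \<gamma>_D"], rule conjI[OF C_s[OF \<gamma>_D] claim[OF \<gamma>_D]])
    qed
  qed
qed

end
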